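(* Let $G:=\Gamma(1/4)$, $\mathbf{a}_4=(2-2i,\,2+2i,\,1-i,\,1+i)$ and $\boldsymbol{\sigma}_4=(1,1,-1,-1)$. For every integer $m\ge1$, $$\Gamma(4m+1)\sum_{j=1}^4 i^{\,j-2}\,\zeta_4\left(4m+1,3+i^j\,|\,\mathbf{a}_4;\boldsymbol{\sigma}_4\right)\in\mathbb{Q}\frac{G^{8m}}{\pi^{2m}}+\mathbb{Q}\frac{G^{8m+4}}{\pi^{2m+2}},$$ $$\Gamma(4m-1)\sum_{j=1}^4(-i)^{j-2}\,\zeta_4\left(4m-1,3+i^j\,|\,\mathbf{a}_4;\boldsymbol{\sigma}_4\right)\in\mathbb{Q}\frac{G^{8m-4}}{\pi^{2m-1}}+\mathbb{Q}\frac{G^{8m}}{\pi^{2m+1}},$$ $$\Gamma(4m+1)\sum_{j=1}^4(-i)^{j-2}\,\zeta_4\left(4m+1,3+i^j\,|\,\mathbf{a}_4\right)\in\mathbb{Q}\frac{G^{8m}}{\pi^{2m}}+\mathbb{Q}\frac{G^{8m+4}}{\pi^{2m+2}},$$ and for every integer $m\ge2$, $$\Gamma(4m-1)\sum_{j=1}^4 i^{\,j-2}\,\zeta_4\left(4m-1,3+i^j\,|\,\mathbf{a}_4\right)\in\mathbb{Q}\frac{G^{8m-4}}{\pi^{2m-1}}+\mathbb{Q}\frac{G^{8m}}{\pi^{2m+1}}.$$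
   Context: For $\mathbf{a}_N=(a_1,\dots,a_N)$ with $\Re(a_j)>0$, signs $\boldsymbol{\sigma}_N=(\sigma_1,\dots,\sigma_N)\in\{\pm1\}^N$, $\Re(\omega)>0$ and $\Re(s)>N$, the generalized Barnes multiple zeta function is $$\zeta_N(s,\omega\,|\,\mathbf{a}_N;\boldsymbol{\sigma}_N):=\sum_{n_1\ge0,\dots,n_N\ge0}\frac{\sigma_1^{n_1}\cdots\sigma_N^{n_N}}{(\omega+n_1a_1+\cdots+n_Na_N)^s},$$ and $\zeta_N(s,\omega\,|\,\mathbf{a}_N)$ denotes the case where all $\sigma_j=1$ (the Barnes multiple zeta function). For real $s$ outside the range of absolute convergence (only $s=3$, $N=4$, $\boldsymbol{\sigma}_4=(1,1,-1,-1)$ is needed, in the second assertion with $m=1$), the value is understood through the (analytically continuing) integral representation $$\zeta_N(s,\omega\,|\,\mathbf{a}_N;\boldsymbol{\sigma}_N)=\frac1{\Gamma(s)}\int_0^\infty u^{s-1}e^{-\omega u}\prod_{j=1}^N(1-\sigma_je^{-a_ju})^{-1}\,du,$$ which converges in that case. $i$ is the imaginary unit, $\Gamma(\cdot)$ is the Euler Gamma function, and $\mathbb{Q}A+\mathbb{Q}B:=\{rA+tB: r,t\in\mathbb{Q}\}$. *)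

theory Defs
  imports "HOL-Analysis.Analysis"
begin

text \<open>
  The parameters are the lists $[a_1,\dots,a_N]$ and $[\sigma_1,\dots,\sigma_N]$, of the same length
  $N$ and with entries of positive real part and in $\{1,-1\}$ respectively; list indices start at 0.
  A summation index $(n_1,\dots,n_N)$ is a list of naturals of length $N$. The power is the principal
  one, whose base has positive real part. The sum is unordered, i.e. absolutely convergent.
\<close>
definition barnes_zeta_series ::
    "complex \<Rightarrow> complex \<Rightarrow> complex list \<Rightarrow> int list \<Rightarrow> complex" where
  "barnes_zeta_series s \<omega> a \<sigma> =
     (\<Sum>\<^sub>\<infinity>n\<in>{n :: nat list. length n = length a}.
        (\<Prod>j<length a. of_int (\<sigma> ! j) ^ (n ! j)) /
        (\<omega> + (\<Sum>j<length a. of_nat (n ! j) * a ! j)) powr s)"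

definition barnes_zeta_integral ::
    "complex \<Rightarrow> complex \<Rightarrow> complex list \<Rightarrow> int list \<Rightarrow> complex" where
  "barnes_zeta_integral s \<omega> a \<sigma> =
     1 / Gamma s *
     (CLBINT u:{0<..}. of_real u powr (s - 1) * exp (- \<omega> * of_real u) *
        (\<Prod>j<length a. inverse (1 - of_int (\<sigma> ! j) * exp (- (a ! j) * of_real u))))"

text \<open>
  The two expressions agree where the series converges absolutely. Outside the half-plane
  $\Re(s) > N$ the value is meaningful only if the integral converges (otherwise the library
  integral returns the default value 0).
\<close>
definition gen_barnes_zeta ::
    "complex \<Rightarrow> complex \<Rightarrow> complex list \<Rightarrow> int list \<Rightarrow> complex" where
  "gen_barnes_zeta s \<omega> a \<sigma> =
     (if Re s > of_nat (length a) then barnes_zeta_series s \<omega> a \<sigma>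
      else barnes_zeta_integral s \<omega> a \<sigma>)"

definition barnes_zeta :: "complex \<Rightarrow> complex \<Rightarrow> complex list \<Rightarrow> complex" where
  "barnes_zeta s \<omega> a = gen_barnes_zeta s \<omega> a (replicate (length a) 1)"

text \<open>The set $\mathbb{Q}A + \mathbb{Q}B$, as a set of complex numbers.\<close>
definition rat_span2 :: "real \<Rightarrow> real \<Rightarrow> complex set" where
  "rat_span2 A B = {complex_of_real (of_rat r * A + of_rat t * B) | r t :: rat. True}"

end

(*
  Each zeta value is a Mellin integral over the half line. In the combination over j the four
  exponentials add up to hyperbolic and trigonometric functions, and after the rotation
  w = (1 - i) u / 2 the integrand becomes f(w) - i f(i w) with f(w) = w^p / (sin w cos w C(w)^2),
  where C is cosh for the alternating signs and sinh otherwise. Hence the integral is a contour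
  integral around a growing square in the first quadrant, and the residues on its diagonal give
  the series of (-1)^n n^p / C(pi n / 2)^2.

  These series are combinations of the Taylor coefficients, at 1/2 and (1 + i)/2, of sums over
  the Gaussian lattice: if Z is the zeta function of the lattice (corrected to be periodic under
  z -> z + 1) and S = sum (-1)^(m+n) / (z + m + n i), then Z' = - S^2 - pi and S^2 satisfies a
  second-order differential equation, so all coefficients are polynomials in pi and S(1/2)^2 with
  rational coefficients. Inverting S turns S(1/2) into a Beta value, whence
  S(1/2)^2 = Gamma(1/4)^4 / (8 pi).
*)

theory Submission
  imports Defs "HOL-Complex_Analysis.Complex_Analysis"
begin

section \<open>Sums over rows of Gaussian integers\<close>

text \<open>The lattice sums do not converge absolutely, so they are taken along rows, whose closed
  forms decay exponentially. The price is that the symmetry under multiplication by i, which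
  exchanges rows and columns, needs a proof. Identities between lattice functions come from
  Liouville's theorem: once polar parts at 0 and translation laws agree, the difference is constant.
  Classically S^2 is the Weierstrass function of the lattice with g2 = 4 e^2, g3 = 0 and e =
  S(1/2)^2, and Z is the Weierstrass zeta function minus pi z. The bridge to the hyperbolic series
  is the sum of the rows of Z weighted by the row number: its Fourier coefficients are 1/sinh^2, and
  it is quadratic in Z up to Z' and a constant, because its change under z -> z + i matches that of
  Z^2. Even-order coefficients at the half-periods avoid the value of Z there, because the
  derivatives of Z of positive even order vanish at these points. At p = 2 they carry an extra pi^2,
  which cancels for cosh but not for sinh; for the same p the sinh kernel has a pole at 0. This is
  why the fourth assertion starts at m = 2.\<close>

lemma holomorphic_on_infsum:
  fixes f :: "'a \<Rightarrow> complex \<Rightarrow> complex"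
  assumes "open A" and hol: "\<And>n. n \<in> X \<Longrightarrow> f n holomorphic_on A"
    and M: "\<And>n z. n \<in> X \<Longrightarrow> z \<in> A \<Longrightarrow> norm (f n z) \<le> M n" "M summable_on X"
  shows "(\<lambda>z. \<Sum>\<^sub>\<infinity>n\<in>X. f n z) holomorphic_on A"
proof -
  have ul: "uniform_limit A (\<lambda>Y z. \<Sum>n\<in>Y. f n z) (\<lambda>z. \<Sum>\<^sub>\<infinity>n\<in>X. f n z) (finite_subsets_at_top X)"
    by (rule Weierstrass_m_test_general[OF M])
  have ev: "\<forall>\<^sub>F Y in finite_subsets_at_top X. (\<lambda>z. \<Sum>n\<in>Y. f n z) holomorphic_on A"
    by (rule eventually_finite_subsets_at_top_weakI) (auto intro!: holomorphic_on_sum hol)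
  have "\<exists>r>0. (\<lambda>z. \<Sum>\<^sub>\<infinity>n\<in>X. f n z) holomorphic_on ball z r" if zA: "z \<in> A" for z
  proof -
    obtain r where r: "r > 0" "cball z r \<subseteq> A"
      using open_contains_cball[THEN iffD1, OF \<open>open A\<close>, rule_format, OF zA] by auto
    have "(\<lambda>z. \<Sum>\<^sub>\<infinity>n\<in>X. f n z) holomorphic_on ball z r"
    proof (rule holomorphic_uniform_limit)
      show "uniform_limit (cball z r) (\<lambda>Y z. \<Sum>n\<in>Y. f n z) (\<lambda>z. \<Sum>\<^sub>\<infinity>n\<in>X. f n z) (finite_subsets_at_top X)"
        by (rule uniform_limit_on_subset[OF ul r(2)])
      show "\<forall>\<^sub>F Y in finite_subsets_at_top X. continuous_on (cball z r) (\<lambda>z. \<Sum>n\<in>Y. f n z) \<and>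
          (\<lambda>z. \<Sum>n\<in>Y. f n z) holomorphic_on ball z r"
        using ev
      proof eventually_elim
        case (elim Y)
        have "ball z r \<subseteq> A" using r ball_subset_cball by blast
        then show ?case using elim r(2) holomorphic_on_subset holomorphic_on_imp_continuous_on by metis
      qed
    qed auto
    with r show ?thesis by blast
  qed
  then show ?thesis
    by (metis \<open>open A\<close> analytic_imp_holomorphic analytic_on_def)
qed

lemma summable_on_exp_int: "(\<lambda>n::int. exp (- real_of_int \<bar>n\<bar>)) summable_on UNIV"
proof -
  have s: "(\<lambda>n::nat. exp (- real n)) summable_on UNIV"
  proof (rule norm_summable_imp_summable_on)
    have "summable (\<lambda>n::nat. exp (- 1 :: real) ^ n)" by (rule summable_geometric) simp
    then show "summable (\<lambda>n. norm (exp (- real n)))"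
      by (simp add: exp_of_nat_mult[symmetric])
  qed
  have 1: "(\<lambda>n::int. exp (- real_of_int \<bar>n\<bar>)) summable_on range int"
    using s by (subst summable_on_reindex) (auto simp: o_def)
  have 2: "(\<lambda>n::int. exp (- real_of_int \<bar>n\<bar>)) summable_on range (\<lambda>n. - int n)"
    using s by (subst summable_on_reindex) (auto simp: o_def inj_def)
  have U: "UNIV = range int \<union> (range (\<lambda>n. - int n) - range int)"
  proof -
    have "n \<in> range int \<union> range (\<lambda>n. - int n)" for n :: int
      by (cases n rule: int_cases2) auto
    then show ?thesis by blast
  qed
  show ?thesis
    by (subst U, rule summable_on_Un_disjoint[OF 1 summable_on_subset_banach[OF 2]]) auto
qed

text \<open>The poles of row n lie at height -n, so in the strip
  \<open>\<bar>Im z\<bar> \<le> K\<close> only the rows with \<open>\<bar>n\<bar> < K + 1\<close>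
  can be singular. These are finitely many and are exempt from the bound; the others have a majorant
  independent of z.\<close>

definition row_decay :: "(int \<Rightarrow> complex \<Rightarrow> complex) \<Rightarrow> bool" where
  "row_decay \<phi> \<longleftrightarrow> (\<forall>n. \<phi> n holomorphic_on {z. z + \<i> * of_int n \<notin> \<int>}) \<and>
     (\<forall>K. \<exists>M. M summable_on UNIV \<and>
        (\<forall>n z. \<bar>Im z\<bar> \<le> K \<longrightarrow> K + 1 \<le> \<bar>real_of_int n\<bar> \<longrightarrow> norm (\<phi> n z) \<le> M n))"

lemma finite_int_abs_less: "finite {n::int. \<bar>real_of_int n\<bar> < K}"
proof (rule finite_subset)
  show "{n::int. \<bar>real_of_int n\<bar> < K} \<subseteq> {-\<lceil>K\<rceil>..\<lceil>K\<rceil>}" by (auto; linarith)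
qed auto

text \<open>No condition keeps z away from the poles: only finitely many rows escape the majorant,
  and a finite sum is summable whatever its terms are, including those given by division by
  zero.\<close>

lemma row_decay_summable:
  assumes "row_decay \<phi>" shows "(\<lambda>n. \<phi> n z) summable_on A"
proof -
  let ?B = "{n::int. \<bar>real_of_int n\<bar> < \<bar>Im z\<bar> + 1}"
  obtain M where M: "M summable_on UNIV"
    "\<And>n. \<bar>Im z\<bar> + 1 \<le> \<bar>real_of_int n\<bar> \<Longrightarrow> norm (\<phi> n z) \<le> M n"
    using assms[unfolded row_decay_def, THEN conjunct2, rule_format, of "\<bar>Im z\<bar>"] by auto
  have "(\<lambda>n. \<phi> n z) summable_on (-?B)"
    by (rule abs_summable_summable,
        rule Infinite_Sum.abs_summable_on_comparison_test'[OF summable_on_subset_banach[OF M(1)]]) (use M(2) in auto)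
  moreover have "(\<lambda>n. \<phi> n z) summable_on ?B" by (simp add: finite_int_abs_less)
  ultimately have "(\<lambda>n. \<phi> n z) summable_on (?B \<union> -?B)"
    by (intro summable_on_Un_disjoint) auto
  then show ?thesis by (rule summable_on_subset_banach) auto
qed

lemma open_row_compl: "open {z. z + \<i> * of_int n \<notin> \<int>}"
proof -
  have "{z. z + \<i> * of_int n \<notin> \<int>} = (\<lambda>z::complex. z + \<i> * of_int n) -` (- \<int>)" by auto
  also have "open \<dots>" by (intro continuous_open_vimage) (auto intro!: continuous_intros)
  finally show ?thesis .
qed

text \<open>On each strip the sum is a finite sum of rows plus a tail controlled by the M-test. The
  index set A is free so that the result covers both the full sum off the lattice and the sum
  without row 0, which is regular near 0.\<close>

lemma row_decay_holomorphic:
  assumes "row_decay \<phi>"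
  shows "(\<lambda>z. \<Sum>\<^sub>\<infinity>n\<in>A. \<phi> n z) holomorphic_on {z. \<forall>n\<in>A. z + \<i> * of_int n \<notin> \<int>}"
proof -
  have *: "(\<lambda>z. \<Sum>\<^sub>\<infinity>n\<in>A. \<phi> n z) holomorphic_on
      ({z. \<bar>Im z\<bar> < K} \<inter> (\<Inter>n\<in>{n\<in>A. \<bar>real_of_int n\<bar> < K + 1}. {z. z + \<i> * of_int n \<notin> \<int>}))"
     (is "_ holomorphic_on ?U") for K
  proof -
    let ?B = "{n\<in>A. \<bar>real_of_int n\<bar> < K + 1}"
    obtain M where M: "M summable_on UNIV"
      "\<And>n z. \<bar>Im z\<bar> \<le> K \<Longrightarrow> K + 1 \<le> \<bar>real_of_int n\<bar> \<Longrightarrow> norm (\<phi> n z) \<le> M n"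
      using assms[unfolded row_decay_def, THEN conjunct2, rule_format, of K] by auto
    have fin: "finite ?B" by (rule finite_subset[OF _ finite_int_abs_less[of "K+1"]]) auto
    have op: "open {z. \<bar>Im z\<bar> < K}"
    proof -
      have "{z. \<bar>Im z\<bar> < K} = (\<lambda>z. \<bar>Im z\<bar>) -` {..<K}" by auto
      also have "open \<dots>" by (intro continuous_open_vimage) (auto intro!: continuous_intros)
      finally show ?thesis .
    qed
    have opU: "open ?U" by (intro open_Int op open_INT ballI open_row_compl fin)
    have "(\<lambda>z. \<Sum>\<^sub>\<infinity>n\<in>A - ?B. \<phi> n z) holomorphic_on ?U"
    proof (rule holomorphic_on_infsum[OF opU])
      show "\<phi> n holomorphic_on ?U" if "n \<in> A - ?B" for n
      proof -
        have "\<phi> n holomorphic_on {z. z + \<i> * of_int n \<notin> \<int>}" using assms unfolding row_decay_def by blast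
        moreover have "?U \<subseteq> {z. z + \<i> * of_int n \<notin> \<int>}"
        proof clarify
          fix z assume z: "\<bar>Im z\<bar> < K" and "z + \<i> * of_int n \<in> \<int>"
          then have "Im (z + \<i> * of_int n) = 0" by (metis Ints_cases Im_complex_of_real of_real_of_int_eq)
          with z that show False by auto
        qed
        ultimately show ?thesis using holomorphic_on_subset by blast
      qed
      show "norm (\<phi> n z) \<le> M n" if "n \<in> A - ?B" "z \<in> ?U" for n z
        using that M(2)[of z n] by auto
      show "M summable_on A - ?B" by (rule summable_on_subset_banach[OF M(1)]) auto
    qed
    moreover have "(\<lambda>z. \<Sum>n\<in>?B. \<phi> n z) holomorphic_on ?U"
    proof (rule holomorphic_on_sum)
      fix n assume n: "n \<in> ?B"
      have "\<phi> n holomorphic_on {z. z + \<i> * of_int n \<notin> \<int>}" using assms unfolding row_decay_def by blast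
      then show "\<phi> n holomorphic_on ?U" by (rule holomorphic_on_subset) (use n in auto)
    qed
    ultimately have "(\<lambda>z. (\<Sum>n\<in>?B. \<phi> n z) + (\<Sum>\<^sub>\<infinity>n\<in>A - ?B. \<phi> n z)) holomorphic_on ?U"
      by (intro holomorphic_on_add)
    moreover have "(\<Sum>\<^sub>\<infinity>n\<in>A. \<phi> n z) = (\<Sum>n\<in>?B. \<phi> n z) + (\<Sum>\<^sub>\<infinity>n\<in>A - ?B. \<phi> n z)" for z
    proof -
      have "(\<Sum>\<^sub>\<infinity>n\<in>?B \<union> (A - ?B). \<phi> n z) = (\<Sum>\<^sub>\<infinity>n\<in>?B. \<phi> n z) + (\<Sum>\<^sub>\<infinity>n\<in>A - ?B. \<phi> n z)"
        by (rule infsum_Un_disjoint) (auto intro!: row_decay_summable assms)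
      moreover have "?B \<union> (A - ?B) = A" by auto
      ultimately show ?thesis using fin by simp
    qed
    ultimately show ?thesis by simp
  qed
  show ?thesis
    unfolding holomorphic_on_def
  proof
    fix z assume z: "z \<in> {z. \<forall>n\<in>A. z + \<i> * of_int n \<notin> \<int>}"
    let ?K = "\<bar>Im z\<bar> + 1"
    let ?U = "{z. \<bar>Im z\<bar> < ?K} \<inter> (\<Inter>n\<in>{n\<in>A. \<bar>real_of_int n\<bar> < ?K + 1}. {z. z + \<i> * of_int n \<notin> \<int>})"
    have fin: "finite {n\<in>A. \<bar>real_of_int n\<bar> < ?K + 1}"
      by (rule finite_subset[OF _ finite_int_abs_less[of "?K+1"]]) auto
    have op: "open {z. \<bar>Im z\<bar> < c}" for c
    proof -
      have "{z. \<bar>Im z\<bar> < c} = (\<lambda>z. \<bar>Im z\<bar>) -` {..<c}" by auto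
      also have "open \<dots>" by (intro continuous_open_vimage) (auto intro!: continuous_intros)
      finally show ?thesis .
    qed
    have "open ?U" by (intro open_Int op open_INT ballI open_row_compl fin)
    moreover have "z \<in> ?U" using z by auto
    ultimately have "(\<lambda>z. \<Sum>\<^sub>\<infinity>n\<in>A. \<phi> n z) field_differentiable at z"
      using *[of ?K] holomorphic_on_imp_differentiable_at by blast
    then show "(\<lambda>z. \<Sum>\<^sub>\<infinity>n\<in>A. \<phi> n z) field_differentiable at z within {z. \<forall>n\<in>A. z + \<i> * of_int n \<notin> \<int>}"
      by (rule field_differentiable_at_within)
  qed
qed

text \<open>With t = pi * |Im u| the reverse triangle inequality gives exp t - exp (-t), and t \<ge>
  1 makes exp t \<ge> 2, so at least half of exp t survives.\<close>

lemma exp_pi_Im_le_norm_sin: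
  assumes "1 \<le> \<bar>Im u\<bar>" shows "exp (pi * \<bar>Im u\<bar>) / 4 \<le> norm (sin (of_real pi * u))"
proof -
  let ?t = "pi * \<bar>Im u\<bar>"
  have "norm (exp (\<i> * (of_real pi * u)) - exp (- (\<i> * (of_real pi * u)))) \<ge>
      \<bar>norm (exp (\<i> * (of_real pi * u))) - norm (exp (- (\<i> * (of_real pi * u))))\<bar>"
    by (rule norm_triangle_ineq3)
  also have "\<bar>norm (exp (\<i> * (of_real pi * u))) - norm (exp (- (\<i> * (of_real pi * u))))\<bar> = exp ?t - exp (- ?t)"
  proof (cases "Im u \<ge> 0")
    case True
    have "exp (- (pi * Im u)) \<le> exp (pi * Im u)" using True by simp
    then show ?thesis using True by simp
  next
    case False
    then have "exp (pi * Im u) \<le> exp (- (pi * Im u))" by (simp add: mult_nonneg_nonpos)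
    then show ?thesis using False by simp
  qed
  finally have 1: "exp ?t - exp (- ?t) \<le> 2 * norm (sin (of_real pi * u))"
    by (simp add: sin_exp_eq norm_divide norm_mult)
  have "1 \<le> ?t" using mult_mono[of 1 pi 1 "\<bar>Im u\<bar>"] assms pi_gt3 by simp
  then have "1 + 1 \<le> exp ?t" using exp_ge_add_one_self[of ?t] by linarith
  moreover have "exp (- ?t) \<le> 1" using \<open>1 \<le> ?t\<close> by simp
  ultimately have "exp ?t / 2 \<le> exp ?t - exp (- ?t)" by linarith
  with 1 show ?thesis by linarith
qed

lemma sin_pi_eq_0_iff: "sin (of_real pi * u) = 0 \<longleftrightarrow> u \<in> (\<int> :: complex set)"
proof
  assume "sin (of_real pi * u) = 0"
  then obtain n :: int where "of_real pi * u = of_real (of_int n * pi)" by (auto simp: Complex_Transcendental.sin_eq_0)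
  then have "u = of_int n" by simp
  then show "u \<in> \<int>" by simp
next
  assume "u \<in> \<int>"
  then obtain n where "u = of_int n" by (auto elim: Ints_cases)
  then have "of_real pi * u = of_real (of_int n * pi)" by simp
  then show "sin (of_real pi * u) = 0" unfolding Complex_Transcendental.sin_eq_0 by blast
qed

definition csc_row :: "int \<Rightarrow> complex \<Rightarrow> complex" where
  "csc_row n z = (if even n then 1 else -1) * of_real pi / sin (of_real pi * (z + \<i> * of_int n))"

definition cot_row :: "int \<Rightarrow> complex \<Rightarrow> complex" where
  "cot_row n z = of_real pi * cot (of_real pi * (z + \<i> * of_int n)) + \<i> * of_real pi * of_int (sgn n)"

text \<open>Every \<^term>\<open>csc_row n z\<close> is the row sum of $(-1)^{m+n}/(z+m+n\mathrm{i})$ over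
  integers $m$, and \<^term>\<open>cot_row n z\<close> that of $1/(z+m+n\mathrm{i})$, up to the constant
  that makes the sum over rows converge.\<close>

lemma row_decayI:
  assumes hol: "\<And>n. \<phi> n holomorphic_on {z. z + \<i> * of_int n \<notin> \<int>}"
    and C: "\<And>K z n. \<bar>Im z\<bar> \<le> K \<Longrightarrow> K + 1 \<le> \<bar>real_of_int n\<bar> \<Longrightarrow> norm (\<phi> n z) \<le> C K * exp (- \<bar>real_of_int n\<bar>)"
  shows "row_decay \<phi>"
  unfolding row_decay_def
proof (intro conjI allI)
  fix K
  have "(\<lambda>n. C K * exp (- \<bar>real_of_int n\<bar>)) summable_on UNIV"
    using summable_on_exp_int by (intro summable_on_cmult_right) simp
  then show "\<exists>M. M summable_on UNIV \<and> (\<forall>n z. \<bar>Im z\<bar> \<le> K \<longrightarrow> K + 1 \<le> \<bar>real_of_int n\<bar> \<longrightarrow> norm (\<phi> n z) \<le> M n)"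
    using C by blast
qed (rule hol)

lemma exp_pi_bound:
  assumes "\<bar>Im z\<bar> \<le> K" "K + 1 \<le> \<bar>real_of_int n\<bar>"
  shows "exp (- (pi * \<bar>Im z + real_of_int n\<bar>)) \<le> exp (pi * K) * exp (- \<bar>real_of_int n\<bar>)"
    and "1 \<le> \<bar>Im z + real_of_int n\<bar>" and "sgn (Im z + real_of_int n) = real_of_int (sgn n)"
proof -
  show 1: "1 \<le> \<bar>Im z + real_of_int n\<bar>" using assms by linarith
  show "sgn (Im z + real_of_int n) = real_of_int (sgn n)" using assms by (auto simp: sgn_if)
  have "\<bar>real_of_int n\<bar> - K \<le> \<bar>Im z + real_of_int n\<bar>" using assms by linarith
  then have "pi * (\<bar>real_of_int n\<bar> - K) \<le> pi * \<bar>Im z + real_of_int n\<bar>" by simp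
  moreover have "\<bar>real_of_int n\<bar> * 1 \<le> \<bar>real_of_int n\<bar> * pi" using pi_gt3 by (intro mult_left_mono) auto
  ultimately have "\<bar>real_of_int n\<bar> - pi * K \<le> pi * \<bar>Im z + real_of_int n\<bar>" by (simp add: algebra_simps)
  then show "exp (- (pi * \<bar>Im z + real_of_int n\<bar>)) \<le> exp (pi * K) * exp (- \<bar>real_of_int n\<bar>)"
    unfolding exp_add[symmetric] by simp
qed

lemma row_decay_csc: "row_decay csc_row"
proof (rule row_decayI[where C = "\<lambda>K. 4 * pi * exp (pi * K)"])
  show "csc_row n holomorphic_on {z. z + \<i> * of_int n \<notin> \<int>}" for n
    unfolding csc_row_def by (auto intro!: holomorphic_intros simp: sin_pi_eq_0_iff)
next
  fix K z n assume *: "\<bar>Im z\<bar> \<le> K" "K + 1 \<le> \<bar>real_of_int n\<bar>"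
  let ?u = "z + \<i> * of_int n"
  have "exp (pi * \<bar>Im ?u\<bar>) / 4 \<le> norm (sin (of_real pi * ?u))"
    by (rule exp_pi_Im_le_norm_sin) (use exp_pi_bound(2)[OF *] in simp)
  then have "norm (csc_row n z) \<le> pi / (exp (pi * \<bar>Im ?u\<bar>) / 4)"
    unfolding csc_row_def norm_divide norm_mult
    by (simp only: norm_of_real abs_of_pos pi_gt_zero if_distrib[of norm] norm_one norm_minus_cancel if_cancel mult_1_left)
       (intro divide_left_mono mult_pos_pos, auto intro: less_le_trans[of 0 "exp (pi * \<bar>Im ?u\<bar>) / 4"])
  also have "\<dots> = 4 * pi * exp (- (pi * \<bar>Im z + real_of_int n\<bar>))" by (simp add: exp_minus field_simps)
  also have "\<dots> \<le> 4 * pi * (exp (pi * K) * exp (- \<bar>real_of_int n\<bar>))"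
    by (intro mult_left_mono exp_pi_bound(1)[OF *]) auto
  finally show "norm (csc_row n z) \<le> 4 * pi * exp (pi * K) * exp (- \<bar>real_of_int n\<bar>)" by (simp add: mult_ac)
qed

lemma cot_row_holomorphic: "cot_row n holomorphic_on {z. z + \<i> * of_int n \<notin> \<int>}"
  unfolding cot_row_def cot_def by (auto intro!: holomorphic_intros simp: sin_pi_eq_0_iff)

text \<open>Since cos v + i s sin v = exp (i s v) for s = sgn n, the added constant turns the
  cotangent into a small exponential over a large sine. The decay is therefore twice that of
  \<open>csc_row\<close>, which leaves room for the factor n in
  \<open>row_decay_n_cot\<close>.\<close>

lemma cot_row_bound:
  assumes *: "\<bar>Im z\<bar> \<le> K" "K + 1 \<le> \<bar>real_of_int n\<bar>"
  shows "norm (cot_row n z) \<le> 4 * pi * exp (2 * pi * K) * exp (- 2 * \<bar>real_of_int n\<bar>)"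
proof -
  let ?u = "z + \<i> * of_int n"
  let ?t = "\<bar>Im z + real_of_int n\<bar>"
  let ?s = "of_int (sgn n) :: complex"
  have ge: "exp (pi * ?t) / 4 \<le> norm (sin (of_real pi * ?u))"
    using exp_pi_Im_le_norm_sin[of ?u] exp_pi_bound(2)[OF *] by simp
  then have "sin (of_real pi * ?u) \<noteq> 0" by (metis divide_pos_pos exp_gt_zero leD norm_zero zero_less_numeral)
  moreover have "n \<noteq> 0" using * by auto
  then have "cos (of_real pi * ?u) + \<i> * ?s * sin (of_real pi * ?u) = exp (\<i> * ?s * (of_real pi * ?u))"
    by (auto simp: sgn_if exp_Euler[symmetric] exp_minus_Euler[symmetric] mult.commute)
  moreover have "cot_row n z = of_real pi * (cos (of_real pi * ?u) + \<i> * ?s * sin (of_real pi * ?u)) / sin (of_real pi * ?u)"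
    if "sin (of_real pi * ?u) \<noteq> 0"
    using that unfolding cot_row_def cot_def by (simp add: add_divide_distrib distrib_left)
  ultimately have "cot_row n z = pi * exp (\<i> * ?s * (of_real pi * ?u)) / sin (of_real pi * ?u)" by simp
  moreover have "norm (exp (\<i> * ?s * (of_real pi * ?u))) = exp (- (pi * ?t))"
  proof -
    have "real_of_int (sgn n) * (Im z + real_of_int n) = ?t"
      using exp_pi_bound(3)[OF *] by (metis abs_sgn mult.commute)
    moreover have "Re (\<i> * ?s * (of_real pi * ?u)) = - (pi * (real_of_int (sgn n) * (Im z + real_of_int n)))"
      by (simp add: algebra_simps)
    ultimately show ?thesis by (simp add: norm_exp_eq_Re)
  qed
  ultimately have "norm (cot_row n z) = pi * exp (- (pi * ?t)) / norm (sin (of_real pi * ?u))"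
    by (simp add: norm_divide norm_mult)
  also have "\<dots> \<le> pi * exp (- (pi * ?t)) / (exp (pi * ?t) / 4)"
    using ge by (intro divide_left_mono mult_pos_pos) (auto intro: less_le_trans[of 0 "exp (pi * ?t) / 4"])
  also have "\<dots> = 4 * pi * exp (- (pi * ?t)) * exp (- (pi * ?t))" by (simp add: exp_minus field_simps)
  also have "\<dots> \<le> 4 * pi * (exp (pi * K) * exp (- \<bar>real_of_int n\<bar>)) * (exp (pi * K) * exp (- \<bar>real_of_int n\<bar>))"
    by (intro mult_mono mult_left_mono exp_pi_bound(1)[OF *]) auto
  also have "\<dots> = 4 * pi * exp (2 * pi * K) * exp (- 2 * \<bar>real_of_int n\<bar>)"
    by (simp add: exp_add[symmetric] mult.assoc)
  finally show ?thesis .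
qed

lemma row_decay_cot: "row_decay cot_row"
proof (rule row_decayI[where C = "\<lambda>K. 4 * pi * exp (2 * pi * K)"])
  fix K z n assume *: "\<bar>Im z\<bar> \<le> K" "K + 1 \<le> \<bar>real_of_int n\<bar>"
  show "norm (cot_row n z) \<le> 4 * pi * exp (2 * pi * K) * exp (- \<bar>real_of_int n\<bar>)"
    by (rule order.trans[OF cot_row_bound[OF *]], rule mult_left_mono) auto
qed (rule cot_row_holomorphic)

lemma row_decay_n_cot: "row_decay (\<lambda>n z. of_int n * cot_row n z)"
proof (rule row_decayI[where C = "\<lambda>K. 4 * pi * exp (2 * pi * K)"])
  fix K z n assume *: "\<bar>Im z\<bar> \<le> K" "K + 1 \<le> \<bar>real_of_int n\<bar>"
  have "norm (of_int n * cot_row n z) \<le> exp \<bar>real_of_int n\<bar> * (4 * pi * exp (2 * pi * K) * exp (- 2 * \<bar>real_of_int n\<bar>))"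
    unfolding norm_mult
  proof (rule mult_mono)
    show "cmod (of_int n) \<le> exp \<bar>real_of_int n\<bar>" using exp_ge_add_one_self[of "\<bar>real_of_int n\<bar>"] unfolding norm_of_int by linarith
  qed (use cot_row_bound[OF *] in auto)
  also have "\<dots> = 4 * pi * exp (2 * pi * K) * (exp \<bar>real_of_int n\<bar> * exp (- 2 * \<bar>real_of_int n\<bar>))" by simp
  also have "exp \<bar>real_of_int n\<bar> * exp (- 2 * \<bar>real_of_int n\<bar>) = exp (- \<bar>real_of_int n\<bar>)"
    by (simp add: exp_add[symmetric])
  finally show "norm (of_int n * cot_row n z) \<le> 4 * pi * exp (2 * pi * K) * exp (- \<bar>real_of_int n\<bar>)" .
qed (intro holomorphic_intros cot_row_holomorphic)

section \<open>The Gaussian lattice and Liouville's theorem for functions periodic under it\<close>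

definition gauss_ints :: "complex set" where
  "gauss_ints = {z. Re z \<in> \<int> \<and> Im z \<in> \<int>}"

lemma notin_gauss_ints_iff: "z \<notin> gauss_ints \<longleftrightarrow> (\<forall>n::int. z + \<i> * of_int n \<notin> \<int>)"
proof -
  have "z \<in> gauss_ints \<longleftrightarrow> (\<exists>n::int. z + \<i> * of_int n \<in> \<int>)"
  proof
    assume z: "z \<in> gauss_ints"
    then obtain m n where mn: "Re z = of_int m" "Im z = of_int n"
      by (auto simp: gauss_ints_def elim!: Ints_cases)
    then have "z + \<i> * of_int (- n) = of_int m" by (simp add: complex_eq_iff)
    then show "\<exists>n::int. z + \<i> * of_int n \<in> \<int>" by (metis Ints_of_int)
  next
    assume "\<exists>n::int. z + \<i> * of_int n \<in> \<int>"
    then obtain m n where mn: "z + \<i> * of_int n = of_int m" by (auto elim!: Ints_cases)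
    have "Re z = of_int m" "Im z = of_int (- n)"
      using arg_cong[OF mn, of Re] arg_cong[OF mn, of Im] by simp_all
    then show "z \<in> gauss_ints" unfolding gauss_ints_def by simp
  qed
  then show ?thesis by blast
qed

lemma gauss_ints_cases:
  assumes "z \<in> gauss_ints" obtains m n :: int where "z = of_int m + \<i> * of_int n"
  using assms by (auto simp: gauss_ints_def complex_eq_iff elim!: Ints_cases)

lemma gauss_ints_shift: "z + (of_int m + \<i> * of_int n) \<in> gauss_ints \<longleftrightarrow> z \<in> gauss_ints"
  by (auto simp: gauss_ints_def)

lemma gauss_ints_shifts [simp]:
  "z + 1 \<in> gauss_ints \<longleftrightarrow> z \<in> gauss_ints" "z + \<i> \<in> gauss_ints \<longleftrightarrow> z \<in> gauss_ints"
  "- z \<in> gauss_ints \<longleftrightarrow> z \<in> gauss_ints" "\<i> * z \<in> gauss_ints \<longleftrightarrow> z \<in> gauss_ints"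
  by (auto simp: gauss_ints_def minus_in_Ints_iff)

lemma gauss_int_near_0: assumes "z \<in> gauss_ints" "norm z < 1" shows "z = 0"
proof -
  obtain m n :: int where mn: "z = of_int m + \<i> * of_int n" using assms(1) by (rule gauss_ints_cases)
  have "\<bar>real_of_int m\<bar> < 1" "\<bar>real_of_int n\<bar> < 1"
    using abs_Re_le_cmod[of z] abs_Im_le_cmod[of z] assms(2) mn by auto
  then have "m = 0" "n = 0" by linarith+
  then show ?thesis by (simp add: mn)
qed

lemma zero_in_gauss_ints [simp]: "0 \<in> gauss_ints" by (simp add: gauss_ints_def)

lemma closed_gauss_ints: "closed gauss_ints"
proof -
  have "gauss_ints = Re -` \<int> \<inter> Im -` \<int>" by (auto simp: gauss_ints_def)
  also have "closed \<dots>" by (intro closed_Int continuous_closed_vimage closed_Ints) (auto intro!: continuous_intros)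
  finally show ?thesis .
qed

lemma open_gauss_compl: "open (- gauss_ints)" using closed_gauss_ints by (rule open_Compl)

lemma countable_gauss_ints: "countable gauss_ints"
proof -
  have "gauss_ints \<subseteq> (\<lambda>(m, n). of_int m + \<i> * of_int n) ` (UNIV :: (int \<times> int) set)"
    by (auto elim!: gauss_ints_cases)
  then show ?thesis by (rule countable_subset) simp
qed

text \<open>Removing countably many points does not disconnect the plane. Hence a function with zero
  derivative off the lattice is a single constant there.\<close>

lemma connected_gauss_compl: "connected (- gauss_ints)"
  using connected_open_diff_countable[of "UNIV :: complex set" gauss_ints] countable_gauss_ints convex_connected[OF convex_UNIV]
  by (simp add: Compl_eq_Diff_UNIV)

lemma gauss_periodic_shift:
  fixes F :: "complex \<Rightarrow> 'a"
  assumes p: "\<And>z. z \<notin> gauss_ints \<Longrightarrow> F (z + 1) = F z" "\<And>z. z \<notin> gauss_ints \<Longrightarrow> F (z + \<i>) = F z"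
    and z: "z \<notin> gauss_ints"
  shows "F (z + (of_int m + \<i> * of_int n)) = F z"
proof -
  have 1: "F (z + of_int m) = F z" if "z \<notin> gauss_ints" for z m
    using that
  proof (induction m arbitrary: z rule: int_induct[of _ 0])
    case (step1 k)
    have "z + of_int k \<notin> gauss_ints" using step1(3) gauss_ints_shift[of z k 0] by simp
    then show ?case using p(1)[of "z + of_int k"] step1 by (simp add: add.assoc)
  next
    case (step2 k)
    have "z + of_int (k - 1) \<notin> gauss_ints" using step2(3) gauss_ints_shift[of z "k - 1" 0] by simp
    then show ?case using p(1)[of "z + of_int (k - 1)"] step2 by simp
  qed simp
  have 2: "F (z + \<i> * of_int n) = F z" if "z \<notin> gauss_ints" for z n
    using that
  proof (induction n arbitrary: z rule: int_induct[of _ 0])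
    case (step1 k)
    have "z + \<i> * of_int k \<notin> gauss_ints" using step1(3) gauss_ints_shift[of z 0 k] by simp
    then show ?case using p(2)[of "z + \<i> * of_int k"] step1 by (simp add: algebra_simps)
  next
    case (step2 k)
    have "z + \<i> * of_int (k - 1) \<notin> gauss_ints" using step2(3) gauss_ints_shift[of z 0 "k - 1"] by simp
    then show ?case using p(2)[of "z + \<i> * of_int (k - 1)"] step2 by (simp add: algebra_simps)
  qed simp
  have "z + of_int m \<notin> gauss_ints" using z gauss_ints_shift[of z m 0] by simp
  with 1[OF z, of m] 2[of "z + of_int m" n] show ?thesis by (simp add: add.assoc)
qed

text \<open>An elliptic function without poles is constant. The function g removes the singularity
  at 0 and, by periodicity, at every lattice point; the resulting entire function takes all its
  values on the unit square, so it is bounded.\<close>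

lemma gauss_periodic_constant:
  assumes hol: "F holomorphic_on - gauss_ints"
    and p: "\<And>z. z \<notin> gauss_ints \<Longrightarrow> F (z + 1) = F z" "\<And>z. z \<notin> gauss_ints \<Longrightarrow> F (z + \<i>) = F z"
    and g: "g holomorphic_on ball 0 1" "\<And>z. z \<in> ball 0 1 - {0} \<Longrightarrow> F z = g z"
    and z: "z \<notin> gauss_ints"
  shows "F z = g 0"
proof -
  define H where "H z = (if z \<in> gauss_ints then g 0 else F z)" for z
  have Hshift: "H (z + (of_int m + \<i> * of_int n)) = H z" for z m n
    using gauss_periodic_shift[of F z m n] p by (auto simp: H_def gauss_ints_shift)
  have "H field_differentiable at z" for z
  proof (cases "z \<in> gauss_ints")
    case False
    have "H holomorphic_on - gauss_ints"
      by (rule holomorphic_transform[OF hol]) (simp add: H_def)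
    then show ?thesis
      using False open_gauss_compl by (metis ComplI holomorphic_on_imp_differentiable_at)
  next
    case True
    then obtain m n :: int where mn: "z = of_int m + \<i> * of_int n" by (rule gauss_ints_cases)
    have "(\<lambda>w. w - z) ` ball z 1 \<subseteq> ball 0 1" by (auto simp: dist_norm norm_minus_commute)
    then have "(\<lambda>w. g (w - z)) holomorphic_on ball z 1"
      using holomorphic_on_compose_gen[of "\<lambda>w. w - z" "ball z 1" g "ball 0 1"] g(1)
      by (simp add: o_def holomorphic_intros)
    then have "H holomorphic_on ball z 1"
    proof (rule holomorphic_transform)
      fix x assume x: "x \<in> ball z 1"
      have "g y = H y" if "y \<in> ball 0 1" for y
        using that g(2)[of y] gauss_int_near_0[of y] by (cases "y = 0") (auto simp: H_def)
      then have "g (x - z) = H (x - z)" using x by (auto simp: dist_norm norm_minus_commute)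
      also have "\<dots> = H x" using Hshift[of "x - z" m n] mn by simp
      finally show "g (x - z) = H x" .
    qed
    then show ?thesis by (rule holomorphic_on_imp_differentiable_at) auto
  qed
  then have ent: "H holomorphic_on UNIV" by (simp add: holomorphic_on_def field_differentiable_at_within)
  have "compact (H ` cbox 0 (1 + \<i>))"
    using ent holomorphic_on_imp_continuous_on continuous_on_subset by (intro compact_continuous_image) (blast, simp)
  moreover have "range H \<subseteq> H ` cbox 0 (1 + \<i>)"
  proof (clarify)
    fix z
    let ?m = "\<lfloor>Re z\<rfloor>" and ?n = "\<lfloor>Im z\<rfloor>"
    have "H z = H (z + (of_int (- ?m) + \<i> * of_int (- ?n)))" by (simp only: Hshift)
    moreover have "z + (of_int (- ?m) + \<i> * of_int (- ?n)) \<in> cbox 0 (1 + \<i>)"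
      by (simp add: in_cbox_complex_iff; linarith)
    ultimately show "H z \<in> H ` cbox 0 (1 + \<i>)" by blast
  qed
  ultimately have "bounded (range H)" using bounded_subset compact_imp_bounded by blast
  then obtain c where "\<And>z. H z = c"
    using Liouville_theorem[OF ent] by (auto simp: constant_on_def)
  then have "H z = H 0" by simp
  then show ?thesis using z by (simp add: H_def)
qed

lemma odd_at_0:
  fixes g :: "complex \<Rightarrow> complex"
  assumes "g holomorphic_on ball 0 1" "\<And>z. z \<in> ball 0 1 - {0} \<Longrightarrow> g (- z) = - g z"
  shows "g 0 = 0"
proof -
  have c: "isCont g 0"
    using assms(1) by (intro continuous_on_interior[of "ball 0 1"] holomorphic_on_imp_continuous_on) auto
  have "g \<midarrow>0\<rightarrow> g 0" using c by (simp add: isCont_def)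
  moreover have "(\<lambda>z. - g z) \<midarrow>0\<rightarrow> g 0"
  proof (rule Lim_transform_within_open[of "\<lambda>z. g (- z)" _ _ _ "ball 0 1"])
    have "isCont (\<lambda>z. g (- z)) 0" by (rule isCont_o2[where g = g]) (use c in auto)
    then show "(\<lambda>z. g (- z)) \<midarrow>0\<rightarrow> g 0" by (simp add: isCont_def)
  qed (use assms(2) in auto)
  ultimately have "(\<lambda>z. g z + - g z) \<midarrow>0\<rightarrow> g 0 + g 0" by (rule tendsto_add)
  then have "g 0 + g 0 = 0" by (simp add: tendsto_const_iff)
  then show ?thesis by simp
qed

text \<open>The square of F is periodic, hence equal to the constant (g 0)^2, and oddness forces g 0
  = 0. This is the form needed for \<open>gauss_csc\<close>, which changes sign under both
  translations.\<close>

lemma gauss_antiperiodic_odd_zero: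
  assumes hol: "F holomorphic_on - gauss_ints"
    and p: "\<And>z. z \<notin> gauss_ints \<Longrightarrow> F (z + 1) = - F z" "\<And>z. z \<notin> gauss_ints \<Longrightarrow> F (z + \<i>) = - F z"
    and odd: "\<And>z. z \<notin> gauss_ints \<Longrightarrow> F (- z) = - F z"
    and g: "g holomorphic_on ball 0 1" "\<And>z. z \<in> ball 0 1 - {0} \<Longrightarrow> F z = g z"
    and z: "z \<notin> gauss_ints"
  shows "F z = 0"
proof -
  have "(F z)\<^sup>2 = (g 0)\<^sup>2"
    using p g by (intro gauss_periodic_constant[where F = "\<lambda>z. (F z)\<^sup>2" and g = "\<lambda>z. (g z)\<^sup>2"] z)
      (auto intro!: holomorphic_intros hol)
  moreover have "g 0 = 0"
  proof (rule odd_at_0[OF g(1)])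
    fix z :: complex assume z: "z \<in> ball 0 1 - {0}"
    then have "z \<notin> gauss_ints" using gauss_int_near_0 by auto
    then show "g (- z) = - g z" using odd[of z] g(2)[of z] g(2)[of "- z"] z by auto
  qed
  ultimately show ?thesis by simp
qed

section \<open>Principal parts at 0 and behaviour under lattice translations\<close>

lemma holomorphic_factor_0:
  fixes f :: "complex \<Rightarrow> complex"
  assumes "f holomorphic_on ball 0 1" "f 0 = 0"
  obtains g where "g holomorphic_on ball 0 1" "\<And>z. f z = z * g z" "g 0 = deriv f 0"
proof
  let ?g = "\<lambda>z. if z = 0 then deriv f 0 else (f z - f 0) / (z - 0)"
  show "?g holomorphic_on ball 0 1" by (rule pole_lemma[OF assms(1)]) simp
  show "f z = z * ?g z" for z using assms(2) by auto
qed auto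

text \<open>Write sin (pi z) = z h(z) with h(0) = pi. As h has no zero in the unit disc, dividing by
  h leaves a simple pole with residue 1 and a holomorphic rest.\<close>

lemma row0_laurent:
  obtains s c where "s holomorphic_on ball 0 1" "c holomorphic_on ball 0 1"
    "\<And>z. z \<in> ball 0 1 - {0} \<Longrightarrow> csc_row 0 z = 1 / z + s z"
    "\<And>z. z \<in> ball 0 1 - {0} \<Longrightarrow> cot_row 0 z = 1 / z + c z"
proof -
  have "(\<lambda>z. sin (of_real pi * z)) holomorphic_on ball 0 1" by (intro holomorphic_intros)
  then obtain h where h: "h holomorphic_on ball 0 1" "\<And>z. sin (of_real pi * z) = z * h z"
      "h 0 = deriv (\<lambda>z. sin (of_real pi * z)) 0"
    using holomorphic_factor_0[of "\<lambda>z. sin (of_real pi * z)"] by auto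
  have "((\<lambda>z. sin (of_real pi * z)) has_field_derivative of_real pi) (at 0)"
    by (auto intro!: derivative_eq_intros)
  then have h0: "h 0 = of_real pi" using h(3) DERIV_imp_deriv by metis
  have hnz: "h z \<noteq> 0" if "z \<in> ball 0 1" for z
  proof (cases "z = 0")
    case False
    then have "z \<notin> \<int>" using that by (auto elim!: Ints_cases simp flip: of_int_abs)
    then have "sin (of_real pi * z) \<noteq> 0" by (simp add: sin_pi_eq_0_iff)
    then show ?thesis using h(2)[of z] by auto
  qed (use h0 in auto)
  obtain k where k: "k holomorphic_on ball 0 1" "\<And>z. of_real pi - h z = z * k z"
    by (rule holomorphic_factor_0[of "\<lambda>z. of_real pi - h z"]) (use h0 in \<open>auto intro!: holomorphic_intros h(1)\<close>)
  obtain l where l: "l holomorphic_on ball 0 1" "\<And>z. cos (of_real pi * z) - 1 = z * l z"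
    by (rule holomorphic_factor_0[of "\<lambda>z. cos (of_real pi * z) - 1"]) (auto intro!: holomorphic_intros)
  show ?thesis
  proof (rule that)
    show "(\<lambda>z. k z / h z) holomorphic_on ball 0 1" using k(1) h(1) hnz by (intro holomorphic_intros) auto
    show "(\<lambda>z. of_real pi * l z / h z + k z / h z) holomorphic_on ball 0 1"
      using k(1) l(1) h(1) hnz by (intro holomorphic_intros) auto
    fix z :: complex assume z: "z \<in> ball 0 1 - {0}"
    then have nz: "h z \<noteq> 0" "z \<noteq> 0" using hnz by auto
    show "csc_row 0 z = 1 / z + k z / h z"
      using nz h(2)[of z] k(2)[of z] by (simp add: csc_row_def divide_simps) (simp add: algebra_simps)
    have "cos (of_real pi * z) = 1 + z * l z" "of_real pi = h z + z * k z"
      using l(2)[of z] k(2)[of z] by (simp_all add: algebra_simps)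
    then show "cot_row 0 z = 1 / z + (of_real pi * l z / h z + k z / h z)"
      using nz h(2)[of z] by (simp add: cot_row_def cot_def divide_simps) (simp add: algebra_simps)
  qed
qed

text \<open>The function S of the overview. In terms of the lemniscate sine sl it is z -> b / sl (b
  z) with b = S(1/2).\<close>

definition gauss_csc :: "complex \<Rightarrow> complex" where
  "gauss_csc z = (\<Sum>\<^sub>\<infinity>n. csc_row n z)"

definition gauss_cot :: "complex \<Rightarrow> complex" where
  "gauss_cot z = (\<Sum>\<^sub>\<infinity>n. cot_row n z)"

text \<open>The weight n is what produces 1/sinh^2: summing n q^(n k) over n > 0 gives q^k / (1 -
  q^k)^2.\<close>

definition gauss_cot1 :: "complex \<Rightarrow> complex" where
  "gauss_cot1 z = (\<Sum>\<^sub>\<infinity>n. of_int n * cot_row n z)"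

lemma rows_compl: "{z. \<forall>n\<in>UNIV. z + \<i> * of_int n \<notin> \<int>} = - gauss_ints"
  using notin_gauss_ints_iff by auto

lemma gauss_csc_holomorphic: "gauss_csc holomorphic_on - gauss_ints"
  using row_decay_holomorphic[OF row_decay_csc, of UNIV] unfolding rows_compl gauss_csc_def by simp

lemma gauss_cot_holomorphic: "gauss_cot holomorphic_on - gauss_ints"
  using row_decay_holomorphic[OF row_decay_cot, of UNIV] unfolding rows_compl gauss_cot_def by simp

lemma ball_subset_rows: "ball 0 1 \<subseteq> {z. \<forall>n\<in>-{0}. z + \<i> * of_int n \<notin> \<int>}"
proof clarify
  fix z :: complex and n :: int
  assume z: "z \<in> ball 0 1" and n: "n \<noteq> 0" "z + \<i> * of_int n \<in> \<int>"
  have "Im (z + \<i> * of_int n) = 0" using n(2) by (metis Ints_cases Im_complex_of_real of_real_of_int_eq)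
  then have "\<bar>real_of_int n\<bar> < 1" using abs_Im_le_cmod[of z] z by auto
  then show False using n(1) by linarith
qed

lemma infsum_int_split_0:
  assumes "row_decay \<phi>" shows "(\<Sum>\<^sub>\<infinity>n. \<phi> n z) = \<phi> 0 z + (\<Sum>\<^sub>\<infinity>n\<in>-{0}. \<phi> n z)"
proof -
  have "(\<Sum>\<^sub>\<infinity>n\<in>{0} \<union> -{0}. \<phi> n z) = (\<Sum>\<^sub>\<infinity>n\<in>{0}. \<phi> n z) + (\<Sum>\<^sub>\<infinity>n\<in>-{0}. \<phi> n z)"
    by (rule infsum_Un_disjoint) (auto intro!: row_decay_summable assms)
  then show ?thesis by simp
qed

lemma gauss_laurent:
  obtains s c where "s holomorphic_on ball 0 1" "c holomorphic_on ball 0 1"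
    "\<And>z. z \<in> ball 0 1 - {0} \<Longrightarrow> gauss_csc z = 1 / z + s z"
    "\<And>z. z \<in> ball 0 1 - {0} \<Longrightarrow> gauss_cot z = 1 / z + c z"
proof -
  obtain s c where sc: "s holomorphic_on ball 0 1" "c holomorphic_on ball 0 1"
    "\<And>z. z \<in> ball 0 1 - {0} \<Longrightarrow> csc_row 0 z = 1 / z + s z"
    "\<And>z. z \<in> ball 0 1 - {0} \<Longrightarrow> cot_row 0 z = 1 / z + c z" by (rule row0_laurent) (rule that; blast)
  show ?thesis
  proof (rule that)
    show "(\<lambda>z. s z + (\<Sum>\<^sub>\<infinity>n\<in>-{0}. csc_row n z)) holomorphic_on ball 0 1"
      by (intro holomorphic_intros sc holomorphic_on_subset[OF row_decay_holomorphic[OF row_decay_csc] ball_subset_rows])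
    show "(\<lambda>z. c z + (\<Sum>\<^sub>\<infinity>n\<in>-{0}. cot_row n z)) holomorphic_on ball 0 1"
      by (intro holomorphic_intros sc holomorphic_on_subset[OF row_decay_holomorphic[OF row_decay_cot] ball_subset_rows])
  qed (use sc infsum_int_split_0[OF row_decay_csc] infsum_int_split_0[OF row_decay_cot] in \<open>auto simp: gauss_csc_def gauss_cot_def\<close>)
qed

text \<open>The weight n kills row 0, the only one with poles on the real line, so this sum is
  regular at 0.\<close>

lemma gauss_cot1_holomorphic_strip: "gauss_cot1 holomorphic_on {z. \<forall>n\<in>-{0}. z + \<i> * of_int n \<notin> \<int>}"
proof -
  have "gauss_cot1 = (\<lambda>z. \<Sum>\<^sub>\<infinity>n\<in>-{0}. of_int n * cot_row n z)"
    unfolding gauss_cot1_def infsum_int_split_0[OF row_decay_n_cot] by simp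
  then show ?thesis using row_decay_holomorphic[OF row_decay_n_cot, of "-{0}"] by simp
qed

lemma gauss_cot1_holomorphic: "gauss_cot1 holomorphic_on - gauss_ints"
  by (rule holomorphic_on_subset[OF gauss_cot1_holomorphic_strip]) (use notin_gauss_ints_iff in auto)

lemma infsum_int_shift: "(\<Sum>\<^sub>\<infinity>n::int. f (n + 1)) = (\<Sum>\<^sub>\<infinity>n. f n)"
  by (rule infsum_reindex_bij_witness[of _ "\<lambda>n. n - 1" "\<lambda>n. n + 1"]) auto

lemma infsum_int_neg: "(\<Sum>\<^sub>\<infinity>n::int. f (- n)) = (\<Sum>\<^sub>\<infinity>n. f n)"
  by (rule infsum_reindex_bij_witness[of _ "\<lambda>n. - n" "\<lambda>n. - n"]) auto

lemma csc_row_plus_1: "csc_row n (z + 1) = - csc_row n z"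
proof -
  have "sin (of_real pi * (z + 1 + \<i> * of_int n)) = sin (of_real pi * (z + \<i> * of_int n) + of_real pi)"
    by (simp add: algebra_simps)
  then show ?thesis by (simp add: csc_row_def sin_plus_pi)
qed

lemma csc_row_plus_i: "csc_row n (z + \<i>) = - csc_row (n + 1) z"
  by (simp add: csc_row_def algebra_simps)

lemma csc_row_minus: "csc_row n (- z) = - csc_row (- n) z"
proof -
  have "of_real pi * (- z + \<i> * of_int n) = - (of_real pi * (z + \<i> * of_int (- n)))" by (simp add: algebra_simps)
  then show ?thesis unfolding csc_row_def by (simp only: sin_minus) simp
qed

lemma cot_row_plus_1: "cot_row n (z + 1) = cot_row n z"
proof -
  have "of_real pi * (z + 1 + \<i> * of_int n) = of_real pi * (z + \<i> * of_int n) + of_real pi"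
    by (simp add: algebra_simps)
  then show ?thesis by (simp add: cot_row_def cot_def sin_plus_pi cos_plus_pi)
qed

lemma cot_row_plus_i: "cot_row n (z + \<i>) = cot_row (n + 1) z + \<i> * of_real pi * (of_int (sgn n) - of_int (sgn (n + 1)))"
  by (simp add: cot_row_def algebra_simps)

lemma cot_row_minus: "cot_row n (- z) = - cot_row (- n) z"
proof -
  have "of_real pi * (- z + \<i> * of_int n) = - (of_real pi * (z + \<i> * of_int (- n)))" by (simp add: algebra_simps)
  then show ?thesis unfolding cot_row_def cot_def by (simp only: sin_minus cos_minus) simp
qed

lemma gauss_csc_shift:
  "gauss_csc (z + 1) = - gauss_csc z" "gauss_csc (z + \<i>) = - gauss_csc z" "gauss_csc (- z) = - gauss_csc z"
  unfolding gauss_csc_def csc_row_plus_1 csc_row_plus_i csc_row_minus infsum_uminus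
  using infsum_int_shift[of "\<lambda>n. csc_row n z"] infsum_int_neg[of "\<lambda>n. csc_row n z"] by simp_all

text \<open>The difference sgn n - sgn (n + 1) equals -1 at n = 0 and n = -1 and vanishes elsewhere.
  These two rows are the source of the additive constants in the translation laws by i.\<close>

lemma infsum_sgn_shift: "(\<lambda>n. c n * (of_int (sgn n) - of_int (sgn (n + 1)))) summable_on (UNIV :: int set)"
  "(\<Sum>\<^sub>\<infinity>n::int. c n * (of_int (sgn n) - of_int (sgn (n + 1)))) = - c 0 - (c (-1) :: complex)"
proof -
  have z: "c n * (of_int (sgn n) - of_int (sgn (n + 1))) = 0" if "n \<notin> {-1, 0}" for n :: int
    using that by (auto simp: sgn_if)
  show "(\<lambda>n. c n * (of_int (sgn n) - of_int (sgn (n + 1)))) summable_on (UNIV :: int set)"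
    by (rule summable_on_cong_neutral[THEN iffD1, OF _ _ _ summable_on_finite[of "{-1, 0}"]]) (use z in auto)
  have "(\<Sum>\<^sub>\<infinity>n::int. c n * (of_int (sgn n) - of_int (sgn (n + 1)))) =
     (\<Sum>\<^sub>\<infinity>n\<in>{-1, 0}. c n * (of_int (sgn n) - of_int (sgn (n + 1))))"
    by (rule infsum_cong_neutral) (use z in auto)
  then show "(\<Sum>\<^sub>\<infinity>n::int. c n * (of_int (sgn n) - of_int (sgn (n + 1)))) = - c 0 - (c (-1) :: complex)" by simp
qed

lemma gauss_cot_shift:
  "gauss_cot (z + 1) = gauss_cot z" "gauss_cot (z + \<i>) = gauss_cot z - 2 * of_real pi * \<i>"
  "gauss_cot (- z) = - gauss_cot z"
proof -
  show "gauss_cot (z + 1) = gauss_cot z" "gauss_cot (- z) = - gauss_cot z"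
    unfolding gauss_cot_def cot_row_plus_1 cot_row_minus infsum_uminus
    using infsum_int_neg[of "\<lambda>n. cot_row n z"] by simp_all
  have "(\<lambda>n. cot_row (n + 1) z) summable_on UNIV"
    using row_decay_summable[OF row_decay_cot, of z UNIV]
    by (subst summable_on_reindex_bij_witness[of _ "\<lambda>n. n - 1" "\<lambda>n. n + 1" UNIV "\<lambda>n. cot_row n z"]) auto
  then have "gauss_cot (z + \<i>) = (\<Sum>\<^sub>\<infinity>n. cot_row (n + 1) z) +
      (\<Sum>\<^sub>\<infinity>n. \<i> * of_real pi * (of_int (sgn n) - of_int (sgn (n + 1))))"
    unfolding gauss_cot_def cot_row_plus_i by (intro infsum_add infsum_sgn_shift)
  then show "gauss_cot (z + \<i>) = gauss_cot z - 2 * of_real pi * \<i>"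
    by (simp add: infsum_sgn_shift(2) infsum_int_shift[of "\<lambda>n. cot_row n z"] gauss_cot_def)
qed

lemma gauss_cot1_shift:
  "gauss_cot1 (z + 1) = gauss_cot1 z" "gauss_cot1 (z + \<i>) = gauss_cot1 z - gauss_cot z + of_real pi * \<i>"
proof -
  show "gauss_cot1 (z + 1) = gauss_cot1 z"
    unfolding gauss_cot1_def cot_row_plus_1 ..
  have "(\<lambda>n. f (n + 1)) summable_on UNIV" if "f summable_on UNIV" for f :: "int \<Rightarrow> complex"
    using that by (subst summable_on_reindex_bij_witness[of _ "\<lambda>n. n - 1" "\<lambda>n. n + 1" UNIV f]) auto
  note s = this[OF row_decay_summable[OF row_decay_n_cot, of z UNIV]] this[OF row_decay_summable[OF row_decay_cot, of z UNIV]]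
  \<comment> \<open>The weight is rewritten as n = (n + 1) - 1, so reindexing returns
    \<open>gauss_cot1\<close> minus \<open>gauss_cot\<close>; of the two sgn terms only n = -1
    carries a nonzero weight, which gives \<open>of_real pi * \<i>\<close>.\<close>
  have s3: "(\<lambda>n. - cot_row (n + 1) z) summable_on UNIV" using s(2) by (simp add: summable_on_uminus)
  have "gauss_cot1 (z + \<i>) = (\<Sum>\<^sub>\<infinity>n::int. (of_int (n + 1) * cot_row (n + 1) z + - cot_row (n + 1) z) +
       (\<i> * of_real pi * of_int n) * (of_int (sgn n) - of_int (sgn (n + 1))))"
    unfolding gauss_cot1_def cot_row_plus_i by (intro infsum_cong) (simp add: algebra_simps)
  also have "\<dots> = (\<Sum>\<^sub>\<infinity>n::int. (of_int (n + 1) * cot_row (n + 1) z + - cot_row (n + 1) z)) +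
       (\<Sum>\<^sub>\<infinity>n::int. (\<i> * of_real pi * of_int n) * (of_int (sgn n) - of_int (sgn (n + 1))))"
    by (intro infsum_add infsum_sgn_shift summable_on_add s s3)
  also have "(\<Sum>\<^sub>\<infinity>n::int. (of_int (n + 1) * cot_row (n + 1) z + - cot_row (n + 1) z)) =
     (\<Sum>\<^sub>\<infinity>n::int. of_int (n + 1) * cot_row (n + 1) z) + (\<Sum>\<^sub>\<infinity>n::int. - cot_row (n + 1) z)"
    by (intro infsum_add s s3)
  finally show "gauss_cot1 (z + \<i>) = gauss_cot1 z - gauss_cot z + of_real pi * \<i>"
    using infsum_int_shift[of "\<lambda>n. of_int n * cot_row n z"] infsum_int_shift[of "\<lambda>n. cot_row n z"]
    by (simp add: infsum_sgn_shift(2)[of "\<lambda>n. \<i> * of_real pi * of_int n"] gauss_cot_def gauss_cot1_def infsum_uminus)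
qed

section \<open>Differential equations\<close>

lemma gauss_deriv_affine:
  assumes hol: "F holomorphic_on - gauss_ints"
    and G: "\<And>z. z \<notin> gauss_ints \<Longrightarrow> a * z + b \<notin> gauss_ints"
    and F: "\<And>z. z \<notin> gauss_ints \<Longrightarrow> F (a * z + b) = c * F z + d"
    and z: "z \<notin> gauss_ints"
  shows "deriv F (a * z + b) * a = c * deriv F z"
proof -
  have D: "(F has_field_derivative deriv F w) (at w)" if "w \<notin> gauss_ints" for w
    using holomorphic_derivI[OF hol open_gauss_compl] that by simp
  have "((\<lambda>w. a * w + b) has_field_derivative a) (at z)" by (auto intro!: derivative_eq_intros)
  then have 1: "((\<lambda>w. F (a * w + b)) has_field_derivative deriv F (a * z + b) * a) (at z)"
    by (rule DERIV_chain2[where g = "\<lambda>w. a * w + b", OF D[OF G[OF z]]])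
  have "((\<lambda>w. c * F w + d) has_field_derivative c * deriv F z) (at z)"
    by (auto intro!: derivative_eq_intros D[OF z])
  then have "((\<lambda>w. F (a * w + b)) has_field_derivative c * deriv F z) (at z)"
    by (rule has_field_derivative_transform_within_open[OF _ open_gauss_compl]) (use F z in auto)
  with 1 show ?thesis by (rule DERIV_unique)
qed

lemmas gauss_deriv_hol = holomorphic_deriv[OF _ open_gauss_compl]

lemma punctured_in: "z \<in> ball 0 1 - {0} \<Longrightarrow> z \<notin> gauss_ints"
  using gauss_int_near_0 by auto

lemma gauss_deriv_local:
  assumes "\<And>z. z \<in> ball 0 1 - {0} \<Longrightarrow> F z = a / z ^ n + g z" "g holomorphic_on ball 0 1" "z \<in> ball 0 1 - {0}"
  shows "deriv F z = - of_nat n * a / z ^ Suc n + deriv g z"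
proof -
  have D: "(g has_field_derivative deriv g z) (at z)"
    using holomorphic_derivI[OF assms(2) open_ball] assms(3) by simp
  have "((\<lambda>z. a * inverse (z ^ n)) has_field_derivative - of_nat n * a / z ^ Suc n) (at z)"
    using assms(3) by (auto intro!: derivative_eq_intros simp: field_simps power_Suc[symmetric] simp del: power_Suc)
       (cases n; simp)
  with D have "((\<lambda>z. a / z ^ n + g z) has_field_derivative - of_nat n * a / z ^ Suc n + deriv g z) (at z)"
    unfolding divide_inverse by (intro DERIV_add)
  then have "(F has_field_derivative - of_nat n * a / z ^ Suc n + deriv g z) (at z)"
    by (rule has_field_derivative_transform_within_open[of _ _ _ "ball 0 1 - {0}"]) (use assms in auto)
  then show ?thesis by (rule DERIV_imp_deriv)
qed

text \<open>The rotation permutes the lattice and fixes the signs up to the factor i, but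
  rearranging rows into columns is not justified here. Instead the difference of the two sides is
  antiperiodic and odd, and its poles cancel because i / (i z) = 1 / z.\<close>

lemma gauss_csc_rotate: assumes z: "z \<notin> gauss_ints" shows "\<i> * gauss_csc (\<i> * z) = gauss_csc z"
proof -
  obtain s c where s: "s holomorphic_on ball 0 1" "\<And>z. z \<in> ball 0 1 - {0} \<Longrightarrow> gauss_csc z = 1 / z + s z"
    by (rule gauss_laurent) (rule that; blast)
  have "\<i> * gauss_csc (\<i> * z) - gauss_csc z = 0"
  proof (rule gauss_antiperiodic_odd_zero[where F = "\<lambda>z. \<i> * gauss_csc (\<i> * z) - gauss_csc z", OF _ _ _ _ _ _ z])
    show "(\<lambda>z. \<i> * gauss_csc (\<i> * z) - gauss_csc z) holomorphic_on - gauss_ints"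
    proof (intro holomorphic_intros gauss_csc_holomorphic)
      show "(\<lambda>z. gauss_csc (\<i> * z)) holomorphic_on - gauss_ints"
        using holomorphic_on_compose_gen[of "\<lambda>z. \<i> * z" "- gauss_ints" gauss_csc "- gauss_ints"] gauss_csc_holomorphic
          image_subsetI[of "- gauss_ints" "\<lambda>z. \<i> * z" "- gauss_ints"]
        by (simp add: o_def holomorphic_intros)
    qed
    fix z
    show "\<i> * gauss_csc (\<i> * (z + 1)) - gauss_csc (z + 1) = - (\<i> * gauss_csc (\<i> * z) - gauss_csc z)"
      using gauss_csc_shift(2)[of "\<i> * z"] by (simp add: distrib_left gauss_csc_shift)
    have "gauss_csc (\<i> * z - 1) = - gauss_csc (\<i> * z)" using gauss_csc_shift(1)[of "\<i> * z - 1"] by simp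
    then show "\<i> * gauss_csc (\<i> * (z + \<i>)) - gauss_csc (z + \<i>) = - (\<i> * gauss_csc (\<i> * z) - gauss_csc z)"
      by (simp add: distrib_left gauss_csc_shift)
    show "\<i> * gauss_csc (\<i> * - z) - gauss_csc (- z) = - (\<i> * gauss_csc (\<i> * z) - gauss_csc z)"
      using gauss_csc_shift(3)[of "\<i> * z"] by (simp add: gauss_csc_shift)
    have "(\<lambda>z. \<i> * z) ` ball 0 1 \<subseteq> ball 0 1" by (auto simp: norm_mult)
    then have "(\<lambda>z. s (\<i> * z)) holomorphic_on ball 0 1"
      using holomorphic_on_compose_gen[of "\<lambda>z. \<i> * z" "ball 0 1" s "ball 0 1"] s(1)
      by (simp add: o_def holomorphic_intros)
    then show "(\<lambda>z. \<i> * s (\<i> * z) - s z) holomorphic_on ball 0 1" using s(1) by (intro holomorphic_intros)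
    assume "z \<in> ball 0 1 - {0}"
    then show "\<i> * gauss_csc (\<i> * z) - gauss_csc z = \<i> * s (\<i> * z) - s z"
      using s(2)[of z] s(2)[of "\<i> * z"] by (auto simp: norm_mult algebra_simps)
  qed
  then show ?thesis by simp
qed

text \<open>Oddness removes the constant term and the rotation law removes the linear one: writing
  the regular part as z s1(z) gives s1(i z) = - s1(z). Both are needed for the cube of S to have the
  polar part 1/z^3 exactly.\<close>

lemma gauss_csc_laurent_2:
  obtains r where "r holomorphic_on ball 0 1" "\<And>z. z \<in> ball 0 1 - {0} \<Longrightarrow> gauss_csc z = 1 / z + z ^ 2 * r z"
proof -
  obtain s c where s: "s holomorphic_on ball 0 1" "\<And>z. z \<in> ball 0 1 - {0} \<Longrightarrow> gauss_csc z = 1 / z + s z"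
    by (rule gauss_laurent) (rule that; blast)
  have "s 0 = 0"
  proof (rule odd_at_0[OF s(1)])
    fix z :: complex assume "z \<in> ball 0 1 - {0}"
    then show "s (- z) = - s z" using s(2)[of z] s(2)[of "- z"] by (auto simp: gauss_csc_shift)
  qed
  then obtain s1 where s1: "s1 holomorphic_on ball 0 1" "\<And>z. s z = z * s1 z"
    using holomorphic_factor_0[OF s(1)] by metis
  have "s1 0 = 0"
  proof -
    have i: "(\<lambda>z. \<i> * z) ` ball 0 1 \<subseteq> ball 0 1" by (auto simp: norm_mult)
    have e: "s1 (\<i> * z) = - s1 z" if z: "z \<in> ball 0 1 - {0}" for z
    proof -
      have "\<i> * (1 / (\<i> * z) + s (\<i> * z)) = 1 / z + s z"
        using gauss_csc_rotate[OF punctured_in[OF z]] s(2)[of z] s(2)[of "\<i> * z"] z by (auto simp: norm_mult)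
      then have "\<i> * s (\<i> * z) = s z" using z by (simp add: distrib_left)
      then have "z * (s1 (\<i> * z) + s1 z) = 0" unfolding s1(2) by (simp add: algebra_simps neg_eq_iff_add_eq_0)
      then show ?thesis using z by (simp add: add_eq_0_iff)
    qed
    let ?h = "\<lambda>z. s1 (\<i> * z) + s1 z"
    have "(\<lambda>z. s1 (\<i> * z)) holomorphic_on ball 0 1"
      using holomorphic_on_compose_gen[of "\<lambda>z. \<i> * z" "ball 0 1" s1 "ball 0 1"] s1(1) i
      by (simp add: o_def holomorphic_intros)
    then have "?h holomorphic_on ball 0 1" using s1(1) by (intro holomorphic_intros)
    \<comment> \<open>\<open>?h\<close> is identically zero on the punctured disc, so it meets the
      oddness condition of \<open>odd_at_0\<close> trivially; its value at 0 is twice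
      \<open>s1 0\<close>.\<close>
    then have "?h 0 = 0"
    proof (rule odd_at_0)
      fix z :: complex assume "z \<in> ball 0 1 - {0}"
      then show "?h (- z) = - ?h z" using e[of z] e[of "- z"] by auto
    qed
    then show ?thesis by simp
  qed
  then obtain r where r: "r holomorphic_on ball 0 1" "\<And>z. s1 z = z * r z"
    using holomorphic_factor_0[OF s1(1)] by metis
  show ?thesis
    by (rule that[OF r(1)]) (use s(2) s1(2) r(2) in \<open>simp add: power2_eq_square mult.assoc\<close>)
qed

text \<open>Both sides have polar part 2 / z^3, since the cross term 3 z^(-2) * z^2 r in the cube of
  S is already regular. The difference is odd and antiperiodic, hence zero.\<close>

lemma gauss_csc_deriv_deriv:
  assumes z: "z \<notin> gauss_ints"
  shows "deriv (deriv gauss_csc) z = 2 * gauss_csc z ^ 3"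
proof -
  obtain r where r: "r holomorphic_on ball 0 1" "\<And>z. z \<in> ball 0 1 - {0} \<Longrightarrow> gauss_csc z = 1 / z + z ^ 2 * r z"
    by (rule gauss_csc_laurent_2) (rule that; blast)
  note d1 = gauss_deriv_hol[OF gauss_csc_holomorphic]
  note d2 = gauss_deriv_hol[OF d1]
  let ?s = "\<lambda>z. z ^ 2 * r z"
  have s: "?s holomorphic_on ball 0 1" using r(1) by (intro holomorphic_intros)
  have e1: "deriv gauss_csc z = - 1 / z ^ 2 + deriv ?s z" if "z \<in> ball 0 1 - {0}" for z
    using gauss_deriv_local[of gauss_csc 1 1 ?s z] r(2) s that by (simp add: power2_eq_square)
  have e2: "deriv (deriv gauss_csc) z = 2 / z ^ 3 + deriv (deriv ?s) z" if "z \<in> ball 0 1 - {0}" for z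
    using gauss_deriv_local[of "deriv gauss_csc" "-1" 2 "deriv ?s" z] e1 holomorphic_deriv[OF s open_ball] that
    by (simp add: power2_eq_square power3_eq_cube)
  have "deriv (deriv gauss_csc) z - 2 * gauss_csc z ^ 3 = 0"
  proof (rule gauss_antiperiodic_odd_zero[where F = "\<lambda>z. deriv (deriv gauss_csc) z - 2 * gauss_csc z ^ 3", OF _ _ _ _ _ _ z])
    show "(\<lambda>z. deriv (deriv gauss_csc) z - 2 * gauss_csc z ^ 3) holomorphic_on - gauss_ints"
      by (intro holomorphic_intros d2 gauss_csc_holomorphic)
    fix z
    show "deriv (deriv gauss_csc) (z + 1) - 2 * gauss_csc (z + 1) ^ 3 = - (deriv (deriv gauss_csc) z - 2 * gauss_csc z ^ 3)"
      if z: "z \<notin> gauss_ints"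
    proof -
      have a: "deriv gauss_csc (z + 1) = - deriv gauss_csc z" if "z \<notin> gauss_ints" for z
        using gauss_deriv_affine[OF gauss_csc_holomorphic, of 1 1 "-1" 0 z] that by (simp add: gauss_csc_shift)
      show ?thesis using gauss_deriv_affine[OF d1, of 1 1 "-1" 0 z] a z by (simp add: gauss_csc_shift)
    qed
    show "deriv (deriv gauss_csc) (z + \<i>) - 2 * gauss_csc (z + \<i>) ^ 3 = - (deriv (deriv gauss_csc) z - 2 * gauss_csc z ^ 3)"
      if z: "z \<notin> gauss_ints"
    proof -
      have a: "deriv gauss_csc (z + \<i>) = - deriv gauss_csc z" if "z \<notin> gauss_ints" for z
        using gauss_deriv_affine[OF gauss_csc_holomorphic, of 1 \<i> "-1" 0 z] that by (simp add: gauss_csc_shift)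
      show ?thesis using gauss_deriv_affine[OF d1, of 1 \<i> "-1" 0 z] a z by (simp add: gauss_csc_shift)
    qed
    show "deriv (deriv gauss_csc) (- z) - 2 * gauss_csc (- z) ^ 3 = - (deriv (deriv gauss_csc) z - 2 * gauss_csc z ^ 3)"
      if z: "z \<notin> gauss_ints"
    proof -
      have a: "deriv gauss_csc (- z) = deriv gauss_csc z" if "z \<notin> gauss_ints" for z
        using gauss_deriv_affine[OF gauss_csc_holomorphic, of "-1" 0 "-1" 0 z] that by (simp add: gauss_csc_shift)
      show ?thesis using gauss_deriv_affine[OF d1, of "-1" 0 1 0 z] a z by (simp add: gauss_csc_shift equation_minus_iff)
    qed
    show "(\<lambda>z. deriv (deriv ?s) z - 6 * r z - 6 * z ^ 3 * r z ^ 2 - 2 * z ^ 6 * r z ^ 3) holomorphic_on ball 0 1"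
      by (intro holomorphic_intros r(1) holomorphic_deriv[OF _ open_ball] s)
    assume p: "z \<in> ball 0 1 - {0}"
    then have "z \<noteq> 0" by auto
    then have "2 * (1 / z + z ^ 2 * r z) ^ 3 = 2 / z ^ 3 + 6 * r z + 6 * z ^ 3 * r z ^ 2 + 2 * z ^ 6 * r z ^ 3"
      by (simp add: power3_eq_cube power2_eq_square field_simps eval_nat_numeral)
    then show "deriv (deriv gauss_csc) z - 2 * gauss_csc z ^ 3 =
        deriv (deriv ?s) z - 6 * r z - 6 * z ^ 3 * r z ^ 2 - 2 * z ^ 6 * r z ^ 3"
      unfolding e2[OF p] r(2)[OF p] by simp
  qed
  then show ?thesis by simp
qed

lemma gauss_cot_laurent_1:
  obtains r where "r holomorphic_on ball 0 1" "\<And>z. z \<in> ball 0 1 - {0} \<Longrightarrow> gauss_cot z = 1 / z + z * r z"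
    "\<And>z. z \<in> ball 0 1 - {0} \<Longrightarrow> deriv gauss_cot z = - 1 / z ^ 2 + deriv (\<lambda>z. z * r z) z"
proof -
  obtain s c where s: "c holomorphic_on ball 0 1" "\<And>z. z \<in> ball 0 1 - {0} \<Longrightarrow> gauss_cot z = 1 / z + c z"
    by (rule gauss_laurent) (rule that; blast)
  have "c 0 = 0"
  proof (rule odd_at_0[OF s(1)])
    fix z :: complex assume "z \<in> ball 0 1 - {0}"
    then show "c (- z) = - c z" using s(2)[of z] s(2)[of "- z"] by (auto simp: gauss_cot_shift)
  qed
  then obtain r where r: "r holomorphic_on ball 0 1" "\<And>z. c z = z * r z"
    using holomorphic_factor_0[OF s(1)] by metis
  show ?thesis
  proof (rule that[OF r(1)])
    fix z :: complex assume z: "z \<in> ball 0 1 - {0}"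
    show "gauss_cot z = 1 / z + z * r z" using s(2)[OF z] r(2) by simp
    show "deriv gauss_cot z = - 1 / z ^ 2 + deriv (\<lambda>z. z * r z) z"
      using gauss_deriv_local[of gauss_cot 1 1 "\<lambda>z. z * r z" z] s(2) r(2) r(1) z
      by (simp add: power2_eq_square holomorphic_intros)
  qed
qed

lemma gauss_cot_deriv_shift:
  assumes "z \<notin> gauss_ints"
  shows "deriv gauss_cot (z + 1) = deriv gauss_cot z" "deriv gauss_cot (z + \<i>) = deriv gauss_cot z"
    "deriv gauss_cot (- z) = deriv gauss_cot z"
  using gauss_deriv_affine[OF gauss_cot_holomorphic, of 1 1 1 0 z]
    gauss_deriv_affine[OF gauss_cot_holomorphic, of 1 \<i> 1 "- 2 * of_real pi * \<i>" z]
    gauss_deriv_affine[OF gauss_cot_holomorphic, of "-1" 0 "-1" 0 z] assms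
  by (simp_all add: gauss_cot_shift)

text \<open>The constant is found by comparing the quasi-periods of an antiderivative of
  \<^term>\<open>\<lambda>z. gauss_csc z ^ 2\<close> under the rotation by \<^term>\<open>\<i>\<close> (Legendre's relation).\<close>

lemma gauss_cot_deriv:
  assumes z: "z \<notin> gauss_ints"
  shows "deriv gauss_cot z = - (gauss_csc z)\<^sup>2 - of_real pi"
proof -
  obtain s where s: "s holomorphic_on ball 0 1" "\<And>z. z \<in> ball 0 1 - {0} \<Longrightarrow> gauss_csc z = 1 / z + z ^ 2 * s z"
    by (rule gauss_csc_laurent_2) (rule that; blast)
  obtain r where r: "r holomorphic_on ball 0 1" "\<And>z. z \<in> ball 0 1 - {0} \<Longrightarrow> gauss_cot z = 1 / z + z * r z"
    "\<And>z. z \<in> ball 0 1 - {0} \<Longrightarrow> deriv gauss_cot z = - 1 / z ^ 2 + deriv (\<lambda>z. z * r z) z"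
    by (fact gauss_cot_laurent_1)
  let ?g = "\<lambda>z. 2 * z * s z + z ^ 4 * (s z)\<^sup>2 + deriv (\<lambda>z. z * r z) z"
  define C where "C = - ?g 0"
  have const: "(gauss_csc z)\<^sup>2 + deriv gauss_cot z = - C" if z: "z \<notin> gauss_ints" for z
    unfolding C_def minus_minus
  proof (rule gauss_periodic_constant[where F = "\<lambda>z. (gauss_csc z)\<^sup>2 + deriv gauss_cot z" and g = ?g, OF _ _ _ _ _ z])
    show "(\<lambda>z. (gauss_csc z)\<^sup>2 + deriv gauss_cot z) holomorphic_on - gauss_ints"
      by (intro holomorphic_intros gauss_csc_holomorphic gauss_deriv_hol gauss_cot_holomorphic)
    show "?g holomorphic_on ball 0 1" by (intro holomorphic_intros r(1) s(1) holomorphic_deriv[OF _ open_ball])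
    fix z :: complex assume z: "z \<in> ball 0 1 - {0}"
    then have "z \<noteq> 0" by auto
    then have "(1 / z + z ^ 2 * s z)\<^sup>2 = 1 / z ^ 2 + 2 * z * s z + z ^ 4 * (s z)\<^sup>2"
      by (simp add: power2_eq_square field_simps eval_nat_numeral)
    then show "(gauss_csc z)\<^sup>2 + deriv gauss_cot z = ?g z" using s(2)[OF z] r(3)[OF z] by simp
  qed (simp_all add: gauss_csc_shift gauss_cot_deriv_shift)
  \<comment> \<open>With the still unknown C, the function Z(z) + C z is an antiderivative of -S^2.
    Because S(i z)^2 = -S(z)^2, its value at i z plus i times its value at z has zero
    derivative.\<close>
  define h where "h z = gauss_cot (\<i> * z) + C * (\<i> * z) + \<i> * (gauss_cot z + C * z)" for z
  have D: "(gauss_cot has_field_derivative (- (gauss_csc w)\<^sup>2 - C)) (at w)" if w: "w \<notin> gauss_ints" for w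
  proof -
    have "deriv gauss_cot w = ((gauss_csc w)\<^sup>2 + deriv gauss_cot w) - (gauss_csc w)\<^sup>2" by simp
    also have "\<dots> = - (gauss_csc w)\<^sup>2 - C" unfolding const[OF w] by simp
    finally have "deriv gauss_cot w = - (gauss_csc w)\<^sup>2 - C" .
    then show ?thesis using holomorphic_derivI[OF gauss_cot_holomorphic open_gauss_compl, of w] w by simp
  qed
  have Dh: "(h has_field_derivative 0) (at w)" if w: "w \<notin> gauss_ints" for w
  proof -
    have "gauss_csc (\<i> * w) = - \<i> * (\<i> * gauss_csc (\<i> * w))" by simp
    then have e: "(gauss_csc (\<i> * w))\<^sup>2 = - (gauss_csc w)\<^sup>2"
      unfolding gauss_csc_rotate[OF w] by (simp add: power_mult_distrib)
    have "((\<lambda>w. gauss_cot (\<i> * w)) has_field_derivative (- (gauss_csc (\<i> * w))\<^sup>2 - C) * \<i>) (at w)"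
      by (rule DERIV_chain2[where g = "\<lambda>w. \<i> * w", OF D]) (use w in \<open>auto intro!: derivative_eq_intros\<close>)
    then show ?thesis unfolding h_def
      by (auto intro!: derivative_eq_intros D[OF w] simp: e algebra_simps)
  qed
  have "continuous_on (- gauss_ints) h"
    by (rule DERIV_continuous_on[of _ _ "\<lambda>_. 0"], rule has_field_derivative_at_within, rule Dh) simp
  then obtain c where c: "\<And>w. w \<in> - gauss_ints \<Longrightarrow> h w = c"
    using DERIV_zero_connected_constant[OF connected_gauss_compl open_gauss_compl finite.emptyI, of h] Dh
    by (metis ComplD Diff_empty)
  \<comment> \<open>Under z -> z + 1 the rotated half of h changes by i C - 2 pi i and the other
    half by i C. Their sum must vanish, which gives C = pi.\<close>
  have "h (z + 1) = h z" using c[of z] c[of "z + 1"] z by simp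
  moreover have rot: "gauss_cot (\<i> * (z + 1)) = gauss_cot (\<i> * z) - 2 * of_real pi * \<i>"
    using gauss_cot_shift(2)[of "\<i> * z"] by (simp add: distrib_left)
  ultimately have "\<i> * (C - of_real pi) = 0"
    unfolding h_def gauss_cot_shift(1) rot by (simp add: algebra_simps)
  then have C: "C = of_real pi" by simp
  have "deriv gauss_cot z = ((gauss_csc z)\<^sup>2 + deriv gauss_cot z) - (gauss_csc z)\<^sup>2" by simp
  also have "\<dots> = - (gauss_csc z)\<^sup>2 - of_real pi" unfolding const[OF z] C by simp
  finally show ?thesis .
qed

text \<open>Under z -> z + i both 4 pi i \<open>gauss_cot1\<close> and the square of
  \<open>gauss_cot\<close> change by -4 pi i Z - 4 pi^2, which dictates the factor 4 pi i. Adding Z'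
  cancels the double pole of Z^2, so the difference is elliptic without poles. The value of the
  constant c does not matter, as only derivatives are taken later.\<close>

lemma gauss_cot1_eq:
  obtains c where "\<And>z. z \<notin> gauss_ints \<Longrightarrow> 4 * of_real pi * \<i> * gauss_cot1 z = (gauss_cot z)\<^sup>2 + deriv gauss_cot z + c"
proof -
  obtain r where r: "r holomorphic_on ball 0 1" "\<And>z. z \<in> ball 0 1 - {0} \<Longrightarrow> gauss_cot z = 1 / z + z * r z"
    "\<And>z. z \<in> ball 0 1 - {0} \<Longrightarrow> deriv gauss_cot z = - 1 / z ^ 2 + deriv (\<lambda>z. z * r z) z"
    by (fact gauss_cot_laurent_1)
  let ?F = "\<lambda>z. 4 * of_real pi * \<i> * gauss_cot1 z - (gauss_cot z)\<^sup>2 - deriv gauss_cot z"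
  let ?g = "\<lambda>z. 4 * of_real pi * \<i> * gauss_cot1 z - 2 * r z - z ^ 2 * (r z)\<^sup>2 - deriv (\<lambda>z. z * r z) z"
  have const: "?F z = ?g 0" if z: "z \<notin> gauss_ints" for z
  proof (rule gauss_periodic_constant[where F = ?F and g = ?g, OF _ _ _ _ _ z])
    show "?F holomorphic_on - gauss_ints"
      by (intro holomorphic_intros gauss_cot1_holomorphic gauss_deriv_hol gauss_cot_holomorphic)
    show "?g holomorphic_on ball 0 1"
      by (intro holomorphic_intros r(1) holomorphic_deriv[OF _ open_ball]
          holomorphic_on_subset[OF gauss_cot1_holomorphic_strip ball_subset_rows])
    fix z :: complex
    show "?F z = ?g z" if z: "z \<in> ball 0 1 - {0}"
    proof -
      have "z \<noteq> 0" using z by auto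
      then have "(1 / z + z * r z)\<^sup>2 = 1 / z ^ 2 + 2 * r z + z ^ 2 * (r z)\<^sup>2"
        by (simp add: power2_eq_square field_simps eval_nat_numeral)
      then show ?thesis using r(2,3)[OF z] by simp
    qed
    show "?F (z + \<i>) = ?F z" if z: "z \<notin> gauss_ints"
      unfolding gauss_cot1_shift gauss_cot_shift gauss_cot_deriv_shift[OF z]
      by (simp add: power2_eq_square algebra_simps)
  qed (simp_all add: gauss_cot1_shift gauss_cot_shift gauss_cot_deriv_shift)
  show ?thesis by (rule that[of "?g 0"]) (use const in \<open>simp add: algebra_simps\<close>)
qed

text \<open>This number is the lemniscate constant 2.622..., and its square is the value of the
  Weierstrass function at the half-period 1/2.\<close>

definition lem_half :: complex where "lem_half = gauss_csc (1/2)"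

lemma half_notin_gauss: "1/2 \<notin> gauss_ints" "(1 + \<i>) / 2 \<notin> gauss_ints"
proof -
  have "(1/2 :: real) \<notin> \<int>"
  proof
    assume "(1/2 :: real) \<in> \<int>"
    then obtain n :: int where "1/2 = real_of_int n" by (auto elim: Ints_cases)
    then have "real_of_int 1 = real_of_int (2 * n)" by simp
    then have "1 = 2 * n" by (simp only: of_int_eq_iff)
    then show False by presburger
  qed
  then show "1/2 \<notin> gauss_ints" "(1 + \<i>) / 2 \<notin> gauss_ints" by (simp_all add: gauss_ints_def)
qed

text \<open>Antiperiodicity and oddness give S(1 - z) = S(z), so 1/2 is a critical point.\<close>

lemma gauss_csc_deriv_half: "deriv gauss_csc (1/2) = 0"
proof -
  have "gauss_csc (- z + 1) = gauss_csc z" for z using gauss_csc_shift(1)[of "- z"] by (simp add: gauss_csc_shift)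
  moreover have "- 1 * z + 1 \<notin> gauss_ints" if "z \<notin> gauss_ints" for z
    using that gauss_ints_shifts(1)[of "- z"] by simp
  ultimately have "deriv gauss_csc (- 1 * (1/2) + 1) * - 1 = 1 * deriv gauss_csc (1/2)"
    by (intro gauss_deriv_affine[where d = 0] gauss_csc_holomorphic half_notin_gauss) auto
  then show ?thesis by simp
qed

text \<open>At the centre z of the unit square, i z = z - 1, so the rotation law and antiperiodicity
  give -i S(z) = S(z).\<close>

lemma gauss_csc_centre: "gauss_csc ((1 + \<i>) / 2) = 0"
proof -
  let ?z = "(1 + \<i>) / 2"
  have "\<i> * ?z = ?z - 1" by (simp add: field_simps)
  moreover have "gauss_csc (?z - 1) = - gauss_csc ?z" using gauss_csc_shift(1)[of "?z - 1"] by simp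
  ultimately have "\<i> * (- gauss_csc ?z) = gauss_csc ?z"
    using gauss_csc_rotate[OF half_notin_gauss(2)] by (simp only:)
  then have "(1 + \<i>) * gauss_csc ?z = 0" by (simp add: algebra_simps eq_neg_iff_add_eq_0 neg_eq_iff_add_eq_0)
  moreover have "1 + \<i> \<noteq> 0" by (simp add: complex_eq_iff)
  ultimately show ?thesis by simp
qed

lemma gauss_csc_DERIV:
  assumes "z \<notin> gauss_ints"
  shows "(gauss_csc has_field_derivative deriv gauss_csc z) (at z)"
    "(deriv gauss_csc has_field_derivative 2 * gauss_csc z ^ 3) (at z)"
  using holomorphic_derivI[OF gauss_csc_holomorphic open_gauss_compl, of z]
    holomorphic_derivI[OF gauss_deriv_hol[OF gauss_csc_holomorphic] open_gauss_compl, of z]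
    gauss_csc_deriv_deriv[OF assms] assms by simp_all

text \<open>Energy conservation for S'' = 2 S^3 on the connected complement of the lattice. The
  constant is read off at 1/2, where S' vanishes.\<close>

lemma gauss_csc_first_integral:
  assumes z: "z \<notin> gauss_ints"
  shows "(deriv gauss_csc z)\<^sup>2 = gauss_csc z ^ 4 - lem_half ^ 4"
proof -
  define h where "h z = (deriv gauss_csc z)\<^sup>2 - gauss_csc z ^ 4" for z
  have Dh: "(h has_field_derivative 0) (at w)" if w: "w \<notin> gauss_ints" for w
    unfolding h_def by (auto intro!: derivative_eq_intros gauss_csc_DERIV[OF w] simp: power2_eq_square power3_eq_cube)
  have "continuous_on (- gauss_ints) h"
    by (rule DERIV_continuous_on[of _ _ "\<lambda>_. 0"], rule has_field_derivative_at_within, rule Dh) simp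
  then obtain c where c: "\<And>w. w \<in> - gauss_ints \<Longrightarrow> h w = c"
    using DERIV_zero_connected_constant[OF connected_gauss_compl open_gauss_compl finite.emptyI, of h] Dh
    by (metis ComplD Diff_empty)
  have "h z = h (1/2)" using c[of z] c[of "1/2"] z half_notin_gauss by simp
  then show ?thesis by (simp add: h_def gauss_csc_deriv_half lem_half_def algebra_simps)
qed

text \<open>For f = S^2 the first integral eliminates S', so that f'' = 6 f^2 - 2 e^2 involves only
  f and the constant e = S(1/2)^2. This is the Weierstrass equation f'' = 6 f^2 - g2 / 2.\<close>

lemma csc_square_ode:
  assumes z: "z \<notin> gauss_ints"
  shows "deriv (deriv (\<lambda>z. (gauss_csc z)\<^sup>2)) z = 6 * ((gauss_csc z)\<^sup>2)\<^sup>2 - 2 * (lem_half\<^sup>2)\<^sup>2"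
    "deriv (\<lambda>z. (gauss_csc z)\<^sup>2) z = 2 * gauss_csc z * deriv gauss_csc z"
proof -
  have 1: "deriv (\<lambda>z. (gauss_csc z)\<^sup>2) w = 2 * gauss_csc w * deriv gauss_csc w" if w: "w \<notin> gauss_ints" for w
    by (rule DERIV_imp_deriv) (auto intro!: derivative_eq_intros gauss_csc_DERIV[OF w])
  show "deriv (\<lambda>z. (gauss_csc z)\<^sup>2) z = 2 * gauss_csc z * deriv gauss_csc z" by (rule 1[OF z])
  have "((\<lambda>w. 2 * gauss_csc w * deriv gauss_csc w) has_field_derivative
     2 * (deriv gauss_csc z)\<^sup>2 + 4 * gauss_csc z ^ 4) (at z)"
    by (auto intro!: derivative_eq_intros gauss_csc_DERIV[OF z] simp: power2_eq_square power3_eq_cube eval_nat_numeral algebra_simps)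
  then have "(deriv (\<lambda>z. (gauss_csc z)\<^sup>2) has_field_derivative 2 * (deriv gauss_csc z)\<^sup>2 + 4 * gauss_csc z ^ 4) (at z)"
    by (rule has_field_derivative_transform_within_open[OF _ open_gauss_compl]) (use 1 z in auto)
  then show "deriv (deriv (\<lambda>z. (gauss_csc z)\<^sup>2)) z = 6 * ((gauss_csc z)\<^sup>2)\<^sup>2 - 2 * (lem_half\<^sup>2)\<^sup>2"
    by (subst DERIV_imp_deriv) (auto simp: gauss_csc_first_integral[OF z] power_mult[symmetric])
qed

section \<open>Taylor coefficients at the half-periods\<close>

lemma Rats_sum [intro]: "(\<And>x. x \<in> A \<Longrightarrow> f x \<in> \<rat>) \<Longrightarrow> sum f A \<in> (\<rat> :: 'a::field_char_0 set)"
  by (induction A rule: infinite_finite_induct) auto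

text \<open>The equation is homogeneous if f and e have weight 2 and each derivative adds 1, so an
  even derivative of order n is a rational multiple of e^(n/2 + 1). Odd derivatives vanish because
  in the Leibniz sum of odd order every product has an odd factor. In the applications q is 1 or
  0.\<close>

lemma ode_higher_derivs:
  fixes f :: "complex \<Rightarrow> complex"
  assumes A: "open A" "z0 \<in> A" and hol: "f holomorphic_on A"
    and ode: "\<And>z. z \<in> A \<Longrightarrow> deriv (deriv f) z = 6 * (f z)\<^sup>2 - 2 * e\<^sup>2"
    and ini: "f z0 = q * e" "q \<in> \<rat>" "deriv f z0 = 0"
  shows "(even n \<longrightarrow> (\<exists>r\<in>\<rat>. (deriv ^^ n) f z0 = r * e ^ (n div 2 + 1))) \<and> (odd n \<longrightarrow> (deriv ^^ n) f z0 = 0)"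
proof (induction n rule: less_induct)
  case (less n)
  show ?case
  proof (cases "n < 2")
    case True
    then have "n = 0 \<or> n = 1" by auto
    then show ?thesis using ini by auto
  next
    case False
    then obtain m where m: "n = m + 2" by (metis add.commute le_Suc_ex not_le)
    define S where "S = (\<Sum>i = 0..m. of_nat (m choose i) * (deriv ^^ i) f z0 * (deriv ^^ (m - i)) f z0)"
    have S: "(deriv ^^ m) (\<lambda>z. f z * f z) z0 = S"
      unfolding S_def by (rule higher_deriv_mult[OF hol hol A])
    have "(deriv ^^ n) f z0 = (deriv ^^ m) (deriv (deriv f)) z0"
      unfolding m by (simp add: funpow_add funpow_swap1 numeral_2_eq_2)
    also have "\<dots> = (deriv ^^ m) (\<lambda>z. 6 * (f z * f z) - 2 * e\<^sup>2) z0"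
    proof (rule higher_deriv_transform_within_open[OF _ _ A])
      show "deriv (deriv f) holomorphic_on A" by (intro holomorphic_deriv hol A)
      show "(\<lambda>z. 6 * (f z * f z) - 2 * e\<^sup>2) holomorphic_on A" by (intro holomorphic_intros hol)
    qed (use ode in \<open>auto simp: power2_eq_square\<close>)
    also have "\<dots> = (deriv ^^ m) (\<lambda>z. 6 * (f z * f z)) z0 - (deriv ^^ m) (\<lambda>z. 2 * e\<^sup>2) z0"
      by (rule higher_deriv_diff[OF _ _ A]) (intro holomorphic_intros hol)+
    also have "(deriv ^^ m) (\<lambda>z. 6 * (f z * f z)) z0 = 6 * S"
      using higher_deriv_cmult[of "\<lambda>z. f z * f z" A z0 m 6] A hol S by (simp add: holomorphic_intros)
    finally have eq: "(deriv ^^ n) f z0 = 6 * S - (if m = 0 then 2 * e\<^sup>2 else 0)"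
      by (simp add: higher_deriv_const)
    show ?thesis
    proof (cases "even m")
      case True
      have "\<exists>r\<in>\<rat>. of_nat (m choose i) * (deriv ^^ i) f z0 * (deriv ^^ (m - i)) f z0 = r * e ^ (m div 2 + 2)"
        if i: "i \<in> {0..m}" for i
      proof (cases "even i")
        case ev: True
        obtain r1 r2 where r: "r1 \<in> \<rat>" "(deriv ^^ i) f z0 = r1 * e ^ (i div 2 + 1)"
          "r2 \<in> \<rat>" "(deriv ^^ (m - i)) f z0 = r2 * e ^ ((m - i) div 2 + 1)"
          using less[of i] less[of "m - i"] i True ev m by force
        have "(i div 2 + 1) + ((m - i) div 2 + 1) = m div 2 + 2" using True ev i by (auto elim!: evenE)
        then have "e ^ (i div 2 + 1) * e ^ ((m - i) div 2 + 1) = e ^ (m div 2 + 2)"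
          by (metis power_add)
        then have "of_nat (m choose i) * (deriv ^^ i) f z0 * (deriv ^^ (m - i)) f z0 =
            (of_nat (m choose i) * r1 * r2) * e ^ (m div 2 + 2)"
          unfolding r by (metis mult.assoc mult.left_commute)
        moreover have "of_nat (m choose i) * r1 * r2 \<in> \<rat>" using r by auto
        ultimately show ?thesis by blast
      next
        case False
        then show ?thesis using less[of i] i m by (intro bexI[of _ 0]) auto
      qed
      then obtain r where r: "\<And>i. i \<in> {0..m} \<Longrightarrow> r i \<in> \<rat>"
        "\<And>i. i \<in> {0..m} \<Longrightarrow> of_nat (m choose i) * (deriv ^^ i) f z0 * (deriv ^^ (m - i)) f z0 = r i * e ^ (m div 2 + 2)"
        by metis
      have "S = (\<Sum>i = 0..m. r i) * e ^ (m div 2 + 2)"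
        unfolding S_def sum_distrib_right using r by (intro sum.cong) auto
      then have "(deriv ^^ n) f z0 = (6 * (\<Sum>i = 0..m. r i) - (if m = 0 then 2 else 0)) * e ^ (n div 2 + 1)"
        unfolding eq using m by (auto simp: algebra_simps power2_eq_square)
      moreover have "(\<Sum>i = 0..m. r i) \<in> \<rat>" using r(1) by (rule Rats_sum)
      then have "6 * (\<Sum>i = 0..m. r i) - (if m = 0 then 2 else 0) \<in> \<rat>" by auto
      ultimately show ?thesis using True m by auto
    next
      case False
      have "of_nat (m choose i) * (deriv ^^ i) f z0 * (deriv ^^ (m - i)) f z0 = 0" if i: "i \<in> {0..m}" for i
      proof (cases "even i")
        case True
        then have "odd (m - i)" using False i by auto
        then show ?thesis using less[of "m - i"] m by auto
      qed (use less[of i] i m in auto)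
      then have "S = 0" unfolding S_def by (intro sum.neutral) auto
      then show ?thesis using eq False m by (cases "m = 0") auto
    qed
  qed
qed

text \<open>Subtracting c = Z(z0) makes all even derivatives of g = Z - c vanish at z0, so the
  unknown value c drops out: 2 c g contributes nothing in even order. The first derivative of g
  contains -pi and the other odd ones are rational multiples of powers of e. Two factors -pi can
  meet only for p = 2, with binomial coefficient 2, which is the exceptional 2 pi^2.\<close>

lemma gauss_cot_square_higher_deriv:
  assumes z0: "z0 \<notin> gauss_ints" and q: "(gauss_csc z0)\<^sup>2 = q * lem_half\<^sup>2" "q \<in> \<rat>"
    and crit: "gauss_csc z0 * deriv gauss_csc z0 = 0"
    and p: "even p" "p \<ge> 2"
  shows "\<exists>r\<in>\<rat>. \<exists>s\<in>\<rat>. (deriv ^^ p) (\<lambda>z. (gauss_cot z)\<^sup>2 + deriv gauss_cot z) z0 =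
     r * (lem_half\<^sup>2) ^ (p div 2 + 1) + s * of_real pi * (lem_half\<^sup>2) ^ (p div 2) + (if p = 2 then 2 * of_real pi ^ 2 else 0)"
proof -
  define e where "e = lem_half\<^sup>2"
  define f where "f = (\<lambda>z. (gauss_csc z)\<^sup>2)"
  define c where "c = gauss_cot z0"
  define g where "g = (\<lambda>z. gauss_cot z - c)"
  let ?A = "- gauss_ints"
  note A = open_gauss_compl
  have z0A: "z0 \<in> ?A" using z0 by simp
  have fh: "f holomorphic_on ?A" unfolding f_def by (intro holomorphic_intros gauss_csc_holomorphic)
  have gh: "g holomorphic_on ?A" unfolding g_def by (intro holomorphic_intros gauss_cot_holomorphic)
  have F: "(even n \<longrightarrow> (\<exists>r\<in>\<rat>. (deriv ^^ n) f z0 = r * e ^ (n div 2 + 1))) \<and> (odd n \<longrightarrow> (deriv ^^ n) f z0 = 0)" for n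
  proof (rule ode_higher_derivs[OF A z0A fh])
    show "deriv (deriv f) z = 6 * (f z)\<^sup>2 - 2 * e\<^sup>2" if "z \<in> ?A" for z
      using csc_square_ode(1)[of z] that by (simp add: f_def e_def)
    show "f z0 = q * e" using q by (simp add: f_def e_def)
    show "deriv f z0 = 0" using csc_square_ode(2)[OF z0] crit by (simp add: f_def)
  qed (rule q(2))
  have dg: "deriv g z = - f z - of_real pi" if "z \<in> ?A" for z
  proof -
    have "(g has_field_derivative deriv gauss_cot z - 0) (at z)"
      unfolding g_def using holomorphic_derivI[OF gauss_cot_holomorphic A that] by (intro DERIV_diff DERIV_const)
    then show ?thesis using DERIV_imp_deriv gauss_cot_deriv[of z] that by (simp add: f_def)
  qed
  have GS: "(deriv ^^ Suc j) g z0 = - (deriv ^^ j) f z0 - (if j = 0 then of_real pi else 0)" for j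
  proof -
    have "(deriv ^^ Suc j) g z0 = (deriv ^^ j) (deriv g) z0" by (simp add: funpow_swap1)
    also have "\<dots> = (deriv ^^ j) (\<lambda>z. (- 1) * f z - of_real pi) z0"
      by (rule higher_deriv_transform_within_open[OF _ _ A z0A])
        (auto intro!: holomorphic_intros holomorphic_deriv gh fh A simp: dg)
    also have "\<dots> = (deriv ^^ j) (\<lambda>z. (- 1) * f z) z0 - (deriv ^^ j) (\<lambda>z. of_real pi) z0"
      by (rule higher_deriv_diff[OF _ _ A z0A]) (intro holomorphic_intros fh)+
    also have "(deriv ^^ j) (\<lambda>z. (- 1) * f z) z0 = (- 1) * (deriv ^^ j) f z0"
      by (rule higher_deriv_cmult[OF fh z0A A])
    finally show ?thesis by simp
  qed
  have Geven: "(deriv ^^ j) g z0 = 0" if "even j" for j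
    using that GS[of "j - 1"] F[of "j - 1"] by (cases "j = 0") (auto simp: g_def c_def)
  have Godd: "\<exists>r\<in>\<rat>. (deriv ^^ j) g z0 = r * e ^ ((j + 1) div 2) - (if j = 1 then of_real pi else 0)" if "odd j" for j
  proof -
    from that obtain k where k: "j = Suc k" "even k" by (metis even_Suc odd_Suc_div_two oddE Suc_eq_plus1 even_mult_iff even_numeral)
    then obtain r where "r \<in> \<rat>" "(deriv ^^ k) f z0 = r * e ^ (k div 2 + 1)" using F[of k] by auto
    then show ?thesis using GS[of k] k by (intro bexI[of _ "- r"]) auto
  qed
  have "\<exists>r\<in>\<rat>. \<exists>s\<in>\<rat>. of_nat (p choose i) * (deriv ^^ i) g z0 * (deriv ^^ (p - i)) g z0 =
      r * e ^ (p div 2 + 1) + s * (of_real pi * e ^ (p div 2)) + (if p = 2 \<and> i = 1 then 2 * of_real pi ^ 2 else 0)"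
    if i: "i \<in> {0..p}" for i
  proof (cases "even i")
    case True
    then show ?thesis using Geven by (intro bexI[of _ 0]) auto
  next
    case False
    then have od: "odd (p - i)" using p i by auto
    obtain r1 where r1: "r1 \<in> \<rat>" "(deriv ^^ i) g z0 = r1 * e ^ ((i + 1) div 2) - (if i = 1 then of_real pi else 0)"
      using Godd[OF False] by blast
    obtain r2 where r2: "r2 \<in> \<rat>" "(deriv ^^ (p - i)) g z0 = r2 * e ^ ((p - i + 1) div 2) - (if p - i = 1 then of_real pi else 0)"
      using Godd[OF od] by blast
    have "(i + 1) div 2 + (p - i + 1) div 2 = p div 2 + 1" using False od i p by (auto elim!: oddE evenE)
    then have e1: "e ^ ((i + 1) div 2) * e ^ ((p - i + 1) div 2) = e ^ (p div 2 + 1)" by (metis power_add)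
    let ?C = "of_nat (p choose i) :: complex"
    have "?C * (deriv ^^ i) g z0 * (deriv ^^ (p - i)) g z0 =
       ?C * r1 * r2 * (e ^ ((i + 1) div 2) * e ^ ((p - i + 1) div 2))
       + (- (if i = 1 then ?C * r2 * (of_real pi * e ^ ((p - i + 1) div 2)) else 0)
          - (if p - i = 1 then ?C * r1 * (of_real pi * e ^ ((i + 1) div 2)) else 0))
       + (if i = 1 \<and> p - i = 1 then ?C * of_real pi ^ 2 else 0)"
      unfolding r1 r2 by (simp add: algebra_simps power2_eq_square)
    also have "(if i = 1 then ?C * r2 * (of_real pi * e ^ ((p - i + 1) div 2)) else 0) =
       (if i = 1 then ?C * r2 else 0) * (of_real pi * e ^ (p div 2))" using p by (auto elim!: evenE)
    also have "(if p - i = 1 then ?C * r1 * (of_real pi * e ^ ((i + 1) div 2)) else 0) =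
       (if p - i = 1 then ?C * r1 else 0) * (of_real pi * e ^ (p div 2))"
    proof -
      have "i + 1 = p" if "p - i = 1" using that by simp
      then show ?thesis by auto
    qed
    also have "(if i = 1 \<and> p - i = 1 then ?C * of_real pi ^ 2 else 0) = (if p = 2 \<and> i = 1 then 2 * of_real pi ^ 2 else 0 :: complex)"
      by auto
    finally have "?C * (deriv ^^ i) g z0 * (deriv ^^ (p - i)) g z0 = (?C * r1 * r2) * e ^ (p div 2 + 1) +
        (- (if i = 1 then ?C * r2 else 0) - (if p - i = 1 then ?C * r1 else 0)) * (of_real pi * e ^ (p div 2)) +
        (if p = 2 \<and> i = 1 then 2 * of_real pi ^ 2 else 0)"
      unfolding e1 by (simp add: algebra_simps)
    moreover have "?C * r1 * r2 \<in> \<rat>" "- (if i = 1 then ?C * r2 else 0) - (if p - i = 1 then ?C * r1 else 0) \<in> \<rat>"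
      using r1(1) r2(1) by auto
    ultimately show ?thesis by blast
  qed
  then obtain r s where rs: "\<And>i. i \<in> {0..p} \<Longrightarrow> r i \<in> \<rat>" "\<And>i. i \<in> {0..p} \<Longrightarrow> s i \<in> \<rat>"
    "\<And>i. i \<in> {0..p} \<Longrightarrow> of_nat (p choose i) * (deriv ^^ i) g z0 * (deriv ^^ (p - i)) g z0 =
      r i * e ^ (p div 2 + 1) + s i * (of_real pi * e ^ (p div 2)) + (if p = 2 \<and> i = 1 then 2 * of_real pi ^ 2 else 0)"
    by metis
  have "(deriv ^^ p) (\<lambda>z. g z * g z) z0 = (\<Sum>i = 0..p. of_nat (p choose i) * (deriv ^^ i) g z0 * (deriv ^^ (p - i)) g z0)"
    by (rule higher_deriv_mult[OF gh gh A z0A])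
  also have "\<dots> = (\<Sum>i = 0..p. r i * e ^ (p div 2 + 1) + s i * (of_real pi * e ^ (p div 2)) + (if p = 2 \<and> i = 1 then 2 * of_real pi ^ 2 else 0))"
    using rs(3) by (intro sum.cong) auto
  also have "\<dots> = (\<Sum>i = 0..p. r i) * e ^ (p div 2 + 1) + (\<Sum>i = 0..p. s i) * (of_real pi * e ^ (p div 2)) +
      (\<Sum>i = 0..p. if p = 2 \<and> i = 1 then 2 * of_real pi ^ 2 else 0)"
    by (simp add: sum.distrib sum_distrib_right)
  also have "(\<Sum>i = 0..p. if p = 2 \<and> i = 1 then 2 * of_real pi ^ 2 else 0 :: complex) = (if p = 2 then 2 * of_real pi ^ 2 else 0)"
    by (cases "p = 2") (simp_all add: sum.delta' eval_nat_numeral)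
  finally have gg: "(deriv ^^ p) (\<lambda>z. g z * g z) z0 = (\<Sum>i = 0..p. r i) * e ^ (p div 2 + 1) +
      (\<Sum>i = 0..p. s i) * (of_real pi * e ^ (p div 2)) + (if p = 2 then 2 * of_real pi ^ 2 else 0)" .
  have "(deriv ^^ p) (\<lambda>z. (gauss_cot z)\<^sup>2 + deriv gauss_cot z) z0 =
      (deriv ^^ p) (\<lambda>z. g z * g z + (2 * c * g z - f z + (c\<^sup>2 - of_real pi))) z0"
  proof (rule higher_deriv_transform_within_open[OF _ _ A z0A])
    show "(\<lambda>z. (gauss_cot z)\<^sup>2 + deriv gauss_cot z) holomorphic_on ?A"
      by (intro holomorphic_intros gauss_cot_holomorphic holomorphic_deriv A)
    show "(\<lambda>z. g z * g z + (2 * c * g z - f z + (c\<^sup>2 - of_real pi))) holomorphic_on ?A"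
      by (intro holomorphic_intros gh fh)
    show "(gauss_cot w)\<^sup>2 + deriv gauss_cot w = g w * g w + (2 * c * g w - f w + (c\<^sup>2 - of_real pi))" if "w \<in> ?A" for w
      using that unfolding g_def f_def by (subst gauss_cot_deriv) (auto simp: power2_eq_square algebra_simps)
  qed
  also have "\<dots> = (deriv ^^ p) (\<lambda>z. g z * g z) z0 + (deriv ^^ p) (\<lambda>z. 2 * c * g z - f z + (c\<^sup>2 - of_real pi)) z0"
    by (rule higher_deriv_add[OF _ _ A z0A]) (intro holomorphic_intros gh fh)+
  also have "(deriv ^^ p) (\<lambda>z. 2 * c * g z - f z + (c\<^sup>2 - of_real pi)) z0 =
     (deriv ^^ p) (\<lambda>z. 2 * c * g z - f z) z0 + (deriv ^^ p) (\<lambda>z. c\<^sup>2 - of_real pi) z0"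
    by (rule higher_deriv_add[OF _ _ A z0A]) (intro holomorphic_intros gh fh)+
  also have "(deriv ^^ p) (\<lambda>z. 2 * c * g z - f z) z0 = (deriv ^^ p) (\<lambda>z. 2 * c * g z) z0 - (deriv ^^ p) f z0"
    by (rule higher_deriv_diff[OF _ _ A z0A]) (intro holomorphic_intros gh fh)+
  also have "(deriv ^^ p) (\<lambda>z. 2 * c * g z) z0 = 2 * c * (deriv ^^ p) g z0"
    by (rule higher_deriv_cmult[OF gh z0A A])
  finally have eq: "(deriv ^^ p) (\<lambda>z. (gauss_cot z)\<^sup>2 + deriv gauss_cot z) z0 = (deriv ^^ p) (\<lambda>z. g z * g z) z0 - (deriv ^^ p) f z0"
    using p Geven by simp
  obtain r' where r': "r' \<in> \<rat>" "(deriv ^^ p) f z0 = r' * e ^ (p div 2 + 1)" using F p by blast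
  have "(\<Sum>i = 0..p. r i) \<in> \<rat>" "(\<Sum>i = 0..p. s i) \<in> \<rat>" using rs(1,2) by (auto intro!: Rats_sum)
  then show ?thesis
    using r'(1) unfolding eq gg r'(2) e_def[symmetric]
    by (intro bexI[of _ "(\<Sum>i = 0..p. r i) - r'"] bexI[of _ "\<Sum>i = 0..p. s i"]) (auto simp: algebra_simps)
qed

section \<open>Hyperbolic series as Taylor coefficients\<close>

lemma abs_summable_on_product:
  fixes f :: "'a \<Rightarrow> complex" and g :: "'b \<Rightarrow> complex"
  assumes "(\<lambda>x. norm (f x)) summable_on A" "(\<lambda>y. norm (g y)) summable_on B"
  shows "(\<lambda>(x, y). norm (f x * g y)) summable_on A \<times> B"
proof -
  have "(\<lambda>z. norm (f (fst z)) * norm (g (snd z))) summable_on A \<times> B"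
  proof (rule summable_on_SigmaI)
    show "((\<lambda>y. norm (f (fst (x, y))) * norm (g (snd (x, y)))) has_sum norm (f x) * (\<Sum>\<^sub>\<infinity>y\<in>B. norm (g y))) B" for x
      using assms(2) by (auto intro!: has_sum_cmult_right)
    show "(\<lambda>x. norm (f x) * (\<Sum>\<^sub>\<infinity>y\<in>B. norm (g y))) summable_on A"
      using assms(1) by (rule summable_on_cmult_left)
  qed auto
  then show ?thesis by (simp add: case_prod_unfold norm_mult)
qed

text \<open>With X = exp (2 pi i (z + m i)) of modulus below 1, pi cot + pi i equals -2 pi i X / (1
  - X). The normalising constant of \<open>cot_row\<close> is the one that leaves no constant term
  in this series.\<close>

lemma cot_row_pos:
  assumes "Im z + real m > 0" "m > 0"
  shows "(\<lambda>k. - 2 * of_real pi * \<i> * exp (2 * of_real pi * \<i> * of_nat (Suc k) * (z + \<i> * of_nat m))) sums cot_row (int m) z"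
proof -
  let ?u = "of_real pi * (z + \<i> * of_nat m)"
  let ?X = "exp (2 * \<i> * ?u)"
  have X: "norm ?X < 1"
  proof -
    have "Re (2 * \<i> * ?u) = - (2 * pi * (Im z + real m))" by (simp add: algebra_simps)
    then show ?thesis using assms by (simp only: norm_exp_eq_Re) simp
  qed
  have "?X \<noteq> 1" using X by (metis norm_one less_irrefl)
  have sin: "sin ?u \<noteq> 0"
  proof
    assume "sin ?u = 0"
    then have "z + \<i> * of_nat m \<in> \<int>" by (simp add: sin_pi_eq_0_iff)
    then have "Im (z + \<i> * of_nat m) = 0" by (metis Ints_cases Im_complex_of_real of_real_of_int_eq)
    then show False using assms by simp
  qed
  have "(\<lambda>k. (- 2 * of_real pi * \<i> * ?X) * ?X ^ k) sums ((- 2 * of_real pi * \<i> * ?X) * (1 / (1 - ?X)))"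
    by (intro sums_mult geometric_sums X)
  moreover have "(- 2 * of_real pi * \<i> * ?X) * ?X ^ k = - 2 * of_real pi * \<i> * exp (2 * of_real pi * \<i> * of_nat (Suc k) * (z + \<i> * of_nat m))" for k
  proof -
    have "exp (2 * of_real pi * \<i> * of_nat (Suc k) * (z + \<i> * of_nat m)) = exp (of_nat (Suc k) * (2 * \<i> * ?u))"
      by (simp add: algebra_simps)
    also have "\<dots> = ?X ^ Suc k" by (rule exp_of_nat_mult)
    finally show ?thesis by simp
  qed
  moreover have "cot_row (int m) z = (- 2 * of_real pi * \<i> * ?X) * (1 / (1 - ?X))"
  proof -
    have XX: "?X = exp (\<i> * ?u) * exp (\<i> * ?u)" by (simp add: exp_add[symmetric] mult.assoc)
    have inv: "exp (- (\<i> * ?u)) * exp (\<i> * ?u) = 1" by (simp add: exp_add[symmetric])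
    have "2 * \<i> * sin ?u = exp (\<i> * ?u) - exp (- (\<i> * ?u))" "2 * cos ?u = exp (\<i> * ?u) + exp (- (\<i> * ?u))"
      unfolding sin_exp_eq cos_exp_eq by simp_all
    then have s: "2 * \<i> * sin ?u * exp (\<i> * ?u) = ?X - 1" and c: "2 * cos ?u * exp (\<i> * ?u) = ?X + 1"
      unfolding XX by (simp_all only: left_diff_distrib distrib_right inv)
    have "cos ?u / sin ?u = \<i> * (?X + 1) / (?X - 1)"
      unfolding s[symmetric] c[symmetric] using sin by (simp add: field_simps)
    then have "cot_row (int m) z = of_real pi * (\<i> * (?X + 1) / (?X - 1)) + \<i> * of_real pi"
      using assms(2) by (simp add: cot_row_def cot_def)
    also have "\<dots> = (- 2 * of_real pi * \<i> * ?X) * (1 / (1 - ?X))"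
      using \<open>?X \<noteq> 1\<close> by (simp add: divide_simps) (simp add: algebra_simps)
    finally show ?thesis .
  qed
  ultimately show ?thesis by (simp only:)
qed

text \<open>Absolute convergence behind the exchange of rows and frequencies. With d = 1 - |Im w|
  one has Im w + m + 1 \<ge> d (m + 1), and 2 (k + 1) (m + 1) \<ge> m + k splits the exponent into a
  product majorant.\<close>

lemma double_exp_summable:
  fixes w :: complex
  assumes "\<bar>Im w\<bar> < 1"
  shows "(\<lambda>(m, k). of_nat (Suc m) * exp (2 * of_real pi * \<i> * of_nat (Suc k) * (w + \<i> * of_nat (Suc m)))) summable_on UNIV"
proof -
  define d where "d = 1 - \<bar>Im w\<bar>"
  have d: "d > 0" using assms by (simp add: d_def)
  have g: "(\<lambda>m. real (Suc m) * exp (- d) ^ m) summable_on UNIV" "(\<lambda>k. exp (- d) ^ k) summable_on UNIV"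
    using geometric_deriv_sums[of "exp (- d)"] d
    by (auto intro!: norm_summable_imp_summable_on summable_geometric simp: sums_iff)
  have "(\<lambda>(m, k). (real (Suc m) * exp (- d) ^ m) * exp (- d) ^ k) summable_on UNIV \<times> UNIV"
    using abs_summable_on_product[of "\<lambda>m. of_real (real (Suc m) * exp (- d) ^ m)" UNIV "\<lambda>k. of_real (exp (- d) ^ k)" UNIV] g
    by (simp add: case_prod_unfold norm_mult norm_power del: of_nat_Suc)
  moreover have "norm (of_nat (Suc m) * exp (2 * of_real pi * \<i> * of_nat (Suc k) * (w + \<i> * of_nat (Suc m)))) \<le>
     (real (Suc m) * exp (- d) ^ m) * exp (- d) ^ k" for m k
  proof -
    have 1: "d * real (Suc m) \<le> Im w + real (Suc m)"
    proof -
      define t M where "t = \<bar>Im w\<bar>" and "M = real (Suc m)"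
      have "t * 1 \<le> t * M" unfolding t_def M_def by (intro mult_left_mono) auto
      moreover have "- t \<le> Im w" unfolding t_def by linarith
      ultimately show ?thesis unfolding d_def t_def[symmetric] M_def[symmetric] left_diff_distrib by linarith
    qed
    have "real m + real k \<le> 2 * (real (Suc k) * real (Suc m))" by (simp add: algebra_simps)
    also have "\<dots> \<le> (2 * pi) * (real (Suc k) * real (Suc m))" using pi_gt3 by (intro mult_right_mono) auto
    finally have "d * (real m + real k) \<le> d * ((2 * pi) * (real (Suc k) * real (Suc m)))" using d by (intro mult_left_mono) auto
    also have "\<dots> = 2 * pi * real (Suc k) * (d * real (Suc m))" by simp
    also have "\<dots> \<le> 2 * pi * real (Suc k) * (Im w + real (Suc m))" by (intro mult_left_mono 1) auto
    finally have *: "- (2 * pi * real (Suc k) * (Im w + real (Suc m))) \<le> - (d * (real m + real k))" by simp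
    have "Re (2 * of_real pi * \<i> * of_nat (Suc k) * (w + \<i> * of_nat (Suc m))) = - (2 * pi * real (Suc k) * (Im w + real (Suc m)))"
      by (simp add: algebra_simps)
    then have "norm (exp (2 * of_real pi * \<i> * of_nat (Suc k) * (w + \<i> * of_nat (Suc m)))) \<le> exp (- (d * (real m + real k)))"
      using * by (simp only: norm_exp_eq_Re exp_le_cancel_iff)
    also have "\<dots> = exp (- d) ^ m * exp (- d) ^ k"
      by (simp add: exp_of_nat_mult[symmetric] exp_add[symmetric] algebra_simps)
    finally have "norm (exp (2 * of_real pi * \<i> * of_nat (Suc k) * (w + \<i> * of_nat (Suc m)))) \<le> exp (- d) ^ m * exp (- d) ^ k" .
    then show ?thesis unfolding norm_mult mult.assoc by (intro mult_mono) (auto simp del: of_nat_Suc)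
  qed
  ultimately have "(\<lambda>x. norm ((\<lambda>(m, k). of_nat (Suc m) * exp (2 * of_real pi * \<i> * of_nat (Suc k) * (w + \<i> * of_nat (Suc m)))) x)) summable_on UNIV"
    by (intro Infinite_Sum.abs_summable_on_comparison_test'[where g = "\<lambda>(m, k). (real (Suc m) * exp (- d) ^ m) * exp (- d) ^ k"]) auto
  then show ?thesis by (rule abs_summable_summable)
qed

text \<open>A Lambert series summed the other way: for fixed k the sum of (m + 1) q^(m + 1) with q =
  exp (-2 pi (k + 1)) is q / (1 - q)^2 = 1 / (4 sinh^2 (pi (k + 1))).\<close>

lemma infsum_exp_columns:
  fixes w :: complex
  assumes "\<bar>Im w\<bar> < 1"
  shows "(\<Sum>\<^sub>\<infinity>m. of_nat (Suc m) * cot_row (int (Suc m)) w) =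
     - 2 * of_real pi * \<i> * (\<Sum>\<^sub>\<infinity>k. exp (2 * of_real pi * \<i> * of_nat (Suc k) * w) / of_real (4 * (sinh (pi * real (Suc k)))\<^sup>2))"
    "(\<lambda>k. exp (2 * of_real pi * \<i> * of_nat (Suc k) * w) / of_real (4 * (sinh (pi * real (Suc k)))\<^sup>2)) summable_on UNIV"
proof -
  let ?t = "\<lambda>m k. of_nat (Suc m) * exp (2 * of_real pi * \<i> * of_nat (Suc k) * (w + \<i> * of_nat (Suc m)))"
  have s: "(\<lambda>(m, k). ?t m k) summable_on UNIV \<times> UNIV" using double_exp_summable[OF assms] by simp
  have s': "(\<lambda>(k, m). ?t m k) summable_on UNIV \<times> UNIV"
    using s by (subst summable_on_swap) (simp add: case_prod_unfold)
  have row: "of_nat (Suc m) * cot_row (int (Suc m)) w = - 2 * of_real pi * \<i> * (\<Sum>\<^sub>\<infinity>k. ?t m k)" for m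
  proof -
    have pos: "Im w + real (Suc m) > 0" using assms by simp
    have "(\<lambda>k. ?t m k) summable_on UNIV"
      using summable_on_SigmaD1[of "\<lambda>m k. ?t m k" UNIV "\<lambda>_. UNIV" m] s by simp
    then have "(\<lambda>k. ?t m k) sums (\<Sum>\<^sub>\<infinity>k. ?t m k)" by (intro has_sum_imp_sums has_sum_infsum)
    then have "(\<lambda>k. - 2 * of_real pi * \<i> * ?t m k) sums (- 2 * of_real pi * \<i> * (\<Sum>\<^sub>\<infinity>k. ?t m k))" by (rule sums_mult)
    moreover have "(\<lambda>k. of_nat (Suc m) * (- 2 * of_real pi * \<i> * exp (2 * of_real pi * \<i> * of_nat (Suc k) * (w + \<i> * of_nat (Suc m)))))
        sums (of_nat (Suc m) * cot_row (int (Suc m)) w)"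
      by (rule sums_mult[OF cot_row_pos[OF pos]]) simp
    ultimately show ?thesis by (simp add: mult_ac sums_iff)
  qed
  have col: "(\<Sum>\<^sub>\<infinity>m. ?t m k) = exp (2 * of_real pi * \<i> * of_nat (Suc k) * w) / of_real (4 * (sinh (pi * real (Suc k)))\<^sup>2)" for k
  proof -
    let ?q = "exp (- (2 * pi * real (Suc k)))"
    have q: "?q < 1" "?q > 0" by auto
    have "(\<lambda>m. real (Suc m) * ?q ^ m) sums (1 / (1 - ?q)\<^sup>2)" by (rule geometric_deriv_sums) simp
    then have "(\<lambda>m. complex_of_real (real (Suc m) * ?q ^ m)) sums complex_of_real (1 / (1 - ?q)\<^sup>2)" by (rule sums_of_real)
    then have "(\<lambda>m. exp (2 * of_real pi * \<i> * of_nat (Suc k) * w) * of_real ?q * complex_of_real (real (Suc m) * ?q ^ m)) sums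
       (exp (2 * of_real pi * \<i> * of_nat (Suc k) * w) * of_real ?q * complex_of_real (1 / (1 - ?q)\<^sup>2))" by (rule sums_mult)
    moreover have "exp (2 * of_real pi * \<i> * of_nat (Suc k) * w) * of_real ?q * complex_of_real (real (Suc m) * ?q ^ m) = ?t m k" for m
    proof -
      have "exp (2 * of_real pi * \<i> * of_nat (Suc k) * (w + \<i> * of_nat (Suc m))) =
        exp (2 * of_real pi * \<i> * of_nat (Suc k) * w) * exp (of_nat (Suc m) * of_real (- (2 * pi * real (Suc k))))"
        by (simp add: exp_add[symmetric] algebra_simps)
      also have "exp (of_nat (Suc m) * of_real (- (2 * pi * real (Suc k)))) = (of_real ?q :: complex) ^ Suc m"
        by (simp only: exp_of_nat_mult exp_of_real)
      finally show ?thesis by simp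
    qed
    moreover have "?q * (1 / (1 - ?q)\<^sup>2) = 1 / (4 * (sinh (pi * real (Suc k)))\<^sup>2)"
    proof -
      have a: "sinh (pi * real (Suc k)) = exp (pi * real (Suc k)) * (1 - ?q) / 2"
        by (simp add: sinh_def field_simps exp_add[symmetric])
      have "?q * (exp (pi * real (Suc k)))\<^sup>2 = 1" by (simp add: power2_eq_square exp_add[symmetric])
      then have "?q = 1 / (exp (pi * real (Suc k)))\<^sup>2" by (simp add: field_simps)
      moreover have "4 * (exp (pi * real (Suc k)) * (1 - ?q) / 2)\<^sup>2 = (exp (pi * real (Suc k)))\<^sup>2 * (1 - ?q)\<^sup>2"
        by (simp add: power_mult_distrib power_divide)
      ultimately show ?thesis unfolding a by (metis divide_divide_eq_left' mult.commute mult_1 times_divide_eq_left)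
    qed
    ultimately have "(\<lambda>m. ?t m k) sums (exp (2 * of_real pi * \<i> * of_nat (Suc k) * w) * of_real (1 / (4 * (sinh (pi * real (Suc k)))\<^sup>2)))"
      by (simp only: mult.assoc of_real_mult[symmetric])
    moreover have "(\<lambda>m. ?t m k) summable_on UNIV"
      using summable_on_SigmaD1[of "\<lambda>k m. ?t m k" UNIV "\<lambda>_. UNIV" k] s' by simp
    then have "(\<lambda>m. ?t m k) sums (\<Sum>\<^sub>\<infinity>m. ?t m k)" by (intro has_sum_imp_sums has_sum_infsum)
    ultimately show ?thesis by (simp add: sums_iff)
  qed
  have "(\<Sum>\<^sub>\<infinity>m. of_nat (Suc m) * cot_row (int (Suc m)) w) = - 2 * of_real pi * \<i> * (\<Sum>\<^sub>\<infinity>m. \<Sum>\<^sub>\<infinity>k. ?t m k)"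
    unfolding row by (rule infsum_cmult_right')
  also have "(\<Sum>\<^sub>\<infinity>m. \<Sum>\<^sub>\<infinity>k. ?t m k) = (\<Sum>\<^sub>\<infinity>k. \<Sum>\<^sub>\<infinity>m. ?t m k)" by (rule infsum_swap_banach[OF s])
  finally show "(\<Sum>\<^sub>\<infinity>m. of_nat (Suc m) * cot_row (int (Suc m)) w) =
     - 2 * of_real pi * \<i> * (\<Sum>\<^sub>\<infinity>k. exp (2 * of_real pi * \<i> * of_nat (Suc k) * w) / of_real (4 * (sinh (pi * real (Suc k)))\<^sup>2))"
    unfolding col .
  show "(\<lambda>k. exp (2 * of_real pi * \<i> * of_nat (Suc k) * w) / of_real (4 * (sinh (pi * real (Suc k)))\<^sup>2)) summable_on UNIV"
    using summable_on_Sigma_banach[OF s'] unfolding col .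
qed

lemma infsum_int_pos_neg:
  fixes f :: "int \<Rightarrow> complex"
  assumes "f summable_on UNIV" "f 0 = 0"
  shows "(\<Sum>\<^sub>\<infinity>n. f n) = (\<Sum>\<^sub>\<infinity>m. f (int (Suc m))) + (\<Sum>\<^sub>\<infinity>m. f (- int (Suc m)))"
proof -
  have U: "n \<in> {0} \<union> (range (\<lambda>m. int (Suc m)) \<union> range (\<lambda>m. - int (Suc m)))" for n :: int
  proof -
    consider "n = 0" | "n > 0" | "n < 0" by linarith
    then show ?thesis
    proof cases
      case 2
      then have "n = int (Suc (nat (n - 1)))" by auto
      then show ?thesis by blast
    next
      case 3
      then have "n = - int (Suc (nat (- n - 1)))" by auto
      then show ?thesis by blast
    qed auto
  qed
  have s: "f summable_on A" for A using assms(1) by (rule summable_on_subset_banach) auto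
  have "(\<Sum>\<^sub>\<infinity>n. f n) = infsum f (range (\<lambda>m. int (Suc m)) \<union> range (\<lambda>m. - int (Suc m)))"
  proof (rule infsum_cong_neutral)
    fix n assume "n \<in> UNIV - (range (\<lambda>m. int (Suc m)) \<union> range (\<lambda>m. - int (Suc m)))"
    then have "n = 0" using U[of n] by blast
    then show "f n = 0" using assms(2) by simp
  qed auto
  also have "\<dots> = infsum f (range (\<lambda>m. int (Suc m))) + infsum f (range (\<lambda>m. - int (Suc m)))"
    by (rule infsum_Un_disjoint) (auto intro: s)
  also have "infsum f (range (\<lambda>m. int (Suc m))) = (\<Sum>\<^sub>\<infinity>m. f (int (Suc m)))"
    by (subst infsum_reindex) (auto simp: inj_def o_def)
  also have "infsum f (range (\<lambda>m. - int (Suc m))) = (\<Sum>\<^sub>\<infinity>m. f (- int (Suc m)))"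
    by (subst infsum_reindex) (auto simp: inj_def o_def)
  finally show ?thesis .
qed

text \<open>Row -n at z is minus row n at -z and its weight changes sign too, so opposite rows give
  the same exponentials in z and -z, which pair up to cosines.\<close>

lemma gauss_cot1_fourier:
  fixes z :: complex
  assumes z: "\<bar>Im z\<bar> < 1"
  shows "gauss_cot1 z = - of_real pi * \<i> * (\<Sum>\<^sub>\<infinity>k. cos (2 * of_real pi * of_nat (Suc k) * z) / of_real ((sinh (pi * real (Suc k)))\<^sup>2))"
proof -
  let ?e = "\<lambda>w k. exp (2 * of_real pi * \<i> * of_nat (Suc k) * w) / of_real (4 * (sinh (pi * real (Suc k)))\<^sup>2) :: complex"
  have z': "\<bar>Im (- z)\<bar> < 1" using z by simp
  have "gauss_cot1 z = (\<Sum>\<^sub>\<infinity>m. of_nat (Suc m) * cot_row (int (Suc m)) z) + (\<Sum>\<^sub>\<infinity>m. of_nat (Suc m) * cot_row (int (Suc m)) (- z))"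
    unfolding gauss_cot1_def
    by (subst infsum_int_pos_neg[OF row_decay_summable[OF row_decay_n_cot]]) (simp_all add: cot_row_minus algebra_simps)
  also have "\<dots> = - 2 * of_real pi * \<i> * ((\<Sum>\<^sub>\<infinity>k. ?e z k) + (\<Sum>\<^sub>\<infinity>k. ?e (- z) k))"
    unfolding infsum_exp_columns(1)[OF z] infsum_exp_columns(1)[OF z'] by (simp only: distrib_left)
  also have "(\<Sum>\<^sub>\<infinity>k. ?e z k) + (\<Sum>\<^sub>\<infinity>k. ?e (- z) k) = (\<Sum>\<^sub>\<infinity>k. ?e z k + ?e (- z) k)"
    by (rule infsum_add[symmetric]; rule infsum_exp_columns(2)) (use z in auto)
  also have "\<dots> = (\<Sum>\<^sub>\<infinity>k. (1/2) * (cos (2 * of_real pi * of_nat (Suc k) * z) / of_real ((sinh (pi * real (Suc k)))\<^sup>2)))"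
    by (intro infsum_cong) (simp add: cos_exp_eq add_divide_distrib mult_ac)
  also have "\<dots> = (1/2) * (\<Sum>\<^sub>\<infinity>k. cos (2 * of_real pi * of_nat (Suc k) * z) / of_real ((sinh (pi * real (Suc k)))\<^sup>2))"
    by (rule infsum_cmult_right')
  finally show ?thesis by simp
qed

lemma exp_le_sinh: assumes "1 \<le> (x::real)" shows "exp x / 4 \<le> sinh x"
proof -
  have "1 + 1 \<le> exp x" using exp_ge_add_one_self[of x] assms by linarith
  moreover have "exp (- x) \<le> 1" using assms by simp
  ultimately show ?thesis unfolding sinh_field_def diff_divide_distrib by linarith
qed

lemma cos_i_times: "cos (\<i> * of_real x) = of_real (cosh x)"
  by (simp add: cos_exp_eq cosh_field_def exp_of_real[symmetric] mult.assoc[symmetric])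

text \<open>In a strip of half-width d < 1 the cosine grows at most like exp (2 pi k d), while
  sinh^2 is at least exp (2 pi k) / 16. The uniform convergence permits termwise differentiation,
  and even order returns the cosine.\<close>

lemma gauss_cot1_higher_deriv:
  assumes z0: "\<bar>Im z0\<bar> < 1" and p: "even p"
  shows "((\<lambda>k. (-1) ^ (p div 2) * (2 * of_real pi * of_nat (Suc k)) ^ p * cos (2 * of_real pi * of_nat (Suc k) * z0)
      / of_real ((sinh (pi * real (Suc k)))\<^sup>2)) has_sum
     (deriv ^^ p) (\<lambda>z. \<Sum>\<^sub>\<infinity>k. cos (2 * of_real pi * of_nat (Suc k) * z) / of_real ((sinh (pi * real (Suc k)))\<^sup>2)) z0) UNIV"
proof -
  define t where "t = (\<lambda>k z. cos (2 * of_real pi * of_nat (Suc k) * z) / of_real ((sinh (pi * real (Suc k)))\<^sup>2) :: complex)"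
  define d where "d = (1 + \<bar>Im z0\<bar>) / 2"
  have d: "\<bar>Im z0\<bar> < d" "d < 1" using z0 by (auto simp: d_def)
  let ?A = "{z. \<bar>Im z\<bar> < d}"
  have A: "open ?A"
  proof -
    have "{z. \<bar>Im z\<bar> < d} = (\<lambda>z. \<bar>Im z\<bar>) -` {..<d}" by auto
    also have "open \<dots>" by (intro continuous_open_vimage) (auto intro!: continuous_intros)
    finally show ?thesis .
  qed
  define M where "M = (\<lambda>k. 16 * exp (- (2 * pi * (1 - d))) ^ Suc k)"
  have "(\<lambda>k. exp (- (2 * pi * (1 - d))) ^ Suc k) summable_on UNIV"
    using d by (intro norm_summable_imp_summable_on) (auto simp: summable_mult summable_geometric)
  then have Ms: "M summable_on UNIV" unfolding M_def by (rule summable_on_cmult_right)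
  have bound: "norm (t k z) \<le> M k" if "z \<in> ?A" for k z
  proof -
    let ?x = "pi * real (Suc k)"
    have x: "?x \<ge> 1" using mult_mono[of 1 pi 1 "real (Suc k)"] pi_gt3 by simp
    have "norm (cos (2 * of_real pi * of_nat (Suc k) * z)) \<le> exp \<bar>Im (2 * of_real pi * of_nat (Suc k) * z)\<bar>"
    proof -
      have "norm (cos w) \<le> exp \<bar>Im w\<bar>" for w :: complex
      proof -
        have "norm (cos w) \<le> (norm (exp (\<i> * w)) + norm (exp (- (\<i> * w)))) / 2"
          unfolding cos_exp_eq norm_divide using norm_triangle_ineq[of "exp (\<i> * w)" "exp (- (\<i> * w))"] by simp
        also have "\<dots> \<le> exp \<bar>Im w\<bar>"
        proof -
          define E where "E = exp \<bar>Im w\<bar>"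
          have "norm (exp (\<i> * w)) \<le> E" "norm (exp (- (\<i> * w))) \<le> E" unfolding E_def by simp_all
          then have "norm (exp (\<i> * w)) + norm (exp (- (\<i> * w))) \<le> E + E" by (rule add_mono)
          then show ?thesis unfolding E_def[symmetric] by simp
        qed
        finally show ?thesis .
      qed
      then show ?thesis .
    qed
    also have "\<bar>Im (2 * of_real pi * of_nat (Suc k) * z)\<bar> = 2 * ?x * \<bar>Im z\<bar>" by (simp add: abs_mult del: of_nat_Suc)
    also have "exp (2 * ?x * \<bar>Im z\<bar>) \<le> exp (2 * ?x * d)" using that x by (simp del: of_nat_Suc)
    finally have c: "norm (cos (2 * of_real pi * of_nat (Suc k) * z)) \<le> exp (2 * ?x * d)" .
    have "exp ?x / 4 \<le> sinh ?x" by (rule exp_le_sinh[OF x])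
    then have "(exp ?x / 4)\<^sup>2 \<le> (sinh ?x)\<^sup>2" by (intro power_mono) auto
    then have s: "exp (2 * ?x) / 16 \<le> (sinh ?x)\<^sup>2" by (simp add: power_divide exp_double del: of_nat_Suc)
    have "norm (t k z) \<le> exp (2 * ?x * d) / (exp (2 * ?x) / 16)"
      unfolding t_def norm_divide norm_of_real using c s
      by (intro frac_le) (auto simp del: of_nat_Suc)
    also have "\<dots> = 16 * exp (2 * ?x * d - 2 * ?x)" by (simp add: exp_diff del: of_nat_Suc)
    also have "2 * ?x * d - 2 * ?x = real (Suc k) * (- (2 * pi * (1 - d)))" by (simp add: algebra_simps)
    also have "16 * exp (real (Suc k) * (- (2 * pi * (1 - d)))) = M k"
      unfolding M_def by (simp only: exp_of_nat_mult)
    finally show ?thesis .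
  qed
  have ul: "uniform_limit ?A (\<lambda>Y z. \<Sum>k\<in>Y. t k z) (\<lambda>z. \<Sum>\<^sub>\<infinity>k. t k z) (finite_subsets_at_top UNIV)"
    by (rule Weierstrass_m_test_general[OF bound Ms])
  have th: "t k holomorphic_on B" for k B unfolding t_def by (auto intro!: holomorphic_intros)
  have "((\<lambda>Y. (deriv ^^ p) (\<lambda>z. \<Sum>k\<in>Y. t k z) z0) \<longlongrightarrow> (deriv ^^ p) (\<lambda>z. \<Sum>\<^sub>\<infinity>k. t k z) z0) (finite_subsets_at_top UNIV)"
    by (rule higher_deriv_complex_uniform_limit[OF ul _ _ A]) (auto intro!: always_eventually holomorphic_on_sum th d)
  moreover have "(deriv ^^ p) (\<lambda>z. \<Sum>k\<in>Y. t k z) z0 = (\<Sum>k\<in>Y. (deriv ^^ p) (t k) z0)" for Y :: "nat set"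
  proof (cases "finite Y")
    case True
    then show ?thesis
    proof (induction Y)
      case (insert x F)
      have "(deriv ^^ p) (\<lambda>z. \<Sum>k\<in>insert x F. t k z) z0 = (deriv ^^ p) (\<lambda>z. t x z + (\<Sum>k\<in>F. t k z)) z0"
        using insert by simp
      also have "\<dots> = (deriv ^^ p) (t x) z0 + (deriv ^^ p) (\<lambda>z. \<Sum>k\<in>F. t k z) z0"
        by (rule higher_deriv_add[of _ UNIV]) (auto intro!: th holomorphic_on_sum)
      finally show ?case using insert by simp
    qed simp
  qed simp
  moreover have dt: "(deriv ^^ (2 * n)) (\<lambda>z. cos (c * z)) = (\<lambda>z. (-1) ^ n * c ^ (2 * n) * cos (c * z))" for n and c :: complex
  proof (induction n)
    case (Suc n)
    have 1: "deriv (\<lambda>z. a * cos (c * z)) = (\<lambda>z. - a * c * sin (c * z))" for a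
      by (rule ext, rule DERIV_imp_deriv) (auto intro!: derivative_eq_intros)
    have 2: "deriv (\<lambda>z. a * sin (c * z)) = (\<lambda>z. a * c * cos (c * z))" for a
      by (rule ext, rule DERIV_imp_deriv) (auto intro!: derivative_eq_intros)
    have "(deriv ^^ (2 * Suc n)) (\<lambda>z. cos (c * z)) = deriv (deriv ((deriv ^^ (2 * n)) (\<lambda>z. cos (c * z))))"
      by simp
    also have "\<dots> = (\<lambda>z. (-1) ^ Suc n * c ^ (2 * Suc n) * cos (c * z))"
      unfolding Suc 1 2 by (simp add: mult_ac)
    finally show ?case .
  qed simp
  have tk: "(deriv ^^ p) (t k) z0 = (-1) ^ (p div 2) * (2 * of_real pi * of_nat (Suc k)) ^ p * cos (2 * of_real pi * of_nat (Suc k) * z0)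
      / of_real ((sinh (pi * real (Suc k)))\<^sup>2)" for k
  proof -
    have "t k = (\<lambda>z. (1 / of_real ((sinh (pi * real (Suc k)))\<^sup>2)) * cos (2 * of_real pi * of_nat (Suc k) * z))"
      by (simp add: t_def)
    then have "(deriv ^^ p) (t k) z0 = (1 / of_real ((sinh (pi * real (Suc k)))\<^sup>2)) * (deriv ^^ p) (\<lambda>z. cos (2 * of_real pi * of_nat (Suc k) * z)) z0"
      by (simp only:) (rule higher_deriv_cmult[of _ UNIV], auto intro!: holomorphic_intros)
    also have "p = 2 * (p div 2)" using p by simp
    then have "(deriv ^^ p) (\<lambda>z. cos (2 * of_real pi * of_nat (Suc k) * z)) z0 =
       (-1) ^ (p div 2) * (2 * of_real pi * of_nat (Suc k)) ^ p * cos (2 * of_real pi * of_nat (Suc k) * z0)"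
      using dt[of "p div 2" "2 * of_real pi * of_nat (Suc k)"] by simp
    finally show ?thesis by simp
  qed
  ultimately have "((\<lambda>k. (deriv ^^ p) (t k) z0) has_sum (deriv ^^ p) (\<lambda>z. \<Sum>\<^sub>\<infinity>k. t k z) z0) UNIV"
    unfolding has_sum_def by simp
  then show ?thesis unfolding tk unfolding t_def .
qed

lemma gauss_point_sum:
  assumes z0: "\<bar>Im z0\<bar> < 1" "z0 \<notin> gauss_ints" and q: "(gauss_csc z0)\<^sup>2 = q * lem_half\<^sup>2" "q \<in> \<rat>"
    and crit: "gauss_csc z0 * deriv gauss_csc z0 = 0"
    and p: "even p" "p \<ge> 2"
  shows "\<exists>r\<in>\<rat>. \<exists>s\<in>\<rat>. (\<lambda>k. of_real pi ^ (p + 2) * (of_nat (Suc k) ^ p * cos (2 * of_real pi * of_nat (Suc k) * z0)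
      / of_real ((sinh (pi * real (Suc k)))\<^sup>2))) sums (r * (lem_half\<^sup>2) ^ (p div 2 + 1) + s * of_real pi * (lem_half\<^sup>2) ^ (p div 2)
        + (if p = 2 then - (1/8) * of_real pi ^ 2 else 0))"
proof -
  let ?T = "\<lambda>z. \<Sum>\<^sub>\<infinity>k. cos (2 * of_real pi * of_nat (Suc k) * z) / of_real ((sinh (pi * real (Suc k)))\<^sup>2)"
  obtain c where c: "\<And>z. z \<notin> gauss_ints \<Longrightarrow> 4 * of_real pi * \<i> * gauss_cot1 z = (gauss_cot z)\<^sup>2 + deriv gauss_cot z + c"
    by (fact gauss_cot1_eq)
  let ?B = "{z. \<bar>Im z\<bar> < 1}"
  have B: "open (?B - gauss_ints)"
  proof -
    have "?B = (\<lambda>z. \<bar>Im z\<bar>) -` {..<1}" by auto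
    also have "open \<dots>" by (intro continuous_open_vimage) (auto intro!: continuous_intros)
    finally show ?thesis using closed_gauss_ints by (rule open_Diff)
  qed
  have zB: "z0 \<in> ?B - gauss_ints" using z0 by auto
  have h: "(\<lambda>z. (gauss_cot z)\<^sup>2 + deriv gauss_cot z) holomorphic_on ?B - gauss_ints"
    by (rule holomorphic_on_subset[of _ "- gauss_ints"])
      (auto intro!: holomorphic_intros gauss_cot_holomorphic holomorphic_deriv open_gauss_compl)
  have Teq: "?T z = 1 / (4 * of_real pi ^ 2) * ((gauss_cot z)\<^sup>2 + deriv gauss_cot z + c)" if "z \<in> ?B - gauss_ints" for z
  proof -
    have "4 * of_real pi * \<i> * (- of_real pi * \<i> * ?T z) = (gauss_cot z)\<^sup>2 + deriv gauss_cot z + c"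
      using c[of z] gauss_cot1_fourier[of z] that by simp
    moreover have eq: "4 * of_real pi * \<i> * (- of_real pi * \<i> * T) = 4 * of_real pi ^ 2 * T" for T
      by (simp add: power2_eq_square)
    ultimately have "4 * of_real pi ^ 2 * ?T z = (gauss_cot z)\<^sup>2 + deriv gauss_cot z + c" unfolding eq by (simp only:)
    then show ?thesis by (simp add: field_simps)
  qed
  have "(deriv ^^ p) ?T z0 = (deriv ^^ p) (\<lambda>z. 1 / (4 * of_real pi ^ 2) * ((gauss_cot z)\<^sup>2 + deriv gauss_cot z + c)) z0"
  proof (rule higher_deriv_transform_within_open[OF _ _ B zB Teq])
    show h': "(\<lambda>z. 1 / (4 * of_real pi ^ 2) * ((gauss_cot z)\<^sup>2 + deriv gauss_cot z + c)) holomorphic_on ?B - gauss_ints"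
      by (intro holomorphic_intros h) auto
    show "?T holomorphic_on ?B - gauss_ints"
      by (rule holomorphic_transform[OF h']) (use Teq in auto)
  qed
  also have "\<dots> = 1 / (4 * of_real pi ^ 2) * (deriv ^^ p) (\<lambda>z. (gauss_cot z)\<^sup>2 + deriv gauss_cot z + c) z0"
    by (rule higher_deriv_cmult[OF _ zB B]) (intro holomorphic_intros h)
  also have "(deriv ^^ p) (\<lambda>z. (gauss_cot z)\<^sup>2 + deriv gauss_cot z + c) z0 =
      (deriv ^^ p) (\<lambda>z. (gauss_cot z)\<^sup>2 + deriv gauss_cot z) z0 + (deriv ^^ p) (\<lambda>z. c) z0"
    by (rule higher_deriv_add[OF _ _ B zB]) (intro holomorphic_intros h)+
  also have "(deriv ^^ p) (\<lambda>z. c) z0 = 0" using p by simp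
  finally have dT: "(deriv ^^ p) ?T z0 = 1 / (4 * of_real pi ^ 2) * (deriv ^^ p) (\<lambda>z. (gauss_cot z)\<^sup>2 + deriv gauss_cot z) z0" by simp
  obtain r s where rs: "r \<in> \<rat>" "s \<in> \<rat>" "(deriv ^^ p) (\<lambda>z. (gauss_cot z)\<^sup>2 + deriv gauss_cot z) z0 =
     r * (lem_half\<^sup>2) ^ (p div 2 + 1) + s * of_real pi * (lem_half\<^sup>2) ^ (p div 2) + (if p = 2 then 2 * of_real pi ^ 2 else 0)"
    using gauss_cot_square_higher_deriv[OF z0(2) q crit p] by blast
  \<comment> \<open>K undoes the factor (-1)^(p/2) 2^p left by differentiating the cosine, and pi^2
    clears the denominator 4 pi^2 up to 4. For p = 2 one has K = -1/4, so the exceptional 2 pi^2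
    becomes 2 pi^2 K / 4 = -pi^2 / 8.\<close>
  define K :: complex where "K = (-1) ^ (p div 2) / 2 ^ p"
  have "(\<lambda>k. (K * of_real pi ^ 2) * ((-1) ^ (p div 2) * (2 * of_real pi * of_nat (Suc k)) ^ p * cos (2 * of_real pi * of_nat (Suc k) * z0)
      / of_real ((sinh (pi * real (Suc k)))\<^sup>2))) sums ((K * of_real pi ^ 2) * (deriv ^^ p) ?T z0)"
    by (intro sums_mult has_sum_imp_sums gauss_cot1_higher_deriv z0 p)
  moreover have "(K * of_real pi ^ 2) * ((-1) ^ (p div 2) * (2 * of_real pi * of_nat (Suc k)) ^ p * cos (2 * of_real pi * of_nat (Suc k) * z0)
      / of_real ((sinh (pi * real (Suc k)))\<^sup>2)) =
     of_real pi ^ (p + 2) * (of_nat (Suc k) ^ p * cos (2 * of_real pi * of_nat (Suc k) * z0)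
      / of_real ((sinh (pi * real (Suc k)))\<^sup>2))" for k
  proof -
    have "(-1 :: complex) ^ (p div 2) * (-1) ^ (p div 2) = 1" by (simp add: power_mult_distrib[symmetric])
    then have "K * ((-1) ^ (p div 2) * (2 * x) ^ p) = x ^ p" for x :: complex
      by (simp add: K_def power_mult_distrib mult.assoc[symmetric])
    note K = this[of "of_real pi * of_nat (Suc k)"]
    have e: "(K * of_real pi ^ 2) * ((-1) ^ (p div 2) * (2 * of_real pi * of_nat (Suc k)) ^ p * c / d) =
        (K * ((-1) ^ (p div 2) * (2 * (of_real pi * of_nat (Suc k))) ^ p)) * (of_real pi ^ 2 * c / d)" for c d
      by (simp only: mult.assoc times_divide_eq_right mult.left_commute[of "of_real pi ^ 2"])
    show ?thesis
      unfolding e K by (simp add: power_mult_distrib power_add power2_eq_square mult_ac del: of_nat_Suc)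
  qed
  moreover have "(K * of_real pi ^ 2) * (deriv ^^ p) ?T z0 = (K / 4 * r) * (lem_half\<^sup>2) ^ (p div 2 + 1) +
     (K / 4 * s) * of_real pi * (lem_half\<^sup>2) ^ (p div 2) + (if p = 2 then - (1/8) * of_real pi ^ 2 else 0)"
  proof -
    have "(K * of_real pi ^ 2) * (deriv ^^ p) ?T z0 = K / 4 * (deriv ^^ p) (\<lambda>z. (gauss_cot z)\<^sup>2 + deriv gauss_cot z) z0"
      unfolding dT by simp
    then show ?thesis unfolding rs(3) by (simp add: distrib_left mult.assoc) (simp add: K_def)
  qed
  moreover have "K \<in> \<rat>" unfolding K_def by auto
  ultimately show ?thesis using rs(1,2)
    by (intro bexI[of _ "K / 4 * r"] bexI[of _ "K / 4 * s"]) (simp_all only: Rats_mult Rats_divide Rats_number_of)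
qed

definition lem_combination :: "nat \<Rightarrow> complex set" where
  "lem_combination p = {r * (lem_half\<^sup>2) ^ (p div 2 + 1) + s * of_real pi * (lem_half\<^sup>2) ^ (p div 2) | r s. r \<in> \<rat> \<and> s \<in> \<rat>}"

text \<open>At 1/2 the cosine of 2 pi k z is (-1)^k, and at (1 + i)/2 it is (-1)^k cosh (pi k). Both
  points are critical for S^2, with values e and 0.\<close>

lemma sums_half_centre:
  assumes p: "even p" "p \<ge> 2"
  obtains u v where "u \<in> lem_combination p" "v \<in> lem_combination p"
    "(\<lambda>k. of_real (pi ^ (p + 2) * (real (Suc k) ^ p * (-1) ^ Suc k / (sinh (pi * real (Suc k)))\<^sup>2)))
       sums (u + (if p = 2 then - (1/8) * of_real pi ^ 2 else 0))"
    "(\<lambda>k. of_real (pi ^ (p + 2) * (real (Suc k) ^ p * ((-1) ^ Suc k * cosh (pi * real (Suc k))) / (sinh (pi * real (Suc k)))\<^sup>2)))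
       sums (v + (if p = 2 then - (1/8) * of_real pi ^ 2 else 0))"
proof -
  have c1: "cos (2 * of_real pi * of_nat (Suc k) * (1/2)) = complex_of_real ((-1) ^ Suc k)" for k
  proof -
    have "2 * of_real pi * of_nat (Suc k) * (1/2) = complex_of_real (real (Suc k) * pi)" by (simp add: field_simps)
    then show ?thesis by (simp only: cos_of_real cos_npi)
  qed
  have c2: "cos (2 * of_real pi * of_nat (Suc k) * ((1 + \<i>) / 2)) = of_real ((-1) ^ Suc k * cosh (pi * real (Suc k)))" for k
  proof -
    have "2 * of_real pi * of_nat (Suc k) * ((1 + \<i>) / 2) = of_real (real (Suc k) * pi) + \<i> * of_real (pi * real (Suc k))"
      by (simp add: field_simps)
    then have "cos (2 * of_real pi * of_nat (Suc k) * ((1 + \<i>) / 2)) =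
        of_real (cos (real (Suc k) * pi)) * cos (\<i> * of_real (pi * real (Suc k)))
        - of_real (sin (real (Suc k) * pi)) * sin (\<i> * of_real (pi * real (Suc k)))"
      by (simp only: cos_add cos_of_real sin_of_real)
    also have "cos (\<i> * of_real (pi * real (Suc k))) = of_real (cosh (pi * real (Suc k)))"
      by (rule cos_i_times)
    finally show ?thesis by (simp only: cos_npi sin_npi) simp
  qed
  have "\<exists>r\<in>\<rat>. \<exists>s\<in>\<rat>. (\<lambda>k. of_real pi ^ (p + 2) * (of_nat (Suc k) ^ p * cos (2 * of_real pi * of_nat (Suc k) * (1/2))
      / of_real ((sinh (pi * real (Suc k)))\<^sup>2))) sums (r * (lem_half\<^sup>2) ^ (p div 2 + 1) + s * of_real pi * (lem_half\<^sup>2) ^ (p div 2)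
        + (if p = 2 then - (1/8) * of_real pi ^ 2 else 0))"
    by (rule gauss_point_sum[OF _ _ _ _ _ p, of _ 1]) (auto simp: half_notin_gauss lem_half_def gauss_csc_deriv_half)
  then obtain r1 s1 where 1: "r1 \<in> \<rat>" "s1 \<in> \<rat>" "(\<lambda>k. of_real pi ^ (p + 2) * (of_nat (Suc k) ^ p * cos (2 * of_real pi * of_nat (Suc k) * (1/2))
      / of_real ((sinh (pi * real (Suc k)))\<^sup>2))) sums (r1 * (lem_half\<^sup>2) ^ (p div 2 + 1) + s1 * of_real pi * (lem_half\<^sup>2) ^ (p div 2)
        + (if p = 2 then - (1/8) * of_real pi ^ 2 else 0))" by blast
  have "\<exists>r\<in>\<rat>. \<exists>s\<in>\<rat>. (\<lambda>k. of_real pi ^ (p + 2) * (of_nat (Suc k) ^ p * cos (2 * of_real pi * of_nat (Suc k) * ((1 + \<i>) / 2))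
      / of_real ((sinh (pi * real (Suc k)))\<^sup>2))) sums (r * (lem_half\<^sup>2) ^ (p div 2 + 1) + s * of_real pi * (lem_half\<^sup>2) ^ (p div 2)
        + (if p = 2 then - (1/8) * of_real pi ^ 2 else 0))"
    by (rule gauss_point_sum[OF _ _ _ _ _ p, of _ 0]) (auto simp: half_notin_gauss gauss_csc_centre)
  then obtain r2 s2 where 2: "r2 \<in> \<rat>" "s2 \<in> \<rat>" "(\<lambda>k. of_real pi ^ (p + 2) * (of_nat (Suc k) ^ p * cos (2 * of_real pi * of_nat (Suc k) * ((1 + \<i>) / 2))
      / of_real ((sinh (pi * real (Suc k)))\<^sup>2))) sums (r2 * (lem_half\<^sup>2) ^ (p div 2 + 1) + s2 * of_real pi * (lem_half\<^sup>2) ^ (p div 2)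
        + (if p = 2 then - (1/8) * of_real pi ^ 2 else 0))" by blast
  show ?thesis
  proof (rule that)
    show "r1 * (lem_half\<^sup>2) ^ (p div 2 + 1) + s1 * of_real pi * (lem_half\<^sup>2) ^ (p div 2) \<in> lem_combination p"
      "r2 * (lem_half\<^sup>2) ^ (p div 2 + 1) + s2 * of_real pi * (lem_half\<^sup>2) ^ (p div 2) \<in> lem_combination p"
      unfolding lem_combination_def using 1(1,2) 2(1,2) by blast+
    show "(\<lambda>k. of_real (pi ^ (p + 2) * (real (Suc k) ^ p * (-1) ^ Suc k / (sinh (pi * real (Suc k)))\<^sup>2)))
       sums (r1 * (lem_half\<^sup>2) ^ (p div 2 + 1) + s1 * of_real pi * (lem_half\<^sup>2) ^ (p div 2) + (if p = 2 then - (1/8) * of_real pi ^ 2 else 0))"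
      using 1(3) unfolding c1 by (simp only: of_real_mult of_real_divide of_real_power of_real_of_nat_eq)
    show "(\<lambda>k. of_real (pi ^ (p + 2) * (real (Suc k) ^ p * ((-1) ^ Suc k * cosh (pi * real (Suc k))) / (sinh (pi * real (Suc k)))\<^sup>2)))
       sums (r2 * (lem_half\<^sup>2) ^ (p div 2 + 1) + s2 * of_real pi * (lem_half\<^sup>2) ^ (p div 2) + (if p = 2 then - (1/8) * of_real pi ^ 2 else 0))"
      using 2(3) unfolding c2 by (simp only: of_real_mult of_real_divide of_real_power of_real_of_nat_eq)
  qed
qed

lemma lem_combination_linear:
  assumes "u \<in> lem_combination p" "v \<in> lem_combination p" "a \<in> \<rat>" "b \<in> \<rat>"
  shows "a * u + b * v \<in> lem_combination p"
proof -
  obtain r s r' s' where "r \<in> \<rat>" "s \<in> \<rat>" "r' \<in> \<rat>" "s' \<in> \<rat>"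
    "u = r * (lem_half\<^sup>2) ^ (p div 2 + 1) + s * of_real pi * (lem_half\<^sup>2) ^ (p div 2)"
    "v = r' * (lem_half\<^sup>2) ^ (p div 2 + 1) + s' * of_real pi * (lem_half\<^sup>2) ^ (p div 2)"
    using assms(1,2) unfolding lem_combination_def by blast
  then have "a * u + b * v = (a * r + b * r') * (lem_half\<^sup>2) ^ (p div 2 + 1) + (a * s + b * s') * of_real pi * (lem_half\<^sup>2) ^ (p div 2)"
    "a * r + b * r' \<in> \<rat>" "a * s + b * s' \<in> \<rat>" using assms(3,4) by (simp_all add: algebra_simps)
  then show ?thesis unfolding lem_combination_def by blast
qed

text \<open>Both series are linear combinations of those of \<open>sums_half_centre\<close>; for \<^term>\<open>p = 2\<close>
  the two exceptional terms in \<^term>\<open>pi ^ 2\<close> cancel in the first one only.\<close>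

lemma lemniscatic_sums:
  assumes p: "even p" "p \<ge> 2"
  shows "\<exists>u\<in>lem_combination p. (\<lambda>k. of_real (pi ^ (p + 2) * (real (Suc k) ^ p * (-1) ^ Suc k / (cosh (pi * real (Suc k) / 2))\<^sup>2))) sums u"
    and "p \<noteq> 2 \<Longrightarrow> \<exists>u\<in>lem_combination p. (\<lambda>k. of_real (pi ^ (p + 2) * (real (Suc k) ^ p * (-1) ^ Suc k / (sinh (pi * real (Suc k) / 2))\<^sup>2))) sums u"
proof -
  obtain u v where uv: "u \<in> lem_combination p" "v \<in> lem_combination p"
    "(\<lambda>k. complex_of_real (pi ^ (p + 2) * (real (Suc k) ^ p * (-1) ^ Suc k / (sinh (pi * real (Suc k)))\<^sup>2)))
       sums (u + (if p = 2 then - (1/8) * of_real pi ^ 2 else 0))"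
    "(\<lambda>k. complex_of_real (pi ^ (p + 2) * (real (Suc k) ^ p * ((-1) ^ Suc k * cosh (pi * real (Suc k))) / (sinh (pi * real (Suc k)))\<^sup>2)))
       sums (v + (if p = 2 then - (1/8) * of_real pi ^ 2 else 0))"
    by (rule sums_half_centre[OF p])
  \<comment> \<open>As sinh x = 2 sinh (x/2) cosh (x/2), each of cosh x - 1 and cosh x + 1 cancels
    one of the two squared factors. This carries the series from argument pi k to pi k / 2.\<close>
  have trig: "2 * (cosh x - 1) / (sinh x)\<^sup>2 = 1 / (cosh (x / 2))\<^sup>2" "2 * (cosh x + 1) / (sinh x)\<^sup>2 = 1 / (sinh (x / 2))\<^sup>2"
    if "x > 0" for x :: real
  proof -
    have "cosh x = 2 * (cosh (x/2))\<^sup>2 - 1" "cosh x = 2 * (sinh (x/2))\<^sup>2 + 1" "sinh x = 2 * sinh (x/2) * cosh (x/2)"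
      using cosh_double[of "x/2"] sinh_double[of "x/2"] by (simp_all add: cosh_square_eq)
    moreover have "sinh (x/2) \<noteq> 0" "cosh (x/2) \<noteq> 0" using that by simp_all
    ultimately have e: "cosh x + 1 = 2 * (cosh (x/2))\<^sup>2" "cosh x - 1 = 2 * (sinh (x/2))\<^sup>2" "(sinh x)\<^sup>2 = 4 * ((sinh (x/2))\<^sup>2 * (cosh (x/2))\<^sup>2)"
      "(sinh (x/2))\<^sup>2 \<noteq> 0" "(cosh (x/2))\<^sup>2 \<noteq> 0" by (simp_all add: power_mult_distrib)
    show "2 * (cosh x - 1) / (sinh x)\<^sup>2 = 1 / (cosh (x / 2))\<^sup>2" "2 * (cosh x + 1) / (sinh x)\<^sup>2 = 1 / (sinh (x / 2))\<^sup>2"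
      unfolding e(1-3) using e(4,5) by (simp_all add: divide_simps)
  qed
  have x: "pi * real (Suc k) > 0" for k by simp
  have ofr: "2 * complex_of_real X - 2 * complex_of_real Y = complex_of_real (2 * X - 2 * Y)"
    "2 * complex_of_real X + 2 * complex_of_real Y = complex_of_real (2 * X + 2 * Y)" for X Y by simp_all
  have alg: "2 * (P * (a * (b * c) / s)) - 2 * (P * (a * b / s)) = P * (a * b * (2 * (c - 1) / s))"
    "2 * (P * (a * (b * c) / s)) + 2 * (P * (a * b / s)) = P * (a * b * (2 * (c + 1) / s))" for P a b c s :: real
    by (cases "s = 0"; simp add: field_simps)+
  have "(\<lambda>k. 2 * complex_of_real (pi ^ (p + 2) * (real (Suc k) ^ p * ((-1) ^ Suc k * cosh (pi * real (Suc k))) / (sinh (pi * real (Suc k)))\<^sup>2))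
     - 2 * complex_of_real (pi ^ (p + 2) * (real (Suc k) ^ p * (-1) ^ Suc k / (sinh (pi * real (Suc k)))\<^sup>2))) sums
     (2 * (v + (if p = 2 then - (1/8) * of_real pi ^ 2 else 0)) - 2 * (u + (if p = 2 then - (1/8) * of_real pi ^ 2 else 0)))"
    by (intro sums_diff sums_mult uv)
  moreover have "2 * complex_of_real (pi ^ (p + 2) * (real (Suc k) ^ p * ((-1) ^ Suc k * cosh (pi * real (Suc k))) / (sinh (pi * real (Suc k)))\<^sup>2))
     - 2 * complex_of_real (pi ^ (p + 2) * (real (Suc k) ^ p * (-1) ^ Suc k / (sinh (pi * real (Suc k)))\<^sup>2)) =
     of_real (pi ^ (p + 2) * (real (Suc k) ^ p * (-1) ^ Suc k / (cosh (pi * real (Suc k) / 2))\<^sup>2))" for k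
  proof -
    have "2 * (pi ^ (p + 2) * (real (Suc k) ^ p * ((-1) ^ Suc k * cosh (pi * real (Suc k))) / (sinh (pi * real (Suc k)))\<^sup>2))
       - 2 * (pi ^ (p + 2) * (real (Suc k) ^ p * (-1) ^ Suc k / (sinh (pi * real (Suc k)))\<^sup>2)) =
       pi ^ (p + 2) * (real (Suc k) ^ p * (-1) ^ Suc k * (2 * (cosh (pi * real (Suc k)) - 1) / (sinh (pi * real (Suc k)))\<^sup>2))"
      by (simp only: alg)
    also have "\<dots> = pi ^ (p + 2) * (real (Suc k) ^ p * (-1) ^ Suc k / (cosh (pi * real (Suc k) / 2))\<^sup>2)"
      unfolding trig(1)[OF x] by (simp only: times_divide_eq_right mult_1_right)
    finally show ?thesis by (simp only: ofr)
  qed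
  ultimately have "(\<lambda>k. of_real (pi ^ (p + 2) * (real (Suc k) ^ p * (-1) ^ Suc k / (cosh (pi * real (Suc k) / 2))\<^sup>2))) sums (2 * v + (-2) * u)"
    by (simp only:) (simp add: algebra_simps)
  then show "\<exists>u\<in>lem_combination p. (\<lambda>k. of_real (pi ^ (p + 2) * (real (Suc k) ^ p * (-1) ^ Suc k / (cosh (pi * real (Suc k) / 2))\<^sup>2))) sums u"
    using lem_combination_linear[OF uv(2,1), of 2 "-2"] by (intro bexI) auto
  assume p2: "p \<noteq> 2"
  have "(\<lambda>k. 2 * complex_of_real (pi ^ (p + 2) * (real (Suc k) ^ p * ((-1) ^ Suc k * cosh (pi * real (Suc k))) / (sinh (pi * real (Suc k)))\<^sup>2))
     + 2 * complex_of_real (pi ^ (p + 2) * (real (Suc k) ^ p * (-1) ^ Suc k / (sinh (pi * real (Suc k)))\<^sup>2))) sums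
     (2 * v + 2 * u)"
    using uv p2 by (intro sums_add sums_mult) simp_all
  moreover have "2 * complex_of_real (pi ^ (p + 2) * (real (Suc k) ^ p * ((-1) ^ Suc k * cosh (pi * real (Suc k))) / (sinh (pi * real (Suc k)))\<^sup>2))
     + 2 * complex_of_real (pi ^ (p + 2) * (real (Suc k) ^ p * (-1) ^ Suc k / (sinh (pi * real (Suc k)))\<^sup>2)) =
     of_real (pi ^ (p + 2) * (real (Suc k) ^ p * (-1) ^ Suc k / (sinh (pi * real (Suc k) / 2))\<^sup>2))" for k
  proof -
    have "2 * (pi ^ (p + 2) * (real (Suc k) ^ p * ((-1) ^ Suc k * cosh (pi * real (Suc k))) / (sinh (pi * real (Suc k)))\<^sup>2))
       + 2 * (pi ^ (p + 2) * (real (Suc k) ^ p * (-1) ^ Suc k / (sinh (pi * real (Suc k)))\<^sup>2)) =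
       pi ^ (p + 2) * (real (Suc k) ^ p * (-1) ^ Suc k * (2 * (cosh (pi * real (Suc k)) + 1) / (sinh (pi * real (Suc k)))\<^sup>2))"
      by (simp only: alg)
    also have "\<dots> = pi ^ (p + 2) * (real (Suc k) ^ p * (-1) ^ Suc k / (sinh (pi * real (Suc k) / 2))\<^sup>2)"
      unfolding trig(2)[OF x] by (simp only: times_divide_eq_right mult_1_right)
    finally show ?thesis by (simp only: ofr)
  qed
  ultimately have "(\<lambda>k. of_real (pi ^ (p + 2) * (real (Suc k) ^ p * (-1) ^ Suc k / (sinh (pi * real (Suc k) / 2))\<^sup>2))) sums (2 * v + 2 * u)"
    by (simp only:)
  then show "\<exists>u\<in>lem_combination p. (\<lambda>k. of_real (pi ^ (p + 2) * (real (Suc k) ^ p * (-1) ^ Suc k / (sinh (pi * real (Suc k) / 2))\<^sup>2))) sums u"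
    using lem_combination_linear[OF uv(2,1), of 2 2] by (intro bexI) auto
qed

section \<open>The lemniscatic period\<close>

definition csc_real :: "real \<Rightarrow> real" where "csc_real x = Re (gauss_csc (of_real x))"

text \<open>Conjugation exchanges rows n and -n, so S is real on the real line.\<close>

lemma gauss_csc_of_real: "gauss_csc (of_real x) = of_real (csc_real x)"
proof -
  have "gauss_csc (cnj z) = cnj (gauss_csc z)" for z
  proof -
    have "csc_row n (cnj z) = cnj (csc_row (- n) z)" for n
      by (simp add: csc_row_def cnj_sin algebra_simps)
    then show ?thesis
      unfolding gauss_csc_def infsum_cnj[symmetric] using infsum_int_neg[of "\<lambda>n. cnj (csc_row n z)"] by simp
  qed
  from this[of "of_real x"] show ?thesis
    by (simp add: csc_real_def complex_eq_iff)
qed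

lemma real_notin_gauss: "0 < x \<Longrightarrow> x < 1 \<Longrightarrow> complex_of_real x \<notin> gauss_ints"
  using gauss_int_near_0[of "of_real x"] by auto

lemma csc_real_DERIV:
  assumes x: "0 < x" "x < 1"
  shows "(csc_real has_real_derivative Re (deriv gauss_csc (of_real x))) (at x)"
    "((\<lambda>x. Re (deriv gauss_csc (of_real x))) has_real_derivative 2 * csc_real x ^ 3) (at x)"
    "(Re (deriv gauss_csc (of_real x)))\<^sup>2 = csc_real x ^ 4 - csc_real (1/2) ^ 4"
proof -
  note D = gauss_csc_DERIV[OF real_notin_gauss[OF x]]
  have R: "((\<lambda>x. Re (f (of_real x))) has_real_derivative Re f') (at x)"
    if "(f has_field_derivative f') (at (of_real x))" for f f'
    using bounded_linear.has_vector_derivative[OF bounded_linear_Re has_vector_derivative_real_field[OF that]]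
    by (simp add: has_real_derivative_iff_has_vector_derivative)
  show 1: "(csc_real has_real_derivative Re (deriv gauss_csc (of_real x))) (at x)"
    using R[OF D(1)] unfolding csc_real_def .
  show "((\<lambda>x. Re (deriv gauss_csc (of_real x))) has_real_derivative 2 * csc_real x ^ 3) (at x)"
    using R[OF D(2)] unfolding gauss_csc_of_real by (simp add: of_real_power[symmetric] del: of_real_power)
  have "((\<lambda>x. gauss_csc (of_real x)) has_vector_derivative of_real (Re (deriv gauss_csc (of_real x)))) (at x)"
    unfolding gauss_csc_of_real using 1
    by (simp add: has_real_derivative_iff_has_vector_derivative has_vector_derivative_of_real)
  moreover have "((\<lambda>x. gauss_csc (of_real x)) has_vector_derivative deriv gauss_csc (of_real x)) (at x)"
    by (rule has_vector_derivative_real_field[OF D(1)])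
  ultimately have "complex_of_real (Re (deriv gauss_csc (of_real x))) = deriv gauss_csc (of_real x)"
    by (rule vector_derivative_unique_at)
  moreover have "lem_half = of_real (csc_real (1/2))" using gauss_csc_of_real[of "1/2"] by (simp add: lem_half_def)
  ultimately have "complex_of_real ((Re (deriv gauss_csc (of_real x)))\<^sup>2) = of_real (csc_real x ^ 4 - csc_real (1/2) ^ 4)"
    using gauss_csc_first_integral[OF real_notin_gauss[OF x]] by (simp add: gauss_csc_of_real)
  then show "(Re (deriv gauss_csc (of_real x)))\<^sup>2 = csc_real x ^ 4 - csc_real (1/2) ^ 4"
    by (simp only: of_real_eq_iff)
qed

text \<open>At 1/2 row n has modulus pi / cosh (pi n). Row 0 contributes pi, and all other rows
  together at most 4 pi q / (1 - q) with q = exp (-pi), which is less than pi because exp pi >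
  8.\<close>

lemma csc_real_half_pos: "csc_real (1/2) > 0"
proof -
  define f where "f n = (if n = 0 then 0 else csc_row n (1/2))" for n :: int
  have nf: "norm (f n) \<le> 2 * pi * exp (- pi) ^ nat \<bar>n\<bar>" for n
  proof (cases "n = 0")
    case False
    have "of_real pi * (1/2 + \<i> * of_int n) = of_real pi / 2 + \<i> * of_real (pi * of_int n)" by (simp add: algebra_simps)
    then have "sin (of_real pi * (1/2 + \<i> * of_int n)) = complex_of_real (cosh (pi * of_int n))"
      by (simp only: sin_add sin_pi_half) (simp add: cos_i_times del: of_real_mult)
    then have "norm (f n) = pi / cosh (pi * of_int n)"
      using False by (simp add: f_def csc_row_def norm_divide del: of_real_mult)
    also have "\<dots> \<le> pi / (exp (pi * \<bar>of_int n\<bar>) / 2)"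
    proof (rule divide_left_mono)
      have "exp (pi * \<bar>of_int n\<bar>) \<le> exp (pi * of_int n) + exp (- (pi * of_int n))"
        by (cases "n \<ge> 0") auto
      then show "exp (pi * \<bar>of_int n\<bar>) / 2 \<le> cosh (pi * of_int n)" by (simp add: cosh_field_def)
    qed auto
    also have "\<dots> = 2 * pi * exp (- pi) ^ nat \<bar>n\<bar>"
    proof -
      have "exp (- pi) ^ nat \<bar>n\<bar> = exp (- (pi * \<bar>of_int n\<bar>))"
        by (simp add: exp_of_nat_mult[symmetric] mult.commute)
      then show ?thesis by (simp add: exp_minus field_simps)
    qed
    finally show ?thesis .
  qed (simp add: f_def)
  have fs: "f summable_on UNIV"
  proof -
    have "f summable_on -{0}" using row_decay_summable[OF row_decay_csc, of "1/2" "-{0}"]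
      by (rule summable_on_cong[THEN iffD1, rotated]) (simp add: f_def)
    then show ?thesis by (rule summable_on_cong_neutral[THEN iffD1, rotated -1]) (auto simp: f_def)
  qed
  have geo: "(\<lambda>m. 2 * pi * exp (- pi) ^ Suc m) sums (2 * pi * (exp (- pi) / (1 - exp (- pi))))"
    using sums_mult[OF geometric_sums[of "exp (- pi)"], of "exp (- pi)"] by (intro sums_mult) (simp add: divide_inverse)
  have half: "norm (\<Sum>\<^sub>\<infinity>m. g m) \<le> 2 * pi * (exp (- pi) / (1 - exp (- pi)))"
    if "\<And>m. norm (g m) \<le> 2 * pi * exp (- pi) ^ Suc m" for g :: "nat \<Rightarrow> complex"
  proof -
    have sn: "summable (\<lambda>m. norm (g m))"
      by (rule summable_comparison_test'[of _ 0, OF sums_summable[OF geo]]) (use that in auto)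
    then have "(g has_sum suminf g) UNIV"
      by (intro norm_summable_imp_has_sum[OF sn] summable_sums[OF summable_norm_cancel])
    then have "(\<Sum>\<^sub>\<infinity>m. g m) = suminf g" by (rule infsumI)
    then have "norm (\<Sum>\<^sub>\<infinity>m. g m) \<le> (\<Sum>m. norm (g m))" using summable_norm[OF sn] by simp
    also have "\<dots> \<le> (\<Sum>m. 2 * pi * exp (- pi) ^ Suc m)" by (rule suminf_le[OF that sn sums_summable[OF geo]])
    also have "\<dots> = 2 * pi * (exp (- pi) / (1 - exp (- pi)))" using geo by (simp add: sums_iff)
    finally show ?thesis .
  qed
  have "(\<Sum>\<^sub>\<infinity>n. f n) = (\<Sum>\<^sub>\<infinity>m. f (int (Suc m))) + (\<Sum>\<^sub>\<infinity>m. f (- int (Suc m)))"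
    by (rule infsum_int_pos_neg[OF fs]) (simp add: f_def)
  moreover have "norm (\<Sum>\<^sub>\<infinity>m. f (int (Suc m))) \<le> 2 * pi * (exp (- pi) / (1 - exp (- pi)))"
    by (rule half) (use nf[of "int (Suc _)"] in \<open>simp only: abs_of_nat nat_int\<close>)
  moreover have "norm (\<Sum>\<^sub>\<infinity>m. f (- int (Suc m))) \<le> 2 * pi * (exp (- pi) / (1 - exp (- pi)))"
    by (rule half) (use nf[of "- int (Suc _)"] in \<open>simp only: abs_minus_cancel abs_of_nat nat_int\<close>)
  ultimately have "norm (\<Sum>\<^sub>\<infinity>n. f n) \<le> 4 * pi * (exp (- pi) / (1 - exp (- pi)))"
    using norm_triangle_ineq[of "\<Sum>\<^sub>\<infinity>m. f (int (Suc m))" "\<Sum>\<^sub>\<infinity>m. f (- int (Suc m))"] by simp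
  also have "\<dots> < pi"
  proof -
    have "(2::real) ^ 3 \<le> exp 1 ^ 3" using exp_ge_add_one_self[of 1] by (intro power_mono) auto
    also have "\<dots> = exp 3" by (simp add: exp_of_nat_mult[symmetric])
    also have "\<dots> < exp pi" using pi_gt3 by simp
    finally have "8 < exp pi" by simp
    then have "4 * (exp (- pi) / (1 - exp (- pi))) < 1" by (simp add: exp_minus field_simps)
    then show ?thesis by (simp add: field_simps)
  qed
  finally have less: "norm (\<Sum>\<^sub>\<infinity>n. f n) < pi" .
  have "(\<Sum>\<^sub>\<infinity>n\<in>-{0}. csc_row n (1/2)) = (\<Sum>\<^sub>\<infinity>n. f n)"
    by (rule infsum_cong_neutral) (auto simp: f_def)
  then have "gauss_csc (1/2) = of_real pi + (\<Sum>\<^sub>\<infinity>n. f n)"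
    using infsum_int_split_0[OF row_decay_csc, of "1/2"] sin_of_real_pi_half[where 'a = complex]
    by (simp add: gauss_csc_def csc_row_def[of 0])
  then have "csc_real (1/2) = pi + Re (\<Sum>\<^sub>\<infinity>n. f n)" by (simp add: csc_real_def)
  then show ?thesis using less abs_Re_le_cmod[of "\<Sum>\<^sub>\<infinity>n. f n"] by linarith
qed

text \<open>A sign change would produce a zero of S in (0,1), where the first integral would read
  S'^2 = -S(1/2)^4 < 0.\<close>

lemma csc_real_pos: assumes x: "0 < x" "x < 1" shows "csc_real x > 0"
proof (rule ccontr)
  assume neg: "\<not> csc_real x > 0"
  have c: "continuous_on {0<..<1} csc_real"
    by (rule DERIV_continuous_on, rule has_field_derivative_at_within, rule csc_real_DERIV(1)) auto
  have "connected (csc_real ` {0<..<1})" by (rule connected_continuous_image[OF c]) simp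
  moreover have "csc_real x \<in> csc_real ` {0<..<1}" "csc_real (1/2) \<in> csc_real ` {0<..<1}" using x by auto
  ultimately have "0 \<in> csc_real ` {0<..<1}"
    using neg csc_real_half_pos by (meson connectedD_interval less_imp_le not_le)
  then obtain t where t: "0 < t" "t < 1" "csc_real t = 0" by auto
  have "csc_real (1/2) ^ 4 > 0" using csc_real_half_pos by simp
  then show False using csc_real_DERIV(3)[OF t(1,2)] t(3) zero_le_power2[of "Re (deriv gauss_csc (of_real t))"] by simp
qed

text \<open>S'' = 2 S^3 > 0 makes S' increase to S'(1/2) = 0, so S' < 0 on (0, 1/2). This selects
  the negative square root in the first integral.\<close>

lemma csc_real_deriv_neg: assumes x: "0 < x" "x < 1/2"
  shows "Re (deriv gauss_csc (of_real x)) = - sqrt (csc_real x ^ 4 - csc_real (1/2) ^ 4)"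
    "csc_real x > csc_real (1/2)"
proof -
  have "Re (deriv gauss_csc (of_real a)) < Re (deriv gauss_csc (of_real (1/2)))" if "0 < a" "a < 1/2" for a
  proof (rule DERIV_pos_imp_increasing[OF that(2)])
    fix t assume t: "a \<le> t" "t \<le> 1/2"
    then have "0 < t" "t < 1" using that by auto
    then show "\<exists>y. ((\<lambda>x. Re (deriv gauss_csc (of_real x))) has_real_derivative y) (at t) \<and> 0 < y"
      using csc_real_DERIV(2)[of t] csc_real_pos[of t] by (intro exI[of _ "2 * csc_real t ^ 3"] conjI) auto
  qed
  then have neg: "Re (deriv gauss_csc (of_real a)) < 0" if "0 < a" "a < 1/2" for a
    using that gauss_csc_deriv_half by simp
  show "Re (deriv gauss_csc (of_real x)) = - sqrt (csc_real x ^ 4 - csc_real (1/2) ^ 4)"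
    using neg[OF x] csc_real_DERIV(3)[of x] x real_sqrt_abs[of "Re (deriv gauss_csc (of_real x))"] by simp
  have "csc_real x ^ 4 - csc_real (1/2) ^ 4 > 0"
    using neg[OF x] csc_real_DERIV(3)[of x] x zero_less_power2[of "Re (deriv gauss_csc (of_real x))"] by auto
  then have "csc_real (1/2) ^ 4 < csc_real x ^ 4" by simp
  then show "csc_real x > csc_real (1/2)"
    by (rule power_less_imp_less_base) (use csc_real_pos[of x] x in auto)
qed

text \<open>Under u = (b / S)^4 the equation S'^2 = S^4 - b^4 becomes f(u) u' = 4 b, where f is the
  Beta integrand, so the Beta integral equals 4 b times the length 1/2. As f is unbounded at the
  endpoints, the argument shows that H(u x) - 4 b x is constant, which needs H and u only to be
  continuous there.\<close>

lemma lem_half_Beta: "2 * csc_real (1/2) = Beta (1/4) (1/2)"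
proof -
  define b where "b = csc_real (1/2)"
  have b: "b > 0" using csc_real_half_pos by (simp add: b_def)
  \<comment> \<open>The value 0 at x = 0 is the limit forced by the pole of S.\<close>
  define u where "u x = (if x = 0 then 0 else (b / csc_real x) ^ 4)" for x
  define f where "f t = t powr (1/4 - 1) * (1 - t) powr (1/2 - 1)" for t :: real
  have fi: "(f has_integral Beta (1/4) (1/2)) {0..1}" unfolding f_def by (rule has_integral_Beta_real) auto
  define H where "H t = integral {0..t} f" for t
  have Hc: "continuous_on {0..1} H"
    unfolding H_def by (rule indefinite_integral_continuous_1) (use fi in auto)
  have Hd: "(H has_real_derivative f t) (at t)" if "0 < t" "t < 1" for t
  proof -
    have "continuous (at t within {0..1}) f" unfolding f_def using that by (intro continuous_intros) auto
    then have "(H has_vector_derivative f t) (at t within {0..1})"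
      unfolding H_def using integral_has_vector_derivative_continuous_at[of f 0 1 t "{}"] fi that by auto
    moreover have "at t within {0..1} = at t" using that by (intro at_within_interior) auto
    ultimately show ?thesis by (simp add: has_real_derivative_iff_has_vector_derivative)
  qed
  have u0: "u x \<in> {0<..<1}" if "0 < x" "x < 1/2" for x
  proof -
    have "0 < b / csc_real x" "b / csc_real x < 1" using csc_real_deriv_neg(2)[OF that] b by (auto simp: b_def)
    then show ?thesis using that power_strict_mono[of "b / csc_real x" 1 4] by (auto simp: u_def simp del: divide_less_eq_1)
  qed
  have u_half: "u (1/2) = 1" using b by (simp add: u_def b_def)
  have ud: "(u has_real_derivative 4 * b ^ 4 * sqrt (csc_real x ^ 4 - b ^ 4) / csc_real x ^ 5) (at x)" if "0 < x" "x < 1/2" for x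
  proof -
    have nz: "csc_real x \<noteq> 0" using csc_real_pos[of x] that by auto
    have D: "(csc_real has_real_derivative - sqrt (csc_real x ^ 4 - b ^ 4)) (at x)"
      using csc_real_DERIV(1)[of x] csc_real_deriv_neg(1)[OF that] that by (simp add: b_def)
    have "((\<lambda>x. (b / csc_real x) ^ 4) has_real_derivative 4 * b ^ 4 * sqrt (csc_real x ^ 4 - b ^ 4) / csc_real x ^ 5) (at x)"
      using nz by (auto intro!: derivative_eq_intros D simp: power_divide field_simps eval_nat_numeral)
    then show ?thesis
      by (rule has_field_derivative_transform_within_open[of _ _ _ "{0<..}"]) (use that in \<open>auto simp: u_def\<close>)
  qed
  have uc: "continuous_on {0..1/2} u"
    unfolding continuous_on_eq_continuous_within
  proof
    fix x :: real assume x: "x \<in> {0..1/2}"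
    show "continuous (at x within {0..1/2}) u"
    proof (cases "x = 0")
      case False
      then have x': "0 < x" "x < 1" using x by auto
      have "isCont csc_real x" by (rule DERIV_isCont[OF csc_real_DERIV(1)[OF x']])
      then have "isCont (\<lambda>x. (b / csc_real x) ^ 4) x"
        using csc_real_pos[OF x'] by (intro continuous_intros) auto
      moreover have "\<forall>\<^sub>F t in at x. (b / csc_real t) ^ 4 = u t"
        unfolding eventually_at using x' by (intro exI[of _ x]) (auto simp: u_def dist_real_def)
      ultimately have "(u \<longlongrightarrow> (b / csc_real x) ^ 4) (at x)"
        unfolding isCont_def by (rule Lim_transform_eventually)
      then have "isCont u x" using x' by (simp add: isCont_def u_def)
      then show ?thesis by (rule continuous_at_imp_continuous_at_within)
    next
      case True
      obtain s c where s: "s holomorphic_on ball 0 1"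
        "\<And>z. z \<in> ball 0 1 - {0} \<Longrightarrow> gauss_csc z = 1 / z + s z" by (rule gauss_laurent) (rule that; blast)
      have "isCont s 0"
        using s(1) by (intro continuous_on_interior[of "ball 0 1"] holomorphic_on_imp_continuous_on) auto
      then have "isCont (\<lambda>x. s (complex_of_real x)) 0"
        by (intro isCont_o2[where g = s and f = complex_of_real]) auto
      then have sc: "isCont (\<lambda>x. Re (s (complex_of_real x))) 0" by (rule continuous_Re)
      \<comment> \<open>Near 0 one has S(t) = 1 / t + r(t) with r continuous, so b / S(t) = b t / (1
        + t r(t)) tends to 0.\<close>
      define r where "r x = Re (s (complex_of_real x))" for x
      have "(r \<longlongrightarrow> r 0) (at 0 within {0..1/2})"
        using sc unfolding isCont_def r_def[symmetric] by (rule tendsto_within_subset) auto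
      then have "((\<lambda>x. (b * x / (1 + x * r x)) ^ 4) \<longlongrightarrow> (b * 0 / (1 + 0 * r 0)) ^ 4) (at 0 within {0..1/2})"
        by (intro tendsto_intros) auto
      moreover have "\<forall>\<^sub>F t in at 0 within {0..1/2}. (b * t / (1 + t * r t)) ^ 4 = u t"
        unfolding eventually_at
      proof (intro exI[of _ 1] conjI ballI impI)
        fix t :: real assume t: "t \<in> {0..1/2}" "t \<noteq> 0 \<and> dist t 0 < 1"
        then have t': "t > 0" "t < 1" by auto
        have "csc_real t = 1 / t + r t"
          unfolding csc_real_def r_def using s(2)[of "of_real t"] t' by (simp add: Re_divide_of_real)
        then have e: "1 + t * r t = t * csc_real t" using t' by (simp add: field_simps)
        show "(b * t / (1 + t * r t)) ^ 4 = u t"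
          unfolding e using t' by (simp add: u_def)
      qed simp
      ultimately have "(u \<longlongrightarrow> (b * 0 / (1 + 0 * r 0)) ^ 4) (at 0 within {0..1/2})"
        by (rule Lim_transform_eventually)
      then show ?thesis using True by (simp add: continuous_within u_def)
    qed
  qed
  have "H (u (1/2)) - 4 * b * (1/2) = H (u 0) - 4 * b * 0"
  proof (rule DERIV_isconst_end[of 0 "1/2" "\<lambda>x. H (u x) - 4 * b * x"])
    have "u ` {0..1/2} \<subseteq> {0..1}"
    proof clarify
      fix x :: real assume "x \<in> {0..1/2}"
      then consider "x = 0" | "x = 1/2" | "0 < x" "x < 1/2" by fastforce
      then show "u x \<in> {0..1}"
      proof cases
        case 2
        then show ?thesis by (simp only: u_half) simp
      qed (use u0[of x] in \<open>auto simp: u_def[of 0]\<close>)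
    qed
    then show "continuous_on {0..1/2} (\<lambda>x. H (u x) - 4 * b * x)"
      by (intro continuous_intros continuous_on_compose2[OF Hc uc]) auto
    fix x :: real assume x: "0 < x" "x < 1/2"
    let ?y = "csc_real x"
    have y: "?y > 0" "?y > b" using csc_real_deriv_neg(2)[OF x] b by (auto simp: b_def)
    have "(b ^ 4 :: real) < ?y ^ 4" using y b by (intro power_strict_mono) auto
    then have pos: "?y ^ 4 - b ^ 4 > 0" by simp
    have "f (u x) = (u x) powr (- (3/4)) * (1 - u x) powr (- (1/2))" by (simp add: f_def)
    also have "(u x) powr (- (3/4)) = (b / ?y) powr (- 3)"
    proof -
      have u: "u x = (b / ?y) powr 4" using x y b by (simp add: u_def powr_numeral)
      show ?thesis unfolding u powr_powr by simp
    qed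
    also have "\<dots> = ?y ^ 3 / b ^ 3"
    proof -
      have "(b / ?y) powr 3 = (b / ?y) ^ 3" by (rule powr_numeral) (use y b in simp)
      then show ?thesis unfolding powr_minus by (simp add: power_divide)
    qed
    also have "(1 - u x) powr (- (1/2)) = ?y ^ 2 / sqrt (?y ^ 4 - b ^ 4)"
    proof -
      have "1 - u x = (?y ^ 4 - b ^ 4) / (?y ^ 2)\<^sup>2" using x y by (simp add: u_def power_divide diff_divide_distrib)
      then have "sqrt (1 - u x) = sqrt (?y ^ 4 - b ^ 4) / ?y ^ 2"
        by (simp only: real_sqrt_divide real_sqrt_abs abs_power2)
      moreover have "1 - u x > 0" using u0[OF x] by simp
      ultimately show ?thesis by (simp add: powr_minus powr_half_sqrt field_simps)
    qed
    finally have fu: "f (u x) = ?y ^ 3 / b ^ 3 * (?y ^ 2 / sqrt (?y ^ 4 - b ^ 4))" .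
    then have "f (u x) * (4 * b ^ 4 * sqrt (?y ^ 4 - b ^ 4) / ?y ^ 5) = 4 * b"
    proof -
      have nz: "sqrt (?y ^ 4 - b ^ 4) \<noteq> 0" using pos by simp
      have gen: "?y ^ 3 / b ^ 3 * (?y ^ 2 / s) * (4 * b ^ 4 * s / ?y ^ 5) = 4 * b" if "s \<noteq> 0" for s
        using that y b by (simp add: divide_simps eval_nat_numeral)
      show ?thesis unfolding fu by (rule gen[OF nz])
    qed
    moreover have "((\<lambda>x. H (u x)) has_real_derivative f (u x) * (4 * b ^ 4 * sqrt (?y ^ 4 - b ^ 4) / ?y ^ 5)) (at x)"
      by (rule DERIV_chain2[OF Hd ud[OF x]]) (use u0[OF x] in auto)
    ultimately show "((\<lambda>x. H (u x) - 4 * b * x) has_real_derivative 0) (at x)"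
      by (auto intro!: derivative_eq_intros)
  qed auto
  moreover have "H (u 0) = 0" by (simp add: u_def H_def)
  moreover have "H (u (1/2)) = Beta (1/4) (1/2)" unfolding u_half H_def using fi by (rule integral_unique)
  ultimately show ?thesis by (simp add: b_def)
qed

text \<open>The reflection formula replaces Gamma (3/4), which enters through the Beta value, by pi
  sqrt 2 / Gamma (1/4).\<close>

lemma lem_half_Gamma: "lem_half\<^sup>2 = of_real (Gamma (1/4) ^ 4 / (8 * pi))"
proof -
  let ?G = "Gamma (1/4 :: real)"
  have G: "?G > 0" by (rule Gamma_real_pos) simp
  have "Gamma (complex_of_real (1/4)) * Gamma (1 - complex_of_real (1/4)) = of_real pi / sin (of_real pi * complex_of_real (1/4))"
    by (rule Gamma_reflection_complex)
  moreover have "of_real pi * complex_of_real (1/4) = of_real (pi / 4)" by simp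
  moreover have "1 - complex_of_real (1/4) = of_real (3/4)" by simp
  ultimately have "Gamma (complex_of_real (1/4)) * Gamma (complex_of_real (3/4)) = of_real pi / sin (complex_of_real (pi / 4))"
    by (simp only:)
  then have "complex_of_real (?G * Gamma (3/4)) = of_real (pi / sin (pi / 4))"
    unfolding Gamma_complex_of_real sin_of_real by (simp only: of_real_mult of_real_divide)
  then have "?G * Gamma (3/4) = pi / (sqrt 2 / 2)" by (simp only: of_real_eq_iff sin_45)
  moreover have "pi / (sqrt 2 / 2) = pi * sqrt 2" using real_div_sqrt[of 2] by (simp add: field_simps)
  ultimately have "?G * Gamma (3/4) = pi * sqrt 2" by (simp only:)
  moreover have "?G \<noteq> 0" using G by (rule less_imp_neq[THEN not_sym])
  ultimately have "Gamma (3/4) = pi * sqrt 2 / ?G" by (metis nonzero_mult_div_cancel_left)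
  then have "2 * csc_real (1/2) = ?G * sqrt pi / (pi * sqrt 2 / ?G)"
    unfolding lem_half_Beta Beta_def by (simp add: Gamma_one_half_real)
  then have "csc_real (1/2) = ?G ^ 2 * sqrt pi / (2 * pi * sqrt 2)" by (simp add: field_simps power2_eq_square)
  then have "(csc_real (1/2))\<^sup>2 = (?G ^ 2)\<^sup>2 * (sqrt pi)\<^sup>2 / ((2 * pi)\<^sup>2 * (sqrt 2)\<^sup>2)"
    by (simp only: power_divide power_mult_distrib)
  also have "(sqrt pi)\<^sup>2 = pi" by simp
  also have "(sqrt 2)\<^sup>2 = (2::real)" by simp
  also have "(?G ^ 2)\<^sup>2 * pi / ((2 * pi)\<^sup>2 * 2) = ?G ^ 4 / (8 * pi)"
    by (simp add: power2_eq_square eval_nat_numeral)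
  finally have "(csc_real (1/2))\<^sup>2 = ?G ^ 4 / (8 * pi)" .
  then show ?thesis
    using gauss_csc_of_real[of "1/2"] by (simp add: lem_half_def flip: of_real_power)
qed

section \<open>The contour integral\<close>

lemma norm_sin_sq: "(norm (sin z))\<^sup>2 = (sin (Re z))\<^sup>2 + (sinh (Im z))\<^sup>2"
  and norm_cos_sq: "(norm (cos z))\<^sup>2 = (cos (Re z))\<^sup>2 + (sinh (Im z))\<^sup>2"
proof -
  have c: "(cosh (Im z))\<^sup>2 = 1 + (sinh (Im z))\<^sup>2" by (simp add: cosh_square_eq)
  have "Re (sin z) = sin (Re z) * cosh (Im z)" "Im (sin z) = cos (Re z) * sinh (Im z)"
    "Re (cos z) = cos (Re z) * cosh (Im z)" "Im (cos z) = - (sin (Re z) * sinh (Im z))"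
    by (simp_all add: Re_sin Im_sin Re_cos Im_cos cosh_field_def sinh_field_def field_simps)
  then show "(norm (sin z))\<^sup>2 = (sin (Re z))\<^sup>2 + (sinh (Im z))\<^sup>2" "(norm (cos z))\<^sup>2 = (cos (Re z))\<^sup>2 + (sinh (Im z))\<^sup>2"
    unfolding cmod_power2 by (simp_all add: power_mult_distrib c cos_squared_eq distrib_left left_diff_distrib)
qed

lemma cosh_eq_cos: "cosh z = cos (\<i> * z)" and sinh_eq_sin: "sinh z = - \<i> * sin (\<i> * z)" for z :: complex
  by (simp add: cos_exp_eq cosh_field_def add.commute)
     (simp add: sin_exp_eq sinh_field_def divide_simps)

lemma sinh_le_norm_cosh_sinh:
  fixes z :: complex
  assumes "Re z \<ge> 0"
  shows "sinh (Re z) \<le> norm (cosh z)" "sinh (Re z) \<le> norm (sinh z)"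
proof -
  have "(sinh (Re z))\<^sup>2 \<le> (norm (cosh z))\<^sup>2" unfolding cosh_eq_cos norm_cos_sq by simp
  then show "sinh (Re z) \<le> norm (cosh z)" by (rule power2_le_imp_le) simp
  have "(sinh (Re z))\<^sup>2 \<le> (norm (sin (\<i> * z)))\<^sup>2" unfolding norm_sin_sq by simp
  then have "sinh (Re z) \<le> norm (sin (\<i> * z))" by (rule power2_le_imp_le) simp
  then show "sinh (Re z) \<le> norm (sinh z)" by (simp add: sinh_eq_sin norm_mult)
qed

definition trig_kernel :: "(complex \<Rightarrow> complex) \<Rightarrow> nat \<Rightarrow> complex \<Rightarrow> complex" where
  "trig_kernel C p w = w ^ p / (sin w * cos w * (C w)\<^sup>2)"

text \<open>The denominator vanishes at 0 to order 1 for cosh and order 3 for sinh. The value at 0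
  is 0, through the convention for division by zero, so continuity asks for a numerator of strictly
  higher order.\<close>

lemma isCont_trig_kernel:
  shows "p \<ge> 2 \<Longrightarrow> isCont (trig_kernel cosh p) 0" "p \<ge> 4 \<Longrightarrow> isCont (trig_kernel sinh p) 0"
proof -
  have "((\<lambda>w::complex. sin w / w) \<longlongrightarrow> 1) (at 0)" using DERIV_D[OF DERIV_sin[of "0::complex"]] by simp
  from tendsto_inverse[OF this] have s: "((\<lambda>w::complex. w / sin w) \<longlongrightarrow> 1) (at 0)" by simp
  have "(sinh has_field_derivative cosh (0::complex)) (at 0)" by (auto intro!: derivative_eq_intros)
  from DERIV_D[OF this] have "((\<lambda>w::complex. sinh w / w) \<longlongrightarrow> 1) (at 0)" by simp
  from tendsto_inverse[OF this] have h: "((\<lambda>w::complex. w / sinh w) \<longlongrightarrow> 1) (at 0)" by simp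
  have c: "((\<lambda>w::complex. cos w) \<longlongrightarrow> cos 0) (at 0)" "((\<lambda>w::complex. cosh w) \<longlongrightarrow> cosh 0) (at 0)"
    by (intro tendsto_intros)+
  show "isCont (trig_kernel cosh p) 0" if p: "p \<ge> 2"
  proof -
    have "((\<lambda>w. w ^ (p - 1) * (w / sin w) / (cos w * (cosh w)\<^sup>2)) \<longlongrightarrow> 0 ^ (p - 1) * 1 / (cos 0 * (cosh (0::complex))\<^sup>2)) (at 0)"
      by (intro tendsto_intros s c) auto
    moreover have "\<forall>\<^sub>F w in at 0. w ^ (p - 1) * (w / sin w) / (cos w * (cosh w)\<^sup>2) = trig_kernel cosh p w"
      using p by (intro eventuallyI) (simp add: trig_kernel_def power_eq_if[of _ p] mult_ac)
    ultimately have "(trig_kernel cosh p \<longlongrightarrow> 0 ^ (p - 1) * 1 / (cos 0 * (cosh (0::complex))\<^sup>2)) (at 0)"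
      by (rule Lim_transform_eventually)
    moreover have "0 ^ (p - 1) * 1 / (cos 0 * (cosh (0::complex))\<^sup>2) = 0" "trig_kernel cosh p 0 = 0"
      using p by (simp_all add: power_0_left trig_kernel_def)
    ultimately show ?thesis unfolding isCont_def by (simp only:)
  qed
  show "isCont (trig_kernel sinh p) 0" if p: "p \<ge> 4"
  proof -
    have "((\<lambda>w. w ^ (p - 3) * (w / sin w) * (w / sinh w)\<^sup>2 / cos w) \<longlongrightarrow> 0 ^ (p - 3) * 1 * 1\<^sup>2 / cos (0::complex)) (at 0)"
      by (intro tendsto_intros s c h) auto
    moreover have "\<forall>\<^sub>F w in at 0. w ^ (p - 3) * (w / sin w) * (w / sinh w)\<^sup>2 / cos w = trig_kernel sinh p w"
    proof (intro eventuallyI)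
      fix w :: complex
      have "w ^ p = w ^ (p - 3) * w ^ 3" using p by (simp add: power_add[symmetric])
      then show "w ^ (p - 3) * (w / sin w) * (w / sinh w)\<^sup>2 / cos w = trig_kernel sinh p w"
        by (simp add: trig_kernel_def power2_eq_square power3_eq_cube mult_ac)
    qed
    ultimately have "(trig_kernel sinh p \<longlongrightarrow> 0 ^ (p - 3) * 1 * 1\<^sup>2 / cos (0::complex)) (at 0)"
      by (rule Lim_transform_eventually)
    moreover have "0 ^ (p - 3) * 1 * 1\<^sup>2 / cos (0::complex) = 0" "trig_kernel sinh p 0 = 0"
      using p by (simp_all add: power_0_left trig_kernel_def)
    ultimately show ?thesis unfolding isCont_def by (simp only:)
  qed
qed

text \<open>The bisector of the first quadrant goes to the positive real axis and the two coordinate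
  half-axes to the rays at -45 and +45 degrees. The scaling is chosen so that a real u equals w + i
  w with w = rot u.\<close>

definition rot :: "complex \<Rightarrow> complex" where "rot z = (1 - \<i>) / 2 * z"

lemma Re_Im_rot: "Re (rot z) = (Re z + Im z) / 2" "Im (rot z) = (Im z - Re z) / 2"
  by (simp_all add: rot_def)

lemma rot_eq_iff: "rot z = w \<longleftrightarrow> z = (1 + \<i>) * w"
proof -
  have 1: "(1 + \<i>) * ((1 - \<i>) / 2) = 1" "(1 - \<i>) / 2 * (1 + \<i>) = 1" by (simp_all add: complex_eq_iff)
  have "(1 + \<i>) * rot z = z" "rot ((1 + \<i>) * w) = w"
    unfolding rot_def mult.assoc[symmetric] 1 by simp_all
  then show ?thesis by metis
qed

text \<open>On the boundary of the square the two trigonometric factors stay away from zero because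
  its corner lies midway between two zeros of \<^term>\<open>\<lambda>w::complex. sin (2 * w)\<close>.\<close>

lemma norm_sin_cos_corner_ge:
  assumes w: "Re w = pi * (real N / 2 + 1/4) - \<bar>Im w\<bar>"
  shows "1/2 \<le> norm (sin w)" "1/2 \<le> norm (cos w)"
proof -
  let ?t = "\<bar>Im w\<bar>"
  have "sin (2 * Re w) ^ 2 = 1 - cos (2 * Re w) ^ 2" by (simp add: sin_squared_eq)
  have e: "2 * Re w = real N * pi + (pi / 2 - 2 * ?t)" unfolding w by (simp add: algebra_simps)
  have c: "cos (2 * Re w) = (-1) ^ N * sin (2 * ?t)"
    unfolding e cos_add using sin_cos_eq[of "2 * ?t"] by simp
  have "\<bar>cos (2 * Re w)\<bar> \<le> 2 * ?t"
    unfolding c using abs_sin_x_le_abs_x[of "2 * ?t"] by (simp add: abs_mult power_abs)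
  then have le: "cos (2 * Re w) \<le> 2 * ?t" "- (2 * ?t) \<le> cos (2 * Re w)" by linarith+
  have "?t \<le> sinh ?t" using real_le_x_sinh[of ?t] by (simp add: sinh_field_def exp_minus)
  then have "?t\<^sup>2 \<le> (sinh ?t)\<^sup>2" by (intro power_mono) auto
  also have "(sinh ?t)\<^sup>2 = (sinh (Im w))\<^sup>2" by (simp add: abs_if)
  finally have h: "?t\<^sup>2 \<le> (sinh (Im w))\<^sup>2" .
  \<comment> \<open>The right side is 1/4 + (t - 1/2)^2. Its two summands are lower bounds for the
    squared sine or cosine of Re w and for sinh^2 (Im w).\<close>
  have q: "1/4 \<le> (1 - 2 * ?t) / 2 + ?t\<^sup>2"
    using zero_le_power2[of "?t - 1/2"] by (simp add: power2_eq_square field_simps)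
  have "(sin (Re w))\<^sup>2 = (1 - cos (2 * Re w)) / 2" "(cos (Re w))\<^sup>2 = (1 + cos (2 * Re w)) / 2"
    unfolding cos_double_cos by (simp_all add: sin_squared_eq field_simps)
  then have "1/4 \<le> (norm (sin w))\<^sup>2" "1/4 \<le> (norm (cos w))\<^sup>2"
    unfolding norm_sin_sq norm_cos_sq using h q le by (simp_all add: field_simps)
  then have "(1/2)\<^sup>2 \<le> (norm (sin w))\<^sup>2" "(1/2)\<^sup>2 \<le> (norm (cos w))\<^sup>2" by (simp_all add: power2_eq_square)
  then show "1/2 \<le> norm (sin w)" "1/2 \<le> norm (cos w)" by (auto intro: power2_le_imp_le)
qed

text \<open>Nonzero zeros of sinh (2 w) lie on the antidiagonal of the z-plane with one coordinate
  at most -pi/2, beyond the margin 1/2. Those of sin w cos w lie on the diagonal at multiples of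
  pi/2, and the margin excludes the negative ones.\<close>

lemma trig_zero_location:
  assumes "Re z > - 1/2" "Im z > - 1/2"
  shows "sinh (2 * rot z) = 0 \<Longrightarrow> z = 0"
    "sin (rot z) * cos (rot z) = 0 \<Longrightarrow> \<exists>n::nat. z = of_real (pi * real n / 2) * (1 + \<i>)"
proof -
  { assume "sinh (2 * rot z) = 0"
    then have "sin (2 * \<i> * rot z) = 0" by (simp add: sinh_eq_sin mult_ac)
    then obtain n :: int where n: "2 * \<i> * rot z = of_real (of_int n * pi)" by (auto simp: Complex_Transcendental.sin_eq_0)
    have "Re z = Im z * (-1)" "Re z - Im z = of_int n * pi"
      using arg_cong[OF n, of Re] arg_cong[OF n, of Im] by (simp_all add: Re_Im_rot field_simps)
    then have "of_int n * pi > - 1" "of_int n * pi < 1" using assms by linarith+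
    moreover have "\<bar>of_int n * pi\<bar> \<ge> pi" if "n \<noteq> 0" using that by (simp add: abs_mult)
    ultimately have "n = 0" using pi_gt3 by (cases "n = 0") auto
    then show "z = 0" using n rot_eq_iff[of z 0] by simp }
  { assume "sin (rot z) * cos (rot z) = 0"
    then have "sin (2 * rot z) = 0" by (simp add: sin_double)
    then obtain n :: int where n: "2 * rot z = of_real (of_int n * pi)" by (auto simp: Complex_Transcendental.sin_eq_0)
    then have r: "rot z = of_real (pi * of_int n / 2)" by (simp add: field_simps)
    then have z: "z = (1 + \<i>) * of_real (pi * of_int n / 2)" by (simp only: rot_eq_iff)
    then have "Re z = pi * of_int n / 2" by (simp del: of_real_mult of_real_divide)
    then have "pi * of_int n > - 1" using assms by simp
    moreover have "pi * of_int n \<le> pi * (- 1)" if "n < 0" using that by (intro mult_left_mono) auto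
    ultimately have "n \<ge> 0" using pi_gt3 by (cases "n \<ge> 0") auto
    then have "z = of_real (pi * real (nat n) / 2) * (1 + \<i>)" using z by (simp add: mult.commute)
    then show "\<exists>n::nat. z = of_real (pi * real n / 2) * (1 + \<i>)" by blast }
qed

text \<open>C stands for cosh or sinh. Their zeros lie among those of sinh (2 w), and both dominate
  sinh (Re w) in the right half-plane; the contour argument uses no more about them than this,
  holomorphy, and the removable singularity of the kernel at 0.\<close>

locale square_kernel =
  fixes C :: "complex \<Rightarrow> complex" and p :: nat
  assumes C_holo: "C holomorphic_on UNIV"
    and C_zero: "\<And>w. C w = 0 \<Longrightarrow> sinh (2 * w) = 0"
    and C_bound: "\<And>w. Re w \<ge> 0 \<Longrightarrow> sinh (Re w) \<le> norm (C w)"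
    and cont_0: "isCont (trig_kernel C p) 0"
    and p_pos: "p > 0"
begin

definition \<phi> :: "complex \<Rightarrow> complex" where "\<phi> z = trig_kernel C p (rot z)"

definition node :: "nat \<Rightarrow> complex" where "node n = of_real (pi * real n / 2) * (1 + \<i>)"

definition corner :: "nat \<Rightarrow> real" where "corner N = pi * (real N / 2 + 1/4)"

text \<open>An open convex neighbourhood of the square, as the residue theorem requires. Its margin
  1/2 is smaller than pi/4, the distance from the corner to the next node in each coordinate, so
  node N + 1 stays outside.\<close>

definition region :: "nat \<Rightarrow> complex set" where
  "region N = {z. - 1/2 < Re z \<and> Re z < corner N + 1/2 \<and> - 1/2 < Im z \<and> Im z < corner N + 1/2}"

lemma open_region: "open (region N)" and convex_region: "convex (region N)"
proof -
  have "region N = box (Complex (-1/2) (-1/2)) (Complex (corner N + 1/2) (corner N + 1/2))"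
    by (auto simp: region_def in_box_complex_iff)
  then show "open (region N)" "convex (region N)" by auto
qed

lemma rot_node: "rot (node n) = of_real (pi * real n / 2)"
  unfolding rot_eq_iff node_def by simp

lemma node_region: "node n \<in> region N \<longleftrightarrow> n \<le> N"
proof -
  have "node n \<in> region N \<longleftrightarrow> pi * real n / 2 < pi * (real N / 2 + 1/4) + 1/2"
  proof -
    have "- 1 < pi * real n" by (rule less_le_trans[of _ 0]) auto
    then show ?thesis by (auto simp: region_def node_def corner_def)
  qed
  also have "\<dots> \<longleftrightarrow> n \<le> N"
  proof
    assume *: "pi * real n / 2 < pi * (real N / 2 + 1/4) + 1/2"
    show "n \<le> N"
    proof (rule ccontr)
      assume "\<not> n \<le> N"
      then have "pi * (real N + 1) \<le> pi * real n" by (intro mult_left_mono) auto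
      then show False using * pi_gt3 by (simp add: field_simps)
    qed
  next
    assume "n \<le> N"
    then have "pi * real n \<le> pi * real N" by (intro mult_left_mono) auto
    moreover have "pi * (real N / 2 + 1/4) = pi * real N / 2 + pi / 4" by (simp add: distrib_left)
    ultimately show "pi * real n / 2 < pi * (real N / 2 + 1/4) + 1/2" using pi_gt3 by linarith
  qed
  finally show ?thesis .
qed

lemma denominator_nonzero:
  assumes "z \<in> region N" "z \<notin> node ` {1..N}" "z \<noteq> 0"
  shows "sin (rot z) * cos (rot z) * (C (rot z))\<^sup>2 \<noteq> 0"
proof
  have z: "Re z > - 1/2" "Im z > - 1/2" using assms(1) by (auto simp: region_def)
  assume "sin (rot z) * cos (rot z) * (C (rot z))\<^sup>2 = 0"
  then consider "sin (rot z) * cos (rot z) = 0" | "C (rot z) = 0" by auto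
  then show False
  proof cases
    case 1
    then obtain n where n: "z = node n" using trig_zero_location(2)[OF z] by (auto simp: node_def)
    then have "n \<le> N" using assms(1) node_region by simp
    moreover have "node 0 = 0" by (simp add: node_def)
    then have "n \<noteq> 0" using n assms(3) by metis
    ultimately show False using n assms(2) by auto
  next
    case 2
    then show False using C_zero trig_zero_location(1)[OF z] assms(3) by blast
  qed
qed

lemma C_rot_holo: "(\<lambda>z. C (rot z)) holomorphic_on A"
  using holomorphic_on_compose_gen[of rot A C UNIV] C_holo
  by (simp add: o_def rot_def[abs_def] holomorphic_intros)

text \<open>The origin is a vertex of the contour, so its singularity must be removed rather than
  counted as a residue.\<close>

lemma \<phi>_holo: "\<phi> holomorphic_on region N - node ` {1..N}"
proof (rule no_isolated_singularity'[of "{0}"])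
  show "open (region N - node ` {1..N})" by (intro open_Diff open_region finite_imp_closed) auto
  show "\<phi> holomorphic_on region N - node ` {1..N} - {0}"
    unfolding \<phi>_def trig_kernel_def
    by (intro holomorphic_intros C_rot_holo) (use denominator_nonzero in \<open>auto simp: rot_def[abs_def] intro!: holomorphic_intros\<close>)
  fix z :: complex assume "z \<in> {0}"
  then have "z = 0" by simp
  have "isCont \<phi> 0" unfolding \<phi>_def[abs_def]
    by (rule isCont_o2[where g = "trig_kernel C p"]) (use cont_0 in \<open>auto simp: rot_def[abs_def]\<close>)
  then show "(\<phi> \<longlongrightarrow> \<phi> z) (at z within region N - node ` {1..N})"
    using \<open>z = 0\<close> by (auto simp: isCont_def intro: tendsto_within_subset)
qed auto

text \<open>A simple pole: the derivative of sin w cos w with respect to z at node n is (1 - i)/2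
  times cos (pi n), and the reciprocal of (1 - i)/2 is 1 + i.\<close>

lemma \<phi>_residue:
  assumes "1 \<le> n"
  shows "residue \<phi> (node n) = (1 + \<i>) * ((-1) ^ n * of_real (pi * real n / 2) ^ p / (C (of_real (pi * real n / 2)))\<^sup>2)"
proof -
  let ?x = "pi * real n / 2"
  define U where "U = {z. Re z > 0 \<and> Im z > 0}"
  have U: "open U" "convex U"
  proof -
    have "U = {z. Re z > 0} \<inter> {z. Im z > 0}" by (auto simp: U_def)
    then show "open U" "convex U"
      by (auto intro!: open_Int convex_Int open_halfspace_Re_gt open_halfspace_Im_gt convex_halfspace_Re_gt convex_halfspace_Im_gt)
  qed
  have Cnz: "C (rot z) \<noteq> 0" if "z \<in> U" for z
  proof
    assume "C (rot z) = 0"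
    then have "z = 0" using C_zero trig_zero_location(1)[of z] that by (auto simp: U_def)
    then show False using that by (simp add: U_def)
  qed
  let ?f = "\<lambda>z. rot z ^ p / (C (rot z))\<^sup>2" and ?g = "\<lambda>z. sin (rot z) * cos (rot z)"
  have x: "?x > 0" using assms by simp
  have nU: "node n \<in> U" using x by (simp add: U_def node_def)
  have D: "(?g has_field_derivative (1 - \<i>) / 2 * (-1) ^ n) (at (node n))"
  proof -
    have "(?g has_field_derivative (1 - \<i>) / 2 * ((cos (rot (node n)))\<^sup>2 - (sin (rot (node n)))\<^sup>2)) (at (node n))"
    proof -
      have "((\<lambda>z. sin (c * z) * cos (c * z)) has_field_derivative c * ((cos (c * x))\<^sup>2 - (sin (c * x))\<^sup>2)) (at x)"
        for c x :: complex
        by (auto intro!: derivative_eq_intros simp: power2_eq_square algebra_simps)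
      then show ?thesis unfolding rot_def .
    qed
    moreover have "(cos (rot (node n)))\<^sup>2 - (sin (rot (node n)))\<^sup>2 = cos (of_real (real n * pi))"
      unfolding cos_double[symmetric] rot_node by (simp add: mult_ac)
    moreover have "cos (complex_of_real (real n * pi)) = (-1) ^ n" by (simp only: cos_of_real cos_npi) simp
    ultimately show ?thesis by simp
  qed
  have "residue (\<lambda>z. ?f z / ?g z) (node n) = ?f (node n) / ((1 - \<i>) / 2 * (-1) ^ n)"
  proof (rule residue_simple_pole_deriv[OF _ _ U(1) convex_connected[OF U(2)] nU D])
    show "?f holomorphic_on U" using Cnz by (intro holomorphic_intros C_rot_holo) (auto simp: rot_def[abs_def] intro!: holomorphic_intros)
    show "?g holomorphic_on U" unfolding rot_def by (intro holomorphic_intros)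
    show "?f (node n) \<noteq> 0" using Cnz[OF nU] assms by (simp add: rot_node)
    have e: "2 * complex_of_real ?x = of_real (real n * pi)" by simp
    have "sin (2 * rot (node n)) = 0" unfolding rot_node e sin_of_real sin_npi by simp
    then show "?g (node n) = 0" by (simp add: sin_double)
  qed (simp_all add: complex_eq_iff)
  moreover have "(\<lambda>z. ?f z / ?g z) = \<phi>" by (rule ext) (simp add: \<phi>_def trig_kernel_def mult_ac)
  moreover have "a / ((1 - \<i>) / 2 * (-1) ^ n) = (1 + \<i>) * ((-1) ^ n * a)" for a
  proof -
    have "1 - \<i> \<noteq> 0" "(-1::complex) ^ n * (-1) ^ n = 1" "(1 + \<i>) * (1 - \<i>) = 2"
      by (simp_all add: complex_eq_iff power_mult_distrib[symmetric])
    then show ?thesis by (simp add: divide_simps mult_ac)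
  qed
  ultimately have "residue \<phi> (node n) = (1 + \<i>) * ((-1) ^ n * ?f (node n))" by (simp only:)
  then show ?thesis by (simp add: rot_node)
qed

lemma corner_pos: "corner N > 0"
  by (simp add: corner_def add_nonneg_pos)

text \<open>On the two outer edges Re w = R - |Im w|, which is the hypothesis of the corner
  estimate, and Re w \<ge> R/2, so the squared factor C grows like sinh^2 (R/2).\<close>

lemma \<phi>_edge_bound:
  assumes "Re z = corner N \<and> Im z \<in> {0..corner N} \<or> Im z = corner N \<and> Re z \<in> {0..corner N}"
  shows "norm (\<phi> z) \<le> 4 * (2 * corner N) ^ p / (sinh (corner N / 2))\<^sup>2"
proof -
  let ?w = "rot z" and ?R = "corner N"
  have R: "?R > 0" by (rule corner_pos)
  have "Re ?w = ?R - \<bar>Im ?w\<bar>" using assms by (auto simp: Re_Im_rot abs_if field_simps)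
  then have sc: "1/2 \<le> norm (sin ?w)" "1/2 \<le> norm (cos ?w)"
    using norm_sin_cos_corner_ge[of ?w N] by (simp_all only: corner_def)
  have "?R / 2 \<le> Re ?w" using assms by (auto simp: Re_Im_rot)
  then have "sinh (?R / 2) \<le> norm (C ?w)" using C_bound[of ?w] R by (intro order.trans[OF _ C_bound]) auto
  then have C2: "(sinh (?R / 2))\<^sup>2 \<le> (norm (C ?w))\<^sup>2" using R by (intro power_mono) auto
  have "norm ?w \<le> \<bar>Re ?w\<bar> + \<bar>Im ?w\<bar>" by (rule cmod_le)
  also have "\<dots> \<le> 2 * ?R" using assms R by (auto simp: Re_Im_rot abs_if field_simps)
  finally have "norm ?w ^ p \<le> (2 * ?R) ^ p" by (intro power_mono) auto
  moreover have "1/2 * (1/2) * (sinh (?R / 2))\<^sup>2 \<le> norm (sin ?w) * norm (cos ?w) * (norm (C ?w))\<^sup>2"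
    by (intro mult_mono sc C2) auto
  ultimately have "norm ?w ^ p / (norm (sin ?w) * norm (cos ?w) * (norm (C ?w))\<^sup>2) \<le> (2 * ?R) ^ p / (1/2 * (1/2) * (sinh (?R / 2))\<^sup>2)"
    using R by (intro frac_le) auto
  then show ?thesis by (simp add: \<phi>_def trig_kernel_def norm_divide norm_mult norm_power mult.commute)
qed

text \<open>The bottom edge and the left edge, the latter run downwards, together give the integral
  of the combination on the left. The right and top edges, each of length R, make up the
  error.\<close>

lemma square_integral:
  shows "norm (integral {0..corner N} (\<lambda>x. \<phi> (of_real x) - \<i> * \<phi> (\<i> * of_real x)) - 2 * of_real pi * \<i> * (\<Sum>n = 1..N. residue \<phi> (node n)))
     \<le> 2 * corner N * (4 * (2 * corner N) ^ p / (sinh (corner N / 2))\<^sup>2)"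
    "(\<lambda>x. \<phi> (of_real x)) integrable_on {0..corner N}" "(\<lambda>x. \<phi> (\<i> * of_real x)) integrable_on {0..corner N}"
proof -
  let ?R = "corner N" and ?S = "region N - node ` {1..N}"
  define a2 a3 a4 where "a2 = complex_of_real ?R" and "a3 = Complex ?R ?R" and "a4 = \<i> * complex_of_real ?R"
  let ?B = "4 * (2 * ?R) ^ p / (sinh (?R / 2))\<^sup>2"
  have R: "?R > 0" by (rule corner_pos)
  have a2': "a2 = Complex (Re a3) (Im 0)" "a4 = Complex (Re 0) (Im a3)"
    by (simp_all add: a2_def a3_def a4_def complex_eq_iff)
  have rp: "rectpath 0 a3 = linepath 0 a2 +++ linepath a2 a3 +++ linepath a3 a4 +++ linepath a4 0"
    by (simp only: rectpath_def Let_def a2')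
  have node_diag: "Re (node n) = pi * real n / 2" "Im (node n) = pi * real n / 2" for n
    by (simp_all add: node_def)
  have node_in: "0 < pi * real n / 2 \<and> pi * real n / 2 < ?R" if "n \<in> {1..N}" for n
  proof -
    have "pi * real n \<le> pi * real N" using that by (intro mult_left_mono) auto
    moreover have "?R = pi * real N / 2 + pi / 4" by (simp add: corner_def distrib_left)
    ultimately have "pi * real n / 2 < ?R" using pi_gt_zero by linarith
    then show ?thesis using that by simp
  qed
  have im: "path_image (rectpath 0 a3) \<subseteq> ?S"
  proof
    fix z assume "z \<in> path_image (rectpath 0 a3)"
    then have z: "Re z \<in> {0, ?R} \<and> Im z \<in> {0..?R} \<or> Im z \<in> {0, ?R} \<and> Re z \<in> {0..?R}"
      using path_image_rectpath[of 0 a3] R by (auto simp: a3_def)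
    then have "z \<in> region N" using R by (auto simp: region_def)
    moreover have "z \<notin> node ` {1..N}"
    proof
      assume "z \<in> node ` {1..N}"
      then obtain n where n: "n \<in> {1..N}" "z = node n" by auto
      then show False using node_in[OF n(1)] z by (auto simp: node_diag)
    qed
    ultimately show "z \<in> ?S" by simp
  qed
  have seg: "closed_segment 0 a2 \<union> closed_segment a2 a3 \<union> closed_segment a3 a4 \<union> closed_segment a4 0 \<subseteq> path_image (rectpath 0 a3)"
    unfolding rp by (auto simp: path_image_join)
  have cont: "continuous_on A \<phi>" if "A \<subseteq> path_image (rectpath 0 a3)" for A
    using \<phi>_holo holomorphic_on_imp_continuous_on continuous_on_subset that im by (meson order.trans)
  have ci: "\<phi> contour_integrable_on linepath 0 a2" "\<phi> contour_integrable_on linepath a2 a3"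
    "\<phi> contour_integrable_on linepath a3 a4" "\<phi> contour_integrable_on linepath a4 0"
    using seg by (auto intro!: contour_integrable_continuous_linepath cont)
  have "contour_integral (rectpath 0 a3) \<phi> = 2 * pi * \<i> * (\<Sum>q\<in>node ` {1..N}. winding_number (rectpath 0 a3) q * residue \<phi> q)"
  proof (rule Residue_theorem[OF open_region convex_connected[OF convex_region] _ \<phi>_holo _ _ im])
    show "\<forall>z. z \<notin> region N \<longrightarrow> winding_number (rectpath 0 a3) z = 0"
    proof (intro allI impI)
      fix z assume "z \<notin> region N"
      then have "z \<notin> cbox 0 a3" using R by (auto simp: region_def in_cbox_complex_iff a3_def)
      then show "winding_number (rectpath 0 a3) z = 0" using R by (intro winding_number_rectpath_outside) (auto simp: a3_def)
    qed
  qed auto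
  also have "(\<Sum>q\<in>node ` {1..N}. winding_number (rectpath 0 a3) q * residue \<phi> q) = (\<Sum>q\<in>node ` {1..N}. residue \<phi> q)"
  proof (rule sum.cong[OF refl])
    fix q assume "q \<in> node ` {1..N}"
    then obtain n where n: "n \<in> {1..N}" "q = node n" by auto
    have "q \<in> box 0 a3" using node_in[OF n(1)] by (simp add: n(2) in_box_complex_iff node_diag a3_def)
    then show "winding_number (rectpath 0 a3) q * residue \<phi> q = residue \<phi> q" by (simp add: winding_number_rectpath)
  qed
  also have "\<dots> = (\<Sum>n = 1..N. residue \<phi> (node n))"
    by (rule sum.reindex_cong[of node "{1..N}"]) (auto simp: inj_on_def node_def complex_eq_iff)
  finally have total: "contour_integral (rectpath 0 a3) \<phi> = 2 * pi * \<i> * (\<Sum>n = 1..N. residue \<phi> (node n))" .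
  have split: "contour_integral (rectpath 0 a3) \<phi> = contour_integral (linepath 0 a2) \<phi> + contour_integral (linepath a2 a3) \<phi>
      + contour_integral (linepath a3 a4) \<phi> + contour_integral (linepath a4 0) \<phi>"
    unfolding rp using ci by simp
  have e1: "contour_integral (linepath 0 a2) \<phi> = integral {0..?R} (\<lambda>x. \<phi> (of_real x))"
    using R by (subst contour_integral_linepath_Reals_eq) (auto simp: a2_def)
  show i1: "(\<lambda>x. \<phi> (of_real x)) integrable_on {0..?R}"
    using ci(1) contour_integrable_linepath_Reals_iff[of 0 a2 \<phi>] R by (simp add: a2_def)
  have "contour_integral (linepath a4 0) \<phi> = - contour_integral (linepath 0 a4) \<phi>"
    using contour_integral_reversepath[of "linepath 0 a4" \<phi>] by simp
  also have "contour_integral (linepath 0 a4) \<phi> = contour_integral (linepath 0 a2) (\<lambda>z. \<phi> (\<i> * z) * \<i>)"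
    unfolding contour_integral_integral by (simp add: linepath_def a2_def a4_def scaleR_conv_of_real mult_ac)
  also have "\<dots> = integral {0..?R} (\<lambda>x. \<phi> (\<i> * of_real x) * \<i>)"
    using R by (subst contour_integral_linepath_Reals_eq) (auto simp: a2_def)
  finally have e4: "contour_integral (linepath a4 0) \<phi> = - integral {0..?R} (\<lambda>x. \<phi> (\<i> * of_real x) * \<i>)" .
  have c0: "continuous_on {0..?R} (\<lambda>x. \<phi> (\<i> * of_real x))"
  proof (rule continuous_on_compose2[OF cont[OF subset_refl]])
    show "(\<lambda>x. \<i> * complex_of_real x) ` {0..?R} \<subseteq> path_image (rectpath 0 a3)"
    proof
      fix z assume "z \<in> (\<lambda>x. \<i> * complex_of_real x) ` {0..?R}"
      then have "Re z = 0" "Im z \<in> {0..?R}" by auto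
      then show "z \<in> path_image (rectpath 0 a3)"
        using R by (subst path_image_rectpath) (auto simp: a3_def)
    qed
  qed (auto intro!: continuous_intros)
  show i2: "(\<lambda>x. \<phi> (\<i> * of_real x)) integrable_on {0..?R}"
    using c0 by (rule integrable_continuous_real)
  have diff: "integral {0..?R} (\<lambda>x. \<phi> (of_real x) - \<i> * \<phi> (\<i> * of_real x)) =
      contour_integral (linepath 0 a2) \<phi> + contour_integral (linepath a4 0) \<phi>"
    unfolding e1 e4 using integral_diff[OF i1 integrable_on_mult_right[OF i2, of \<i>]] by (simp add: mult.commute)
  have B: "?B \<ge> 0" using R by simp
  have n2: "norm (contour_integral (linepath a2 a3) \<phi>) \<le> ?B * norm (a3 - a2)"
  proof (rule contour_integral_bound_linepath[OF ci(2) B])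
    fix z assume "z \<in> closed_segment a2 a3"
    then have "Re z = ?R \<and> Im z \<in> {0..?R}" using R
      by (subst (asm) closed_segment_same_Re) (auto simp: a2_def a3_def closed_segment_eq_real_ivl split: if_splits)
    then show "norm (\<phi> z) \<le> ?B" by (intro \<phi>_edge_bound) auto
  qed
  have n3: "norm (contour_integral (linepath a3 a4) \<phi>) \<le> ?B * norm (a4 - a3)"
  proof (rule contour_integral_bound_linepath[OF ci(3) B])
    fix z assume "z \<in> closed_segment a3 a4"
    then have "Im z = ?R \<and> Re z \<in> {0..?R}" using R
      by (subst (asm) closed_segment_same_Im) (auto simp: a4_def a3_def closed_segment_eq_real_ivl split: if_splits)
    then show "norm (\<phi> z) \<le> ?B" by (intro \<phi>_edge_bound) auto
  qed
  have "norm (a3 - a2) = ?R" "norm (a4 - a3) = ?R"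
  proof -
    have "a3 - a2 = \<i> * of_real ?R" "a4 - a3 = - of_real ?R" by (simp_all add: a2_def a3_def a4_def complex_eq_iff)
    then show "norm (a3 - a2) = ?R" "norm (a4 - a3) = ?R" using R by (simp_all add: norm_mult)
  qed
  then have "norm (contour_integral (linepath a2 a3) \<phi> + contour_integral (linepath a3 a4) \<phi>) \<le> 2 * ?R * ?B"
    using norm_triangle_mono[OF n2 n3] by (simp add: mult_ac)
  moreover have "integral {0..?R} (\<lambda>x. \<phi> (of_real x) - \<i> * \<phi> (\<i> * of_real x)) - 2 * of_real pi * \<i> * (\<Sum>n = 1..N. residue \<phi> (node n))
     = - (contour_integral (linepath a2 a3) \<phi> + contour_integral (linepath a3 a4) \<phi>)"
    unfolding diff using total split by (simp add: algebra_simps)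
  ultimately show "norm (integral {0..?R} (\<lambda>x. \<phi> (of_real x) - \<i> * \<phi> (\<i> * of_real x)) - 2 * of_real pi * \<i> * (\<Sum>n = 1..N. residue \<phi> (node n))) \<le> 2 * ?R * ?B"
    by (simp only: norm_minus_cancel)
qed

lemma edge_limit: "(\<lambda>N. 2 * corner N * (4 * (2 * corner N) ^ p / (sinh (corner N / 2))\<^sup>2)) \<longlonglongrightarrow> 0"
proof -
  have "((\<lambda>R. 2 * R * (4 * (2 * R) ^ p / (sinh (R / 2))\<^sup>2)) \<longlongrightarrow> (0::real)) at_top"
  proof (rule tendsto_sandwich[OF _ _ tendsto_const])
    show "\<forall>\<^sub>F R in at_top. 0 \<le> 2 * R * (4 * (2 * R) ^ p / (sinh (R / 2))\<^sup>2 :: real)"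
      using eventually_ge_at_top[of 0] by eventually_elim auto
    show "\<forall>\<^sub>F R in at_top. 2 * R * (4 * (2 * R) ^ p / (sinh (R / 2))\<^sup>2) \<le> 64 * 2 ^ Suc p * (R ^ Suc p / exp R :: real)"
      using eventually_ge_at_top[of 2]
    proof eventually_elim
      case (elim R)
      have "exp (R/2) / 4 \<le> sinh (R/2)" using elim by (intro exp_le_sinh) simp
      then have "(exp (R/2) / 4)\<^sup>2 \<le> (sinh (R/2))\<^sup>2" by (intro power_mono) auto
      then have s: "exp R / 16 \<le> (sinh (R/2))\<^sup>2" using exp_double[of "R/2"] by (simp add: power_divide)
      have "4 * (2 * R) ^ p / (sinh (R / 2))\<^sup>2 \<le> 4 * (2 * R) ^ p / (exp R / 16)"
        using s elim by (intro frac_le) auto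
      then have "2 * R * (4 * (2 * R) ^ p / (sinh (R / 2))\<^sup>2) \<le> 2 * R * (4 * (2 * R) ^ p / (exp R / 16))"
        using elim by (intro mult_left_mono) auto
      also have "\<dots> = 64 * 2 ^ Suc p * (R ^ Suc p / exp R)" by (simp add: power_mult_distrib)
      finally show ?case .
    qed
    show "((\<lambda>R. 64 * 2 ^ Suc p * (R ^ Suc p / exp R :: real)) \<longlongrightarrow> 0) at_top"
      by (rule tendsto_mult_right_zero[OF tendsto_power_div_exp_0])
  qed
  moreover have "filterlim corner at_top sequentially"
  proof (rule filterlim_at_top_mono[OF filterlim_real_sequentially])
    show "\<forall>\<^sub>F N in sequentially. real N \<le> corner N"
    proof (intro always_eventually allI)
      fix N
      have "2 * (real N / 2 + 1/4) \<le> pi * (real N / 2 + 1/4)" using pi_gt3 by (intro mult_right_mono) auto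
      then show "real N \<le> corner N" by (simp add: corner_def)
    qed
  qed
  ultimately show ?thesis by (rule filterlim_compose)
qed

lemma half_line_integral:
  assumes int: "set_integrable lborel {0<..} (\<lambda>x. \<phi> (of_real x) - \<i> * \<phi> (\<i> * of_real x))"
    and s: "(\<lambda>k. (-1) ^ Suc k * of_real (pi * real (Suc k) / 2) ^ p / (C (of_real (pi * real (Suc k) / 2)))\<^sup>2) sums s"
  shows "(CLBINT x:{0<..}. \<phi> (of_real x) - \<i> * \<phi> (\<i> * of_real x)) = 2 * of_real pi * \<i> * (1 + \<i>) * s"
proof -
  define F where "F x = \<phi> (of_real x) - \<i> * \<phi> (\<i> * of_real x)" for x :: real
  \<comment> \<open>The vanishing at 0 lets the open half line be replaced by the closed one, which
    is exhausted by the intervals [0, corner N].\<close>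
  have "F 0 = 0" using p_pos by (simp add: F_def \<phi>_def trig_kernel_def rot_def)
  then have ind: "indicator {0<..} x *\<^sub>R F x = indicator {0..} x *\<^sub>R F x" for x :: real
    by (cases "x = 0") (auto simp: indicator_def)
  have int0: "set_integrable lborel {0..} F" using int unfolding F_def[symmetric] set_integrable_def ind .
  have eq0: "(CLBINT x:{0<..}. F x) = (CLBINT x:{0..}. F x)" unfolding set_lebesgue_integral_def ind ..
  have cl: "filterlim corner at_top sequentially"
  proof (rule filterlim_at_top_mono[OF filterlim_real_sequentially])
    show "\<forall>\<^sub>F N in sequentially. real N \<le> corner N"
    proof (intro always_eventually allI)
      fix N
      have "2 * (real N / 2 + 1/4) \<le> pi * (real N / 2 + 1/4)" using pi_gt3 by (intro mult_right_mono) auto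
      then show "real N \<le> corner N" by (simp add: corner_def)
    qed
  qed
  have "((\<lambda>b. CLBINT x:{0..b}. F x) \<longlongrightarrow> (CLBINT x:{0..}. F x)) at_top"
    by (rule tendsto_set_lebesgue_integral_at_top[OF _ int0]) simp
  then have l1: "(\<lambda>N. CLBINT x:{0..corner N}. F x) \<longlonglongrightarrow> (CLBINT x:{0..}. F x)"
    by (rule filterlim_compose[OF _ cl])
  have e: "(CLBINT x:{0..corner N}. F x) = integral {0..corner N} F" for N
    by (intro set_borel_integral_eq_integral set_integrable_subset[OF int0]) auto
  let ?S = "\<lambda>N. \<Sum>n = 1..N. residue \<phi> (node n)"
  have l2: "(\<lambda>N. integral {0..corner N} F - 2 * of_real pi * \<i> * ?S N) \<longlonglongrightarrow> 0"
    by (rule Lim_null_comparison[OF _ edge_limit])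
      (use square_integral(1) in \<open>auto simp: F_def[abs_def] intro!: always_eventually\<close>)
  have l3: "(\<lambda>N. ?S N) \<longlonglongrightarrow> (1 + \<i>) * s"
  proof -
    have "?S N = (\<Sum>k<N. (1 + \<i>) * ((-1) ^ Suc k * of_real (pi * real (Suc k) / 2) ^ p / (C (of_real (pi * real (Suc k) / 2)))\<^sup>2))" for N
    proof -
      have "?S N = (\<Sum>k<N. residue \<phi> (node (Suc k)))"
        by (rule sum.reindex_bij_witness[of _ Suc "\<lambda>n. n - 1"]) auto
      also have "\<dots> = (\<Sum>k<N. (1 + \<i>) * ((-1) ^ Suc k * of_real (pi * real (Suc k) / 2) ^ p / (C (of_real (pi * real (Suc k) / 2)))\<^sup>2))"
        by (intro sum.cong refl \<phi>_residue) simp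
      finally show ?thesis .
    qed
    then show ?thesis using sums_mult[OF s, of "1 + \<i>"] unfolding sums_def by simp
  qed
  have "(\<lambda>N. (integral {0..corner N} F - 2 * of_real pi * \<i> * ?S N) + 2 * of_real pi * \<i> * ?S N) \<longlonglongrightarrow> 0 + 2 * of_real pi * \<i> * ((1 + \<i>) * s)"
    by (intro tendsto_add l2 tendsto_mult l3 tendsto_const)
  then have "(\<lambda>N. CLBINT x:{0..corner N}. F x) \<longlonglongrightarrow> 2 * of_real pi * \<i> * ((1 + \<i>) * s)"
    unfolding e by simp
  with l1 have "(CLBINT x:{0..}. F x) = 2 * of_real pi * \<i> * ((1 + \<i>) * s)" by (rule LIMSEQ_unique)
  then show ?thesis unfolding F_def[symmetric] eq0 by (simp add: mult.assoc)
qed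

end

lemma cosh_sinh_entire: "(cosh :: complex \<Rightarrow> complex) holomorphic_on A" "(sinh :: complex \<Rightarrow> complex) holomorphic_on A"
  unfolding cosh_field_def[abs_def] sinh_field_def[abs_def] by (auto intro!: holomorphic_intros)

lemma square_kernel_cosh: "p \<ge> 2 \<Longrightarrow> square_kernel cosh p"
  by unfold_locales
    (auto intro!: cosh_sinh_entire isCont_trig_kernel sinh_le_norm_cosh_sinh simp: sinh_double)

lemma square_kernel_sinh: "p \<ge> 4 \<Longrightarrow> square_kernel sinh p"
  by unfold_locales
    (auto intro!: cosh_sinh_entire isCont_trig_kernel sinh_le_norm_cosh_sinh simp: sinh_double)

section \<open>The integral representation of the zeta function\<close>

text \<open>An antiderivative of u^p exp (-l u), as obtained by repeated integration by
  parts.\<close>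

fun exp_power_prim :: "complex \<Rightarrow> nat \<Rightarrow> real \<Rightarrow> complex" where
  "exp_power_prim l 0 u = - exp (- l * of_real u) / l"
| "exp_power_prim l (Suc p) u = - (of_real u ^ Suc p * exp (- l * of_real u)) / l + of_nat (Suc p) / l * exp_power_prim l p u"

lemma exp_power_prim_deriv:
  assumes "l \<noteq> 0"
  shows "(exp_power_prim l p has_vector_derivative of_real u ^ p * exp (- l * of_real u)) (at u)"
proof (induction p)
  case 0
  have "((\<lambda>z. - exp (- l * z) / l) has_field_derivative exp (- l * of_real u)) (at (of_real u))"
    using assms by (auto intro!: derivative_eq_intros)
  then show ?case unfolding exp_power_prim.simps[abs_def] by (auto dest: has_vector_derivative_real_field)
next
  case (Suc p)
  have "((\<lambda>z. - (z ^ Suc p * exp (- l * z)) / l) has_field_derivative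
      of_real u ^ Suc p * exp (- l * of_real u) - of_nat (Suc p) / l * (of_real u ^ p * exp (- l * of_real u))) (at (of_real u))"
    using assms by (auto intro!: derivative_eq_intros simp: field_simps simp del: of_nat_Suc power_Suc)
  from has_vector_derivative_real_field[OF this]
  have "((\<lambda>u. - (of_real u ^ Suc p * exp (- l * of_real u)) / l + of_nat (Suc p) / l * exp_power_prim l p u) has_vector_derivative
     (of_real u ^ Suc p * exp (- l * of_real u) - of_nat (Suc p) / l * (of_real u ^ p * exp (- l * of_real u))) +
      of_nat (Suc p) / l * (of_real u ^ p * exp (- l * of_real u))) (at u)"
    by (intro has_vector_derivative_add has_vector_derivative_mult_right Suc)
  then show ?case unfolding exp_power_prim.simps[abs_def] by (simp del: of_nat_Suc power_Suc)
qed

lemma exp_power_prim_0: "l \<noteq> 0 \<Longrightarrow> exp_power_prim l p 0 = - fact p / l ^ Suc p"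
proof (induction p)
  case (Suc p)
  then have "exp_power_prim l (Suc p) 0 = of_nat (Suc p) / l * (- fact p / l ^ Suc p)"
    by (simp del: of_nat_Suc)
  also have "\<dots> = - fact (Suc p) / l ^ Suc (Suc p)" by (simp add: mult.assoc)
  finally show ?case .
qed simp

lemma power_exp_tendsto_0:
  assumes "Re l > 0"
  shows "((\<lambda>u. of_real u ^ p * exp (- l * of_real u)) \<longlongrightarrow> 0) at_top"
proof (rule tendsto_norm_zero_cancel)
  have "((\<lambda>x. x ^ p / exp x :: real) \<longlongrightarrow> 0) at_top" by (rule tendsto_power_div_exp_0)
  moreover have "filterlim (\<lambda>u. Re l * u) at_top at_top" using assms by (intro filterlim_tendsto_pos_mult_at_top[OF tendsto_const]) (auto simp: filterlim_ident)
  ultimately have "((\<lambda>u. (Re l * u) ^ p / exp (Re l * u)) \<longlongrightarrow> 0) at_top" by (rule filterlim_compose)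
  then have "((\<lambda>u. (1 / Re l ^ p) * ((Re l * u) ^ p / exp (Re l * u))) \<longlongrightarrow> 0) at_top" by (rule tendsto_mult_right_zero)
  moreover have "\<forall>\<^sub>F u in at_top. (1 / Re l ^ p) * ((Re l * u) ^ p / exp (Re l * u)) = norm (of_real u ^ p * exp (- l * of_real u))"
    using eventually_ge_at_top[of 0]
  proof eventually_elim
    case (elim u)
    have "norm (of_real u ^ p * exp (- l * of_real u)) = u ^ p * exp (- (Re l * u))"
      using elim by (simp add: norm_mult norm_power)
    also have "\<dots> = (1 / Re l ^ p) * ((Re l * u) ^ p / exp (Re l * u))"
      using assms by (simp add: power_mult_distrib exp_minus divide_inverse)
    finally show ?case by simp
  qed
  ultimately show "((\<lambda>u. norm (of_real u ^ p * exp (- l * of_real u))) \<longlongrightarrow> 0) at_top" by (rule Lim_transform_eventually)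
qed

lemma exp_power_prim_tendsto_0:
  assumes "Re l > 0" shows "(exp_power_prim l p \<longlongrightarrow> 0) at_top"
proof (induction p)
  case 0
  have "((\<lambda>u. - (of_real u ^ 0 * exp (- l * of_real u)) / l) \<longlongrightarrow> - 0 / l) at_top"
    using assms by (intro tendsto_intros power_exp_tendsto_0) auto
  then show ?case by (simp add: exp_power_prim.simps[abs_def])
next
  case (Suc p)
  have "((\<lambda>u. - (of_real u ^ Suc p * exp (- l * of_real u)) / l + of_nat (Suc p) / l * exp_power_prim l p u) \<longlongrightarrow> - 0 / l + of_nat (Suc p) / l * 0) at_top"
    using assms by (intro tendsto_intros power_exp_tendsto_0 Suc) auto
  then show ?case by (simp add: exp_power_prim.simps[abs_def])
qed

lemma half_line_open_closed:
  fixes f :: "real \<Rightarrow> 'a::{banach, second_countable_topology}"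
  assumes [measurable]: "f \<in> borel_measurable borel"
  shows "set_integrable lborel {0<..} f \<longleftrightarrow> set_integrable lborel {0..} f"
    "(LINT u:{0<..}|lborel. f u) = (LINT u:{0..}|lborel. f u)"
proof -
  have ae: "AE u in lborel. indicator {0<..} u *\<^sub>R f u = indicator {0..} u *\<^sub>R f u"
    using AE_lborel_singleton[of "0::real"] by eventually_elim (auto simp: indicator_def)
  show "set_integrable lborel {0<..} f \<longleftrightarrow> set_integrable lborel {0..} f"
    unfolding set_integrable_def by (rule integrable_cong_AE[OF _ _ ae]) simp_all
  show "(LINT u:{0<..}|lborel. f u) = (LINT u:{0..}|lborel. f u)"
    unfolding set_lebesgue_integral_def by (rule integral_cong_AE[OF _ _ ae]) simp_all
qed

text \<open>For a nonnegative integrand the fundamental theorem on the half line yields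
  integrability and value at once. The complex case takes its integrability from this one with c =
  Re l.\<close>

lemma power_exp_integral_real:
  assumes "0 < (c::real)"
  shows "set_integrable lborel {0<..} (\<lambda>u. u ^ p * exp (- c * u))" "(LBINT u:{0<..}. u ^ p * exp (- c * u)) = fact p / c ^ Suc p"
proof -
  let ?f = "\<lambda>u::real. u ^ p * exp (- c * u)"
  let ?F = "\<lambda>u. Re (exp_power_prim (of_real c) p u)"
  have f: "?f u = Re (of_real u ^ p * exp (- of_real c * of_real u))" for u
  proof -
    have "of_real u ^ p * exp (- of_real c * of_real u) = complex_of_real (u ^ p * exp (- c * u))"
      by (simp add: exp_of_real[symmetric])
    then show ?thesis by (simp only: Re_complex_of_real)
  qed
  have D: "(?F has_real_derivative ?f u) (at u)" for u
  proof -
    have "(exp_power_prim (of_real c) p has_vector_derivative of_real u ^ p * exp (- of_real c * of_real u)) (at u)"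
      using assms by (intro exp_power_prim_deriv) auto
    from bounded_linear.has_vector_derivative[OF bounded_linear_Re this]
    show ?thesis unfolding f by (simp only: has_real_derivative_iff_has_vector_derivative)
  qed
  have l: "(?F \<longlongrightarrow> 0) at_top"
    using tendsto_Re[OF exp_power_prim_tendsto_0[of "of_real c" p]] assms by simp
  have F0: "?F 0 = - (fact p / c ^ Suc p)"
  proof -
    have "exp_power_prim (of_real c) p 0 = of_real (- (fact p / c ^ Suc p))"
      using assms by (subst exp_power_prim_0) auto
    then show ?thesis by (simp only: Re_complex_of_real)
  qed
  have nn: "(\<integral>\<^sup>+x. ennreal (?f x) * indicator {0..} x \<partial>lborel) = ennreal (0 - ?F 0)"
    by (rule nn_integral_FTC_atLeast[OF _ D _ l]) auto
  have bi: "has_bochner_integral lborel (\<lambda>u. indicator {0..} u *\<^sub>R ?f u) (fact p / c ^ Suc p)"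
  proof (rule has_bochner_integral_nn_integral)
    have "(\<integral>\<^sup>+x. ennreal (indicator {0..} x *\<^sub>R ?f x) \<partial>lborel) = (\<integral>\<^sup>+x. ennreal (?f x) * indicator {0..} x \<partial>lborel)"
      by (intro nn_integral_cong) (auto simp: indicator_def)
    then show "(\<integral>\<^sup>+x. ennreal (indicator {0..} x *\<^sub>R ?f x) \<partial>lborel) = ennreal (fact p / c ^ Suc p)"
      using nn unfolding F0 by simp
  qed (use assms in \<open>auto simp: indicator_def intro!: AE_I2\<close>)
  have "?f \<in> borel_measurable borel" by measurable
  note oc = half_line_open_closed[OF this]
  show "set_integrable lborel {0<..} ?f" "(LBINT u:{0<..}. ?f u) = fact p / c ^ Suc p"
    unfolding oc using bi by (auto simp: set_integrable_def set_lebesgue_integral_def has_bochner_integral_iff)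
qed

lemma power_exp_integral:
  assumes l: "0 < Re l"
  shows "set_integrable lborel {0<..} (\<lambda>u. of_real u ^ p * exp (- l * of_real u))"
    "(CLBINT u:{0<..}. of_real u ^ p * exp (- l * of_real u)) = fact p / l ^ Suc p"
proof -
  let ?f = "\<lambda>u::real. of_real u ^ p * exp (- l * of_real u)"
  have m: "?f \<in> borel_measurable borel" by measurable
  show i: "set_integrable lborel {0<..} ?f"
  proof (rule set_integrable_bound[OF power_exp_integral_real(1)[OF l, of p]])
    show "set_borel_measurable lborel {0<..} ?f" unfolding set_borel_measurable_def by measurable
    show "AE x in lborel. x \<in> {0<..} \<longrightarrow> norm (?f x) \<le> norm (x ^ p * exp (- Re l * x))"
      by (intro AE_I2) (simp add: norm_mult norm_power)
  qed
  then have i0: "set_integrable lborel {0..} ?f" using half_line_open_closed(1)[OF m] by simp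
  have "((\<lambda>b. CLBINT u:{0..b}. ?f u) \<longlongrightarrow> (CLBINT u:{0..}. ?f u)) at_top"
    by (rule tendsto_set_lebesgue_integral_at_top[OF _ i0]) simp
  moreover have "((\<lambda>b. CLBINT u:{0..b}. ?f u) \<longlongrightarrow> 0 - exp_power_prim l p 0) at_top"
  proof (rule Lim_transform_eventually)
    show "((\<lambda>b. exp_power_prim l p b - exp_power_prim l p 0) \<longlongrightarrow> 0 - exp_power_prim l p 0) at_top"
      by (intro tendsto_intros exp_power_prim_tendsto_0 l)
    have FTC: "(CLBINT u:{0..b}. ?f u) = exp_power_prim l p b - exp_power_prim l p 0" if "b \<ge> 0" for b
      unfolding set_lebesgue_integral_def
    proof (rule integral_FTC_atLeastAtMost[OF that])
      have "l \<noteq> 0" using l by auto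
      then show "(exp_power_prim l p has_vector_derivative ?f x) (at x within {0..b})" for x
        by (rule has_vector_derivative_at_within[OF exp_power_prim_deriv])
      show "continuous_on {0..b} ?f" by (intro continuous_intros)
    qed
    show "\<forall>\<^sub>F b in at_top. exp_power_prim l p b - exp_power_prim l p 0 = (CLBINT u:{0..b}. ?f u)"
      using eventually_ge_at_top[of 0] by eventually_elim (simp only: FTC)
  qed
  ultimately have "(CLBINT u:{0..}. ?f u) = 0 - exp_power_prim l p 0"
    by (rule tendsto_unique[OF trivial_limit_at_top_linorder])
  moreover have "l \<noteq> 0" using l by auto
  ultimately show "(CLBINT u:{0<..}. ?f u) = fact p / l ^ Suc p"
    unfolding half_line_open_closed(2)[OF m] by (simp add: exp_power_prim_0)
qed

text \<open>Induction on N through the bijection (x, xs) -> x # xs, with the product of two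
  absolutely convergent families as the step.\<close>

lemma has_sum_list_prod:
  fixes f :: "nat \<Rightarrow> nat \<Rightarrow> complex"
  assumes "\<And>j. j < N \<Longrightarrow> summable (\<lambda>k. norm (f j k))"
  shows "((\<lambda>n. \<Prod>j<N. f j (n ! j)) has_sum (\<Prod>j<N. \<Sum>k. f j k)) {n. length n = N}"
    "(\<lambda>n. norm (\<Prod>j<N. f j (n ! j))) summable_on {n. length n = N}"
proof -
  have "((\<lambda>n. \<Prod>j<N. f j (n ! j)) has_sum (\<Prod>j<N. \<Sum>k. f j k)) {n. length n = N} \<and>
    (\<lambda>n. norm (\<Prod>j<N. f j (n ! j))) summable_on {n. length n = N}"
    using assms
  proof (induction N arbitrary: f)
    case 0
    have "{n :: nat list. length n = 0} = {[]}" by auto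
    then show ?case using has_sum_finite[of "{[] :: nat list}" "\<lambda>_. 1 :: complex"] by simp
  next
    case (Suc N)
    let ?L = "{n :: nat list. length n = N}"
    let ?c = "\<lambda>(x :: nat, xs). x # xs"
    have IH: "((\<lambda>n. \<Prod>j<N. f (Suc j) (n ! j)) has_sum (\<Prod>j<N. \<Sum>k. f (Suc j) k)) ?L"
      "(\<lambda>n. norm (\<Prod>j<N. f (Suc j) (n ! j))) summable_on ?L"
      using Suc.IH[of "\<lambda>j. f (Suc j)"] Suc.prems by auto
    have f0: "(\<lambda>k. norm (f 0 k)) summable_on UNIV" "((\<lambda>k. f 0 k) has_sum (\<Sum>k. f 0 k)) UNIV"
      using Suc.prems[of 0]
      by (auto intro!: norm_summable_imp_summable_on norm_summable_imp_has_sum summable_sums summable_norm_cancel[of "f 0"])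
    have ns: "(\<lambda>(x, xs). norm (f 0 x * (\<Prod>j<N. f (Suc j) (xs ! j)))) summable_on UNIV \<times> ?L"
      by (rule abs_summable_on_product[OF f0(1) IH(2)])
    have hs: "((\<lambda>z. f 0 (fst z) * (\<Prod>j<N. f (Suc j) (snd z ! j))) has_sum (\<Sum>k. f 0 k) * (\<Prod>j<N. \<Sum>k. f (Suc j) k)) (UNIV \<times> ?L)"
    proof (rule has_sum_SigmaI)
      show "((\<lambda>y. f 0 (fst (x, y)) * (\<Prod>j<N. f (Suc j) (snd (x, y) ! j))) has_sum f 0 x * (\<Prod>j<N. \<Sum>k. f (Suc j) k)) ?L" for x
        using has_sum_cmult_right[OF IH(1)] by simp
      show "((\<lambda>x. f 0 x * (\<Prod>j<N. \<Sum>k. f (Suc j) k)) has_sum (\<Sum>k. f 0 k) * (\<Prod>j<N. \<Sum>k. f (Suc j) k)) UNIV"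
        by (rule has_sum_cmult_left[OF f0(2)])
      show "(\<lambda>z. f 0 (fst z) * (\<Prod>j<N. f (Suc j) (snd z ! j))) summable_on UNIV \<times> ?L"
        using ns by (rule abs_summable_summable[OF iffD1[OF summable_on_cong, rotated]]) (simp add: case_prod_unfold)
    qed
    have inj: "inj_on ?c (UNIV \<times> ?L)" by (auto simp: inj_on_def)
    have im: "?c ` (UNIV \<times> ?L) = {n. length n = Suc N}"
      by (auto simp: length_Suc_conv image_iff)
    have comp: "(\<lambda>n. \<Prod>j<Suc N. f j (n ! j)) \<circ> ?c = (\<lambda>z. f 0 (fst z) * (\<Prod>j<N. f (Suc j) (snd z ! j)))"
      unfolding prod.lessThan_Suc_shift by (auto simp: fun_eq_iff)
    have comp2: "(\<lambda>n. norm (\<Prod>j<Suc N. f j (n ! j))) \<circ> ?c = (\<lambda>(x, xs). norm (f 0 x * (\<Prod>j<N. f (Suc j) (xs ! j))))"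
      unfolding prod.lessThan_Suc_shift by (auto simp: fun_eq_iff)
    have "((\<lambda>n. \<Prod>j<Suc N. f j (n ! j)) has_sum (\<Prod>j<Suc N. \<Sum>k. f j k)) {n. length n = Suc N}"
      unfolding im[symmetric] has_sum_reindex[OF inj] comp using hs by (simp only: prod.lessThan_Suc_shift)
    moreover have "(\<lambda>n. norm (\<Prod>j<Suc N. f j (n ! j))) summable_on {n. length n = Suc N}"
      unfolding im[symmetric] summable_on_reindex[OF inj] comp2 by (rule ns)
    ultimately show ?case by blast
  qed
  then show "((\<lambda>n. \<Prod>j<N. f j (n ! j)) has_sum (\<Prod>j<N. \<Sum>k. f j k)) {n. length n = N}"
    "(\<lambda>n. norm (\<Prod>j<N. f j (n ! j))) summable_on {n. length n = N}" by auto
qed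

text \<open>Here \<^term>\<open>Suc p\<close> is the exponent of the zeta function, so \<^term>\<open>length a \<le> p\<close> is
  absolute convergence of the series.\<close>

lemma gen_barnes_zeta_integral:
  fixes a :: "complex list" and \<sigma> :: "int list"
  assumes a: "a \<noteq> []" "\<And>j. j < length a \<Longrightarrow> Re (a ! j) \<ge> 1" and \<sigma>: "\<And>j. j < length a \<Longrightarrow> \<sigma> ! j \<in> {1, -1}"
    and \<omega>: "Re \<omega> \<ge> 1" and p: "length a \<le> p"
  defines "K \<equiv> \<lambda>u. of_real u ^ p * exp (- \<omega> * of_real u) * (\<Prod>j<length a. inverse (1 - of_int (\<sigma> ! j) * exp (- (a ! j) * of_real u)))"
  shows "set_integrable lborel {0<..} K"
    "Gamma (of_nat (Suc p)) * gen_barnes_zeta (of_nat (Suc p)) \<omega> a \<sigma> = (CLBINT u:{0<..}. K u)"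
proof -
  define N where "N = length a"
  define A where "A = {n :: nat list. length n = N}"
  define c where "c n = (\<Prod>j<N. of_int (\<sigma> ! j) ^ (n ! j) :: complex)" for n
  define l where "l n = \<omega> + (\<Sum>j<N. of_nat (n ! j) * a ! j)" for n
  have N: "N > 0" using a(1) by (simp add: N_def)
  have nc: "norm (c n) = 1" for n
  proof -
    have "norm (of_int (\<sigma> ! j) ^ (n ! j) :: complex) = 1" if "j < N" for j
      using \<sigma>[of j] that by (auto simp: N_def norm_power)
    then show ?thesis unfolding c_def prod_norm[symmetric] by (intro prod.neutral) auto
  qed
  have Re_l: "Re (l n) \<ge> 1 + (\<Sum>j<N. real (n ! j))" for n
  proof -
    have "(\<Sum>j<N. real (n ! j)) \<le> (\<Sum>j<N. real (n ! j) * Re (a ! j))"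
      using a(2) by (intro sum_mono) (use mult_left_mono[of 1] in \<open>fastforce simp: N_def\<close>)
    then show ?thesis using \<omega> by (simp add: l_def)
  qed
  have Re_l0: "Re (l n) > 0" for n using Re_l[of n] sum_nonneg[of "{..<N}" "\<lambda>j. real (n ! j)"] by simp
  \<comment> \<open>Re l is at least n_j + 1 for every j, so Re l ^ (p + 1) dominates the product of
    the (n_j + 1)^q when q N = p + 1. The majorant is thus a product of N series with exponent q >
    1.\<close>
  define q where "q = real (Suc p) / real N"
  have q: "q > 1" using p N by (simp add: q_def N_def)
  have lb: "1 / Re (l n) ^ Suc p \<le> (\<Prod>j<N. real (Suc (n ! j)) powr - q)" for n
  proof -
    let ?S = "1 + (\<Sum>j<N. real (n ! j))"
    have S: "?S \<ge> 1" by (simp add: sum_nonneg)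
    have "(\<Prod>j<N. real (Suc (n ! j)) powr q) \<le> (\<Prod>j<N. ?S powr q)"
    proof (intro prod_mono conjI)
      fix j assume j: "j \<in> {..<N}"
      have "real (n ! j) \<le> (\<Sum>j<N. real (n ! j))" using j by (intro member_le_sum) auto
      then show "real (Suc (n ! j)) powr q \<le> ?S powr q" using q by (intro powr_mono2) auto
    qed auto
    also have "\<dots> = ?S powr (q * real N)" using S by (simp add: powr_powr[symmetric] powr_realpow)
    also have "q * real N = real (Suc p)" using N by (simp add: q_def)
    also have "?S powr real (Suc p) = ?S ^ Suc p" using S by (intro powr_realpow) auto
    also have "\<dots> \<le> Re (l n) ^ Suc p" using Re_l[of n] S by (intro power_mono) auto
    finally have le: "(\<Prod>j<N. real (Suc (n ! j)) powr q) \<le> Re (l n) ^ Suc p" .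
    have "1 / Re (l n) ^ Suc p \<le> 1 / (\<Prod>j<N. real (Suc (n ! j)) powr q)"
      using le by (intro divide_left_mono mult_pos_pos prod_pos) (use Re_l0 in auto)
    also have "\<dots> = (\<Prod>j<N. real (Suc (n ! j)) powr - q)"
      by (simp add: powr_minus inverse_eq_divide prod_dividef del: of_nat_Suc)
    finally show ?thesis .
  qed
  have "(\<lambda>n. \<Prod>j<N. real (Suc (n ! j)) powr - q) summable_on A"
  proof -
    have "summable (\<lambda>k. norm (complex_of_real (real (Suc k) powr - q)))"
    proof -
      have "summable (\<lambda>k. real k powr - q)" using q by (simp add: summable_real_powr_iff)
      then show ?thesis by (subst (asm) summable_Suc_iff[symmetric]) simp
    qed
    then have "(\<lambda>n. norm (\<Prod>j<N. complex_of_real (real (Suc (n ! j)) powr - q))) summable_on A"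
      unfolding A_def by (rule has_sum_list_prod(2)[where f = "\<lambda>j k. complex_of_real (real (Suc k) powr - q)"])
    then show ?thesis by (simp add: prod_norm[symmetric] del: of_nat_Suc)
  qed
  then have s2: "(\<lambda>n. 1 / Re (l n) ^ Suc p) summable_on A"
    by (rule summable_on_comparison_test) (use lb Re_l0 in \<open>auto simp: less_imp_le\<close>)
  have "countable A" by simp
  moreover have "infinite A"
  proof -
    have "inj_on (\<lambda>k::nat. replicate N k) UNIV" using N by (auto simp: inj_on_def replicate_eq_replicate)
    then have "infinite (range (\<lambda>k::nat. replicate N k))" by (simp add: finite_image_iff)
    moreover have "range (\<lambda>k::nat. replicate N k) \<subseteq> A" by (auto simp: A_def)
    ultimately show ?thesis using finite_subset by blast
  qed
  ultimately have bij: "bij_betw (from_nat_into A) UNIV A" by (rule bij_betw_from_nat_into)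
  \<comment> \<open>Enumerating the index lists turns the unordered sum into an ordinary series, the
    form in which summation and integration are interchanged.\<close>
  define e where "e = from_nat_into A"
  note bij = bij[folded e_def]
  define f where "f i u = indicator {0<..} u *\<^sub>R (c (e i) * (of_real u ^ p * exp (- l (e i) * of_real u)))" for i and u :: real
  have f_int: "integrable lborel (f i)" and f_val: "integral\<^sup>L lborel (f i) = c (e i) * (fact p / l (e i) ^ Suc p)" for i
  proof -
    have "f i = (\<lambda>u. c (e i) * (indicator {0<..} u *\<^sub>R (of_real u ^ p * exp (- l (e i) * of_real u))))"
      by (simp add: f_def fun_eq_iff)
    then show "integrable lborel (f i)" "integral\<^sup>L lborel (f i) = c (e i) * (fact p / l (e i) ^ Suc p)"
      using power_exp_integral[OF Re_l0[of "e i"], of p]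
      by (simp_all only: set_integrable_def set_lebesgue_integral_def integrable_mult_right integral_mult_right_zero)
  qed
  have nf: "norm (f i u) = indicator {0<..} u *\<^sub>R (u ^ p * exp (- Re (l (e i)) * u))" for i u
    by (auto simp: f_def indicator_def norm_mult norm_power nc)
  have f_norm: "(\<integral>u. norm (f i u) \<partial>lborel) = fact p * (1 / Re (l (e i)) ^ Suc p)" for i
    unfolding nf using power_exp_integral_real(2)[OF Re_l0[of "e i"], of p] by (simp add: set_lebesgue_integral_def)
  have reindex: "(\<lambda>i. g (e i)) summable_on UNIV \<longleftrightarrow> g summable_on A" for g :: "nat list \<Rightarrow> real"
    using summable_on_reindex_bij_betw[OF bij, of g] .
  have sum_norm: "summable (\<lambda>i. \<integral>u. norm (f i u) \<partial>lborel)"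
    unfolding f_norm
    using s2 reindex[of "\<lambda>n. 1 / Re (l n) ^ Suc p"]
    by (intro summable_mult summable_on_imp_summable) simp
  have prodsum: "((\<lambda>n. c n * (of_real u ^ p * exp (- l n * of_real u))) has_sum K u) A \<and>
      (\<lambda>n. norm (c n * (of_real u ^ p * exp (- l n * of_real u)))) summable_on A" if u: "u > 0" for u
  proof -
    let ?g = "\<lambda>j k. (of_int (\<sigma> ! j) * exp (- (a ! j) * of_real u)) ^ k :: complex"
    have ng: "norm (of_int (\<sigma> ! j) * exp (- (a ! j) * of_real u) :: complex) < 1" if "j < N" for j
    proof -
      have "norm (of_int (\<sigma> ! j) :: complex) = 1" using \<sigma>[of j] that by (auto simp: N_def)
      moreover have "Re (a ! j) * u > 0" using a(2)[of j] that u by (simp add: N_def)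
      ultimately show ?thesis by (simp add: norm_mult)
    qed
    have sg: "summable (\<lambda>k. norm (?g j k))" if "j < N" for j
      using ng[OF that] by (simp add: norm_power summable_geometric)
    have vg: "(\<Sum>k. ?g j k) = inverse (1 - of_int (\<sigma> ! j) * exp (- (a ! j) * of_real u))" if "j < N" for j
      using suminf_geometric[OF ng[OF that]] by (simp add: inverse_eq_divide)
    have term_eq: "c n * (of_real u ^ p * exp (- l n * of_real u)) = (of_real u ^ p * exp (- \<omega> * of_real u)) * (\<Prod>j<N. ?g j (n ! j))" for n
    proof -
      have "exp (- l n * of_real u) = exp (- \<omega> * of_real u) * (\<Prod>j<N. exp (- (a ! j) * of_real u) ^ (n ! j))"
        by (simp add: l_def exp_of_nat_mult[symmetric] exp_sum[symmetric] exp_add[symmetric] sum_distrib_left sum_negf algebra_simps)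
      then show ?thesis by (simp add: c_def power_mult_distrib prod.distrib mult_ac)
    qed
    have "((\<lambda>n. \<Prod>j<N. ?g j (n ! j)) has_sum (\<Prod>j<N. \<Sum>k. ?g j k)) A" "(\<lambda>n. norm (\<Prod>j<N. ?g j (n ! j))) summable_on A"
      unfolding A_def using sg by (intro has_sum_list_prod; simp)+
    moreover have "(\<Prod>j<N. \<Sum>k. ?g j k) = (\<Prod>j<length a. inverse (1 - of_int (\<sigma> ! j) * exp (- (a ! j) * of_real u)))"
      unfolding N_def[symmetric] by (intro prod.cong refl vg) auto
    ultimately show ?thesis unfolding term_eq K_def norm_mult[of "of_real u ^ p * exp (- \<omega> * of_real u)"]
      by (auto intro!: has_sum_cmult_right summable_on_cmult_right)
  qed
  have sumf: "(\<lambda>i. f i u) sums (indicator {0<..} u *\<^sub>R K u)" "summable (\<lambda>i. norm (f i u))" for u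
  proof -
    show "(\<lambda>i. f i u) sums (indicator {0<..} u *\<^sub>R K u)"
    proof (cases "u > 0")
      case True
      then have "((\<lambda>i. c (e i) * (of_real u ^ p * exp (- l (e i) * of_real u))) has_sum K u) UNIV"
        using prodsum[OF True] has_sum_reindex_bij_betw[OF bij, of "\<lambda>n. c n * (of_real u ^ p * exp (- l n * of_real u))"] by simp
      then show ?thesis using True by (simp add: f_def has_sum_imp_sums)
    qed (simp add: f_def)
    show "summable (\<lambda>i. norm (f i u))"
    proof (cases "u > 0")
      case True
      then have "(\<lambda>i. norm (c (e i) * (of_real u ^ p * exp (- l (e i) * of_real u)))) summable_on UNIV"
        using prodsum[OF True] reindex[of "\<lambda>n. norm (c n * (of_real u ^ p * exp (- l n * of_real u)))"] by simp
      then show ?thesis using True by (simp add: f_def summable_on_imp_summable)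
    qed (simp add: f_def)
  qed
  have suminf_f: "(\<Sum>i. f i u) = indicator {0<..} u *\<^sub>R K u" for u using sumf(1)[of u] by (simp add: sums_iff)
  have "integrable lborel (\<lambda>u. \<Sum>i. f i u)"
    by (rule integrable_suminf[OF f_int _ sum_norm]) (use sumf(2) in simp)
  then show "set_integrable lborel {0<..} K" unfolding suminf_f set_integrable_def .
  have "(\<lambda>i. integral\<^sup>L lborel (f i)) sums (\<integral>u. (\<Sum>i. f i u) \<partial>lborel)"
    by (rule sums_integral[OF f_int _ sum_norm]) (use sumf(2) in simp)
  then have S: "(\<lambda>i. fact p * (c (e i) / l (e i) ^ Suc p)) sums (CLBINT u:{0<..}. K u)"
    unfolding suminf_f f_val set_lebesgue_integral_def by (simp add: mult.commute)
  have "(\<lambda>n. norm (c n / l n ^ Suc p)) summable_on A"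
  proof (rule summable_on_comparison_test[OF s2])
    fix n
    have "Re (l n) ^ Suc p \<le> norm (l n) ^ Suc p"
      using Re_l0[of n] complex_Re_le_cmod[of "l n"] by (intro power_mono) auto
    then show "norm (c n / l n ^ Suc p) \<le> 1 / Re (l n) ^ Suc p"
      using Re_l0[of n] by (auto simp: norm_divide norm_power nc simp del: power_Suc intro!: frac_le)
  qed auto
  then have "(\<lambda>n. c n / l n ^ Suc p) summable_on A" by (rule abs_summable_summable)
  then have "((\<lambda>n. c n / l n ^ Suc p) has_sum (\<Sum>\<^sub>\<infinity>n\<in>A. c n / l n ^ Suc p)) A" by (rule has_sum_infsum)
  then have "((\<lambda>i. c (e i) / l (e i) ^ Suc p) has_sum (\<Sum>\<^sub>\<infinity>n\<in>A. c n / l n ^ Suc p)) UNIV"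
    using has_sum_reindex_bij_betw[OF bij, of "\<lambda>n. c n / l n ^ Suc p"] by simp
  then have "(\<lambda>i. c (e i) / l (e i) ^ Suc p) sums (\<Sum>\<^sub>\<infinity>n\<in>A. c n / l n ^ Suc p)" by (rule has_sum_imp_sums)
  from sums_mult[OF this, of "fact p"] S have "(CLBINT u:{0<..}. K u) = fact p * (\<Sum>\<^sub>\<infinity>n\<in>A. c n / l n ^ Suc p)"
    by (rule sums_unique2[symmetric])
  moreover have "gen_barnes_zeta (of_nat (Suc p)) \<omega> a \<sigma> = (\<Sum>\<^sub>\<infinity>n\<in>A. c n / l n ^ Suc p)"
  proof -
    have "l n powr of_nat (Suc p) = l n ^ Suc p" for n using Re_l0[of n] by (intro powr_nat') auto
    moreover have "Re (of_nat (Suc p)) > of_nat (length a)" using p by simp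
    ultimately show ?thesis
      unfolding gen_barnes_zeta_def barnes_zeta_series_def l_def[symmetric] c_def[symmetric] A_def[symmetric] N_def[symmetric]
      by (simp del: of_nat_Suc power_Suc add: c_def l_def A_def N_def)
  qed
  moreover have "Gamma (of_nat (Suc p)) = (fact p :: complex)" by (simp add: Gamma_fact)
  ultimately show "Gamma (of_nat (Suc p)) * gen_barnes_zeta (of_nat (Suc p)) \<omega> a \<sigma> = (CLBINT u:{0<..}. K u)" by (simp only:)
qed

text \<open>The residue series has terms (pi k / 2)^p, while the lemniscatic series is normalised by
  pi^(p + 2); the ratio 1 / (2^p pi^2) times 2 pi i (1 + i) gives the stated constant. Integrability
  of the kernel combination is inherited from K, which is where d \<noteq> 0 enters.\<close>

lemma integral_trig_kernel:
  fixes K :: "real \<Rightarrow> complex"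
  assumes sk: "square_kernel C p" and C: "\<And>x. C (of_real x) = of_real (c x)"
    and sm: "(\<lambda>k. of_real (pi ^ (p + 2) * (real (Suc k) ^ p * (-1) ^ Suc k / (c (pi * real (Suc k) / 2))\<^sup>2))) sums U"
    and K: "set_integrable lborel {0<..} K" and d: "d \<noteq> 0"
    and eq: "\<And>u. u > 0 \<Longrightarrow> K u = d * (trig_kernel C p (rot (of_real u)) - \<i> * trig_kernel C p (\<i> * rot (of_real u)))"
  shows "(CLBINT u:{0<..}. K u) = d * (2 * \<i> * (1 + \<i>)) / 2 ^ p * (U / of_real pi)"
proof -
  let ?F = "\<lambda>u. square_kernel.\<phi> C p (of_real u) - \<i> * square_kernel.\<phi> C p (\<i> * of_real u)"
  have KF: "K u = d * ?F u" if "u \<in> {0<..}" for u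
    using eq[of u] that by (simp add: square_kernel.\<phi>_def[OF sk] rot_def mult_ac)
  have "set_integrable lborel {0<..} (\<lambda>u. d * ?F u)"
    using K by (rule set_integrable_cong[THEN iffD1, OF refl refl, rotated]) (use KF in auto)
  then have int: "set_integrable lborel {0<..} ?F" using d by simp
  have "(-1) ^ Suc k * of_real (pi * real (Suc k) / 2) ^ p / (C (of_real (pi * real (Suc k) / 2)))\<^sup>2 =
     1 / (2 ^ p * of_real pi ^ 2) * complex_of_real (pi ^ (p + 2) * (real (Suc k) ^ p * (-1) ^ Suc k / (c (pi * real (Suc k) / 2))\<^sup>2))" for k
  proof -
    have pp: "pi ^ (p + 2) = pi ^ p * pi\<^sup>2" by (rule power_add)
    show ?thesis unfolding C pp by (simp add: power_divide power_mult_distrib del: of_nat_Suc)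
  qed
  then have s: "(\<lambda>k. (-1) ^ Suc k * of_real (pi * real (Suc k) / 2) ^ p / (C (of_real (pi * real (Suc k) / 2)))\<^sup>2) sums (1 / (2 ^ p * of_real pi ^ 2) * U)"
    using sums_mult[OF sm] by (simp only:)
  have "(CLBINT u:{0<..}. K u) = (CLBINT u:{0<..}. d * ?F u)"
    by (rule set_lebesgue_integral_cong) (use KF in auto)
  also have "\<dots> = d * (2 * of_real pi * \<i> * (1 + \<i>) * (1 / (2 ^ p * of_real pi ^ 2) * U))"
    unfolding set_integral_mult_right square_kernel.half_line_integral[OF sk int s] ..
  finally show ?thesis by (simp add: power2_eq_square)
qed

section \<open>Elementary identities for the exponential factors\<close>

lemma inverse_one_minus_exp: "inverse (1 - exp (- (2 * z))) = exp z / (2 * sinh z)"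
  and inverse_one_plus_exp: "inverse (1 + exp (- (2 * z))) = exp z / (2 * cosh z)" for z :: complex
proof -
  have e: "exp (- (2 * z)) = exp (- z) * exp (- z)" "exp (- z) * exp z = 1" by (simp_all add: exp_add[symmetric])
  have "1 - exp (- (2 * z)) = exp (- z) * (2 * sinh z)" "1 + exp (- (2 * z)) = exp (- z) * (2 * cosh z)"
    using e by (simp_all add: sinh_field_def cosh_field_def right_diff_distrib distrib_left)
  then show "inverse (1 - exp (- (2 * z))) = exp z / (2 * sinh z)" "inverse (1 + exp (- (2 * z))) = exp z / (2 * cosh z)"
    by (simp_all only: inverse_mult_distrib divide_inverse exp_minus inverse_inverse_eq)
qed

text \<open>A roots-of-unity filter on the exponential series: the coefficients in i keep the powers
  z^n with n = 3 mod 4, those in -i the powers with n = 1 mod 4.\<close>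

lemma sum_exp_roots:
  "(\<Sum>j=1..4::nat. \<i> powi (int j - 2) * exp (- (\<i> ^ j * z))) = 2 * sinh z - 2 * sin z"
  "(\<Sum>j=1..4::nat. (- \<i>) powi (int j - 2) * exp (- (\<i> ^ j * z))) = 2 * sinh z + 2 * sin z"
proof -
  have i4: "{1..4::nat} = {1,2,3,4}" by auto
  have p: "\<i> powi - 1 = - \<i>" "(- \<i>) powi - 1 = \<i>" "\<i> powi 2 = - 1" "(- \<i>) powi 2 = - 1"
    "\<i> ^ 3 = - \<i>" "\<i> ^ 4 = 1"
    by (simp_all add: power_int_minus power_int_def power3_eq_cube eval_nat_numeral)
  show "(\<Sum>j=1..4::nat. \<i> powi (int j - 2) * exp (- (\<i> ^ j * z))) = 2 * sinh z - 2 * sin z"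
    "(\<Sum>j=1..4::nat. (- \<i>) powi (int j - 2) * exp (- (\<i> ^ j * z))) = 2 * sinh z + 2 * sin z"
    unfolding i4 by (simp_all add: p sin_exp_eq sinh_field_def field_simps)
qed

lemma rot_of_real_nonzero:
  assumes "u > 0"
  defines "w \<equiv> rot (of_real u)"
  shows "sin w \<noteq> 0" "cos w \<noteq> 0" "sinh w \<noteq> 0" "cosh w \<noteq> 0"
proof -
  have w: "Re w = u / 2" "Im w = - u / 2" by (simp_all add: w_def Re_Im_rot)
  have "0 < (sinh (Im w))\<^sup>2" using assms w by simp
  then have "0 < (norm (sin w))\<^sup>2" "0 < (norm (cos w))\<^sup>2"
    unfolding norm_sin_sq norm_cos_sq by (auto intro: add_nonneg_pos)
  then show "sin w \<noteq> 0" "cos w \<noteq> 0" by auto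
  have "0 < sinh (Re w)" using assms w by simp
  then show "sinh w \<noteq> 0" "cosh w \<noteq> 0" using sinh_le_norm_cosh_sinh[of w] assms w by auto
qed

section \<open>The four-term combinations\<close>

definition quartet :: "complex list" where "quartet = [2 - 2 * \<i>, 2 + 2 * \<i>, 1 - \<i>, 1 + \<i>]"

definition zint :: "nat \<Rightarrow> int list \<Rightarrow> complex \<Rightarrow> real \<Rightarrow> complex" where
  "zint p \<sigma> \<omega> u = of_real u ^ p * exp (- \<omega> * of_real u) *
     (\<Prod>j<length quartet. inverse (1 - of_int (\<sigma> ! j) * exp (- (quartet ! j) * of_real u)))"

text \<open>The 3 in the argument is half the sum of the four parameters. Thus exp (-3 u) is exactly
  what turns each 1 / (1 - exp (-a u)) into 1 / (2 sinh (a u / 2)), and each sign -1 turns sinh into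
  cosh. The values a u / 2 are 2 w, 2 i w, w and i w.\<close>

lemma zint_eq:
  fixes u :: real
  defines "w \<equiv> rot (of_real u)"
  shows "zint p [1, 1, -1, -1] (3 + \<omega>) u = of_real u ^ p * exp (- (\<omega> * of_real u)) / (16 * sinh (2 * w) * sinh (2 * (\<i> * w)) * cosh w * cosh (\<i> * w))"
    "zint p [1, 1, 1, 1] (3 + \<omega>) u = of_real u ^ p * exp (- (\<omega> * of_real u)) / (16 * sinh (2 * w) * sinh (2 * (\<i> * w)) * sinh w * sinh (\<i> * w))"
proof -
  have l4: "{..<length quartet} = {0, 1, 2, 3}" by (auto simp: quartet_def)
  have a: "quartet ! 0 * of_real u = 2 * (2 * w)" "quartet ! 1 * of_real u = 2 * (2 * (\<i> * w))"
    "quartet ! 2 * of_real u = 2 * w" "quartet ! 3 * of_real u = 2 * (\<i> * w)"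
    by (simp_all add: quartet_def w_def rot_def complex_eq_iff)
  have u: "of_real u = w + \<i> * w" by (simp add: w_def rot_def complex_eq_iff)
  have "exp (- (3 + \<omega>) * of_real u) = exp (- (\<omega> * of_real u)) * exp (- (3 * of_real u))"
    by (simp add: exp_add[symmetric] algebra_simps)
  moreover have "exp (- (3 * of_real u)) * (exp (2 * w) * exp (2 * (\<i> * w)) * exp w * exp (\<i> * w)) = 1"
    unfolding u by (simp add: exp_add[symmetric] algebra_simps)
  ultimately have e: "exp (- (3 + \<omega>) * of_real u) * (exp (2 * w) * exp (2 * (\<i> * w)) * exp w * exp (\<i> * w)) = exp (- (\<omega> * of_real u))"
    by (simp add: mult.assoc)
  have m: "- x * y = - (x * y)" for x y :: complex by simp
  have "zint p [1, 1, -1, -1] (3 + \<omega>) u = of_real u ^ p * exp (- (3 + \<omega>) * of_real u) *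
     (inverse (1 - exp (- (2 * (2 * w)))) * inverse (1 - exp (- (2 * (2 * (\<i> * w))))) * inverse (1 + exp (- (2 * w))) * inverse (1 + exp (- (2 * (\<i> * w)))))"
    unfolding zint_def l4 m[of "quartet ! _"] by (simp add: a[simplified] mult.assoc del: minus_mult_left minus_add_distrib)
  also have "\<dots> = of_real u ^ p * (exp (- (3 + \<omega>) * of_real u) * (exp (2 * w) * exp (2 * (\<i> * w)) * exp w * exp (\<i> * w))) /
      (16 * sinh (2 * w) * sinh (2 * (\<i> * w)) * cosh w * cosh (\<i> * w))"
    unfolding inverse_one_minus_exp inverse_one_plus_exp by (simp only: times_divide_eq_right times_divide_eq_left divide_divide_eq_left mult_ac) simp
  finally show "zint p [1, 1, -1, -1] (3 + \<omega>) u = of_real u ^ p * exp (- (\<omega> * of_real u)) / (16 * sinh (2 * w) * sinh (2 * (\<i> * w)) * cosh w * cosh (\<i> * w))"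
    unfolding e .
  have "zint p [1, 1, 1, 1] (3 + \<omega>) u = of_real u ^ p * exp (- (3 + \<omega>) * of_real u) *
     (inverse (1 - exp (- (2 * (2 * w)))) * inverse (1 - exp (- (2 * (2 * (\<i> * w))))) * inverse (1 - exp (- (2 * w))) * inverse (1 - exp (- (2 * (\<i> * w)))))"
    unfolding zint_def l4 m[of "quartet ! _"] by (simp add: a[simplified] mult.assoc del: minus_mult_left minus_add_distrib)
  also have "\<dots> = of_real u ^ p * (exp (- (3 + \<omega>) * of_real u) * (exp (2 * w) * exp (2 * (\<i> * w)) * exp w * exp (\<i> * w))) /
      (16 * sinh (2 * w) * sinh (2 * (\<i> * w)) * sinh w * sinh (\<i> * w))"
    unfolding inverse_one_minus_exp inverse_one_plus_exp by (simp only: times_divide_eq_right times_divide_eq_left divide_divide_eq_left mult_ac) simp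
  finally show "zint p [1, 1, 1, 1] (3 + \<omega>) u = of_real u ^ p * exp (- (\<omega> * of_real u)) / (16 * sinh (2 * w) * sinh (2 * (\<i> * w)) * sinh w * sinh (\<i> * w))"
    unfolding e .
qed

lemma zint_measurable [measurable]: "zint p \<sigma> \<omega> \<in> borel_measurable borel"
  unfolding zint_def[abs_def] by measurable

text \<open>Here the exponent 3 is below the dimension 4, so the bound is direct: the two factors
  with sign 1 are at most (1 + u) / u each, which u^2 absorbs, and the two with sign -1 are at most
  2.\<close>

lemma zint_2_integrable:
  assumes \<omega>: "Re \<omega> \<ge> 2"
  shows "set_integrable lborel {0<..} (zint 2 [1, 1, -1, -1] \<omega>)"
proof -
  \<comment> \<open>This is 4 (1 + u)^2 exp (-2 u), expanded into integrals already known.\<close>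
  let ?b = "\<lambda>u::real. 4 * (u ^ 0 * exp (- 2 * u) + 2 * (u ^ 1 * exp (- 2 * u)) + u ^ 2 * exp (- 2 * u))"
  have "set_integrable lborel {0<..} ?b"
    by (intro set_integrable_mult_right set_integral_add(1) power_exp_integral_real(1)) auto
  then show ?thesis
  proof (rule set_integrable_bound)
    show "set_borel_measurable lborel {0<..} (zint 2 [1, 1, -1, -1] \<omega>)"
      unfolding set_borel_measurable_def by measurable
    show "AE u in lborel. u \<in> {0<..} \<longrightarrow> norm (zint 2 [1, 1, -1, -1] \<omega> u) \<le> norm (?b u)"
    proof (intro AE_I2 impI)
      fix u :: real assume "u \<in> {0<..}"
      then have u: "u > 0" by simp
      have l4: "{..<length quartet} = {0, 1, 2, 3}" by (auto simp: quartet_def)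
      have A: "norm (inverse (1 - exp (- a * of_real u))) \<le> (1 + u) / u" if "Re a = 2" for a
      proof -
        have "1 + u \<le> exp u" by (rule exp_ge_add_one_self)
        then have "exp (- u) \<le> 1 / (1 + u)" using u by (simp add: exp_minus field_simps)
        moreover have "exp (- (2 * u)) \<le> exp (- u)" using u by simp
        moreover have "u / (1 + u) = 1 - 1 / (1 + u)" using u by (simp add: field_simps)
        ultimately have "u / (1 + u) \<le> 1 - exp (- (2 * u))" by linarith
        also have "\<dots> = norm (1::complex) - norm (exp (- a * of_real u))" using that by simp
        also have "\<dots> \<le> norm (1 - exp (- a * of_real u))" by (rule norm_triangle_ineq2)
        finally have "inverse (norm (1 - exp (- a * of_real u))) \<le> inverse (u / (1 + u))"
          using u by (intro le_imp_inverse_le) auto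
        then show ?thesis by (simp add: norm_inverse)
      qed
      have B: "norm (inverse (1 + exp (- a * of_real u))) \<le> 2" if "Re a = 1" "Im a = 1 \<or> Im a = -1" for a
      proof -
        \<comment> \<open>For u \<le> 1 the cosine is positive; for u > 1 one has exp (-u) \<le>
          1/2.\<close>
        have "1/2 \<le> 1 + exp (- u) * cos u"
        proof (cases "u \<le> 1")
          case True
          then have "cos u > 0" using u pi_gt3 by (intro cos_gt_zero) auto
          then show ?thesis by (simp add: add_nonneg_nonneg less_imp_le)
        next
          case False
          have "2 \<le> exp (1::real)" using exp_ge_add_one_self[of 1] by simp
          also have "\<dots> \<le> exp u" using False by simp
          finally have "exp (- u) \<le> 1/2" by (simp add: exp_minus field_simps)
          moreover have "- exp (- u) \<le> exp (- u) * cos u"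
            using mult_left_mono[OF cos_ge_minus_one[of u], of "exp (- u)"] by simp
          ultimately show ?thesis by linarith
        qed
        also have "\<dots> = Re (1 + exp (- a * of_real u))" using that by (auto simp: Re_exp)
        also have "\<dots> \<le> norm (1 + exp (- a * of_real u))" by (rule complex_Re_le_cmod)
        finally have "inverse (norm (1 + exp (- a * of_real u))) \<le> inverse (1/2)"
          by (intro le_imp_inverse_le) auto
        then show ?thesis by (simp add: norm_inverse)
      qed
      have "norm (zint 2 [1, 1, -1, -1] \<omega> u) = u ^ 2 * exp (- (Re \<omega> * u)) *
        (norm (inverse (1 - exp (- (quartet ! 0) * of_real u))) * (norm (inverse (1 - exp (- (quartet ! 1) * of_real u))) *
        (norm (inverse (1 + exp (- (quartet ! 2) * of_real u))) * norm (inverse (1 + exp (- (quartet ! 3) * of_real u))))))"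
        unfolding zint_def l4 using u by (simp add: norm_mult norm_power)
      also have "\<dots> \<le> u ^ 2 * exp (- (2 * u)) * ((1 + u) / u * ((1 + u) / u * (2 * 2)))"
        using u \<omega> by (intro mult_mono A B) (auto simp: quartet_def intro!: mult_right_mono)
      also have "\<dots> = ?b u" using u by (simp add: field_simps power2_eq_square)
      also have "\<dots> \<le> norm (?b u)" by simp
      finally show "norm (zint 2 [1, 1, -1, -1] \<omega> u) \<le> norm (?b u)" .
    qed
  qed
qed

text \<open>The exponent is p + 1. For p \<ge> 4 it exceeds the dimension 4 and the series is
  integrated termwise; p = 2 is the exponent 3, where the definition itself is the integral.\<close>

lemma quartet_zeta_integral:
  assumes \<omega>: "Re \<omega> \<ge> 2" and p: "p \<ge> 4 \<and> \<sigma> \<in> {[1, 1, -1, -1], [1, 1, 1, 1]} \<or> p = 2 \<and> \<sigma> = [1, 1, -1, -1]"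
  shows "set_integrable lborel {0<..} (zint p \<sigma> \<omega>)"
    "Gamma (of_nat (Suc p)) * gen_barnes_zeta (of_nat (Suc p)) \<omega> quartet \<sigma> = (CLBINT u:{0<..}. zint p \<sigma> \<omega> u)"
proof -
  have "set_integrable lborel {0<..} (zint p \<sigma> \<omega>) \<and>
    Gamma (of_nat (Suc p)) * gen_barnes_zeta (of_nat (Suc p)) \<omega> quartet \<sigma> = (CLBINT u:{0<..}. zint p \<sigma> \<omega> u)"
  proof (cases "p = 2")
    case False
    then have p': "p \<ge> 4" "\<sigma> \<in> {[1, 1, -1, -1], [1, 1, 1, 1]}" using p by auto
    have j4: "j < length quartet \<longleftrightarrow> j = 0 \<or> j = 1 \<or> j = 2 \<or> j = 3" for j by (auto simp: quartet_def)
    have "quartet \<noteq> []" "length quartet \<le> p" "Re \<omega> \<ge> 1" using p' \<omega> by (auto simp: quartet_def)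
    moreover have "Re (quartet ! j) \<ge> 1" "\<sigma> ! j \<in> {1, -1}" if "j < length quartet" for j
      using that p'(2) unfolding j4 by (auto simp: quartet_def)
    ultimately show ?thesis
      using gen_barnes_zeta_integral[of quartet \<sigma> \<omega> p] unfolding zint_def[abs_def] by blast
  next
    case True
    then have \<sigma>: "\<sigma> = [1, 1, -1, -1]" using p by auto
    have "\<not> Re (of_nat (Suc p)) > of_nat (length quartet)" using True by (simp add: quartet_def)
    then have "gen_barnes_zeta (of_nat (Suc p)) \<omega> quartet \<sigma> = barnes_zeta_integral (of_nat (Suc p)) \<omega> quartet \<sigma>"
      by (simp only: gen_barnes_zeta_def if_False)
    also have "\<dots> = 1 / Gamma (of_nat (Suc p)) * (CLBINT u:{0<..}. zint p \<sigma> \<omega> u)"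
      unfolding barnes_zeta_integral_def
    proof (intro arg_cong[where f = "\<lambda>x. _ * x"] set_lebesgue_integral_cong)
      show "\<forall>u. u \<in> {0<..} \<longrightarrow> of_real u powr (of_nat (Suc p) - 1) * exp (- \<omega> * of_real u) *
          (\<Prod>j<length quartet. inverse (1 - of_int (\<sigma> ! j) * exp (- quartet ! j * of_real u))) = zint p \<sigma> \<omega> u"
      proof (intro allI impI)
        fix u :: real assume "u \<in> {0<..}"
        then have "complex_of_real u powr (of_nat (Suc p) - 1) = of_real u ^ p" by (simp add: powr_nat')
        then show "of_real u powr (of_nat (Suc p) - 1) * exp (- \<omega> * of_real u) *
          (\<Prod>j<length quartet. inverse (1 - of_int (\<sigma> ! j) * exp (- quartet ! j * of_real u))) = zint p \<sigma> \<omega> u"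
          by (simp only: zint_def)
      qed
    qed simp
    finally have g: "gen_barnes_zeta (of_nat (Suc p)) \<omega> quartet \<sigma> = 1 / Gamma (of_nat (Suc p)) * (CLBINT u:{0<..}. zint p \<sigma> \<omega> u)" .
    have "Gamma (of_nat (Suc p) :: complex) = fact p" by (simp add: Gamma_fact)
    then have "Gamma (of_nat (Suc p) :: complex) \<noteq> 0" by simp
    with g zint_2_integrable[OF \<omega>] show ?thesis by (simp add: True \<sigma> del: of_nat_Suc)
  qed
  then show "set_integrable lborel {0<..} (zint p \<sigma> \<omega>)"
    "Gamma (of_nat (Suc p)) * gen_barnes_zeta (of_nat (Suc p)) \<omega> quartet \<sigma> = (CLBINT u:{0<..}. zint p \<sigma> \<omega> u)" by auto
qed

lemma zeta_combination:
  assumes p: "p \<ge> 4 \<and> \<sigma> \<in> {[1, 1, -1, -1], [1, 1, 1, 1]} \<or> p = 2 \<and> \<sigma> = [1, 1, -1, -1]"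
  shows "set_integrable lborel {0<..} (\<lambda>u. (\<Sum>j=1..4::nat. f j * zint p \<sigma> (3 + \<i> ^ j) u))"
    "Gamma (of_nat (Suc p)) * (\<Sum>j=1..4::nat. f j * gen_barnes_zeta (of_nat (Suc p)) (3 + \<i> ^ j) quartet \<sigma>) =
      (CLBINT u:{0<..}. (\<Sum>j=1..4::nat. f j * zint p \<sigma> (3 + \<i> ^ j) u))"
proof -
  have R: "Re (3 + \<i> ^ j) \<ge> 2" for j
    using abs_Re_le_cmod[of "\<i> ^ j"] by (simp add: norm_power)
  note q = quartet_zeta_integral[OF R p]
  have i: "set_integrable lborel {0<..} (\<lambda>u. f j * zint p \<sigma> (3 + \<i> ^ j) u)" for j
    by (intro set_integrable_mult_right q(1))
  then show "set_integrable lborel {0<..} (\<lambda>u. (\<Sum>j=1..4::nat. f j * zint p \<sigma> (3 + \<i> ^ j) u))"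
    unfolding set_integrable_def scaleR_sum_right by (intro Bochner_Integration.integrable_sum)
  have "(CLBINT u:{0<..}. (\<Sum>j=1..4::nat. f j * zint p \<sigma> (3 + \<i> ^ j) u)) = (\<Sum>j=1..4::nat. (CLBINT u:{0<..}. f j * zint p \<sigma> (3 + \<i> ^ j) u))"
    using i unfolding set_integrable_def set_lebesgue_integral_def scaleR_sum_right by (intro Bochner_Integration.integral_sum)
  also have "\<dots> = (\<Sum>j=1..4::nat. f j * (Gamma (of_nat (Suc p)) * gen_barnes_zeta (of_nat (Suc p)) (3 + \<i> ^ j) quartet \<sigma>))"
    unfolding q(2) by simp
  finally show "Gamma (of_nat (Suc p)) * (\<Sum>j=1..4::nat. f j * gen_barnes_zeta (of_nat (Suc p)) (3 + \<i> ^ j) quartet \<sigma>) =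
      (CLBINT u:{0<..}. (\<Sum>j=1..4::nat. f j * zint p \<sigma> (3 + \<i> ^ j) u))"
    by (simp only: sum_distrib_left mult.left_commute)
qed

lemma sinh_sin_rot:
  fixes w :: complex
  shows "2 * sinh (w + \<i> * w) - 2 * sin (w + \<i> * w) = 2 * (1 - \<i>) * (sinh w * cos w - cosh w * sin w)"
    "2 * sinh (w + \<i> * w) + 2 * sin (w + \<i> * w) = 2 * (1 + \<i>) * (sinh w * cos w + cosh w * sin w)"
    "sinh (\<i> * w) = \<i> * sin w" "cosh (\<i> * w) = cos w" "sin (\<i> * w) = \<i> * sinh w" "cos (\<i> * w) = cosh w"
proof -
  have i: "\<i> * (\<i> * w) = - w" by simp
  show 1: "sinh (\<i> * w) = \<i> * sin w" "cosh (\<i> * w) = cos w" "sin (\<i> * w) = \<i> * sinh w" "cos (\<i> * w) = cosh w"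
    by (simp_all only: sinh_eq_sin cosh_eq_cos i sin_minus cos_minus) simp_all
  show "2 * sinh (w + \<i> * w) - 2 * sin (w + \<i> * w) = 2 * (1 - \<i>) * (sinh w * cos w - cosh w * sin w)"
    "2 * sinh (w + \<i> * w) + 2 * sin (w + \<i> * w) = 2 * (1 + \<i>) * (sinh w * cos w + cosh w * sin w)"
    unfolding sinh_add sin_add 1 by (simp_all add: algebra_simps)
qed

text \<open>With f the kernel, i f(i w) = i^p w^p / (sinh w cosh w cos^2 w). Over a common
  denominator f(w) - i f(i w) has numerator sinh w cos w - i^p cosh w sin w, so p mod 4 selects the
  combination.\<close>

lemma kernel_combination_cosh:
  fixes w :: complex
  assumes nz: "sin w \<noteq> 0" "cos w \<noteq> 0" "sinh w \<noteq> 0" "cosh w \<noteq> 0"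
  shows "\<i> ^ p = 1 \<Longrightarrow> w ^ p * (sinh w * cos w - cosh w * sin w) / (sinh w * (cosh w)\<^sup>2 * sin w * (cos w)\<^sup>2) =
      trig_kernel cosh p w - \<i> * trig_kernel cosh p (\<i> * w)"
    and "\<i> ^ p = -1 \<Longrightarrow> w ^ p * (sinh w * cos w + cosh w * sin w) / (sinh w * (cosh w)\<^sup>2 * sin w * (cos w)\<^sup>2) =
      trig_kernel cosh p w - \<i> * trig_kernel cosh p (\<i> * w)"
  using nz unfolding trig_kernel_def power_mult_distrib sinh_sin_rot
  by (simp_all add: divide_simps) (simp_all add: algebra_simps power2_eq_square)

lemma kernel_combination_sinh:
  fixes w :: complex
  assumes nz: "sin w \<noteq> 0" "cos w \<noteq> 0" "sinh w \<noteq> 0" "cosh w \<noteq> 0"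
  \<comment> \<open>Compared with the cosh case, sinh^2 (i w) = - sin^2 w reverses the sign of the
    second term. This is why the coefficients i and -i trade places between the two sign
    patterns.\<close>
  shows "\<i> ^ p = 1 \<Longrightarrow> w ^ p * (sinh w * cos w + cosh w * sin w) / ((sinh w)\<^sup>2 * cosh w * (sin w)\<^sup>2 * cos w) =
      trig_kernel sinh p w - \<i> * trig_kernel sinh p (\<i> * w)"
    and "\<i> ^ p = -1 \<Longrightarrow> - (w ^ p * (sinh w * cos w - cosh w * sin w) / ((sinh w)\<^sup>2 * cosh w * (sin w)\<^sup>2 * cos w)) =
      trig_kernel sinh p w - \<i> * trig_kernel sinh p (\<i> * w)"
  using nz unfolding trig_kernel_def power_mult_distrib sinh_sin_rot
  by (simp_all add: divide_simps) (simp_all add: algebra_simps power2_eq_square)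

lemma of_real_eq_rot: "of_real u = (1 + \<i>) * rot (of_real u)" "of_real u = rot (of_real u) + \<i> * rot (of_real u)"
  by (simp_all add: rot_def complex_eq_iff)

lemma cosh_sinh_of_real: "cosh (complex_of_real x) = of_real (cosh x)" "sinh (complex_of_real x) = of_real (sinh x)"
  by (simp_all add: cosh_field_def sinh_field_def exp_of_real[symmetric])

text \<open>The duplication formula makes 16 sinh (2 w) sinh (2 i w) equal to 64 i sinh w cosh w sin
  w cos w. The remaining factors are cosh w cos w, or i sinh w sin w, which changes 64 i into
  -64.\<close>

lemma zint_sum:
  fixes u :: real and f :: "nat \<Rightarrow> complex"
  defines "w \<equiv> rot (of_real u)"
  assumes S: "(\<Sum>j=1..4::nat. f j * exp (- (\<i> ^ j * of_real u))) = S"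
  shows "(\<Sum>j=1..4::nat. f j * zint p [1, 1, -1, -1] (3 + \<i> ^ j) u) =
      (1 + \<i>) ^ p / (64 * \<i>) * (w ^ p * S / (sinh w * (cosh w)\<^sup>2 * sin w * (cos w)\<^sup>2))"
    "(\<Sum>j=1..4::nat. f j * zint p [1, 1, 1, 1] (3 + \<i> ^ j) u) =
      - ((1 + \<i>) ^ p) / 64 * (w ^ p * S / ((sinh w)\<^sup>2 * cosh w * (sin w)\<^sup>2 * cos w))"
proof -
  have up: "of_real u ^ p = (1 + \<i>) ^ p * w ^ p"
    unfolding w_def by (subst of_real_eq_rot(1)) (rule power_mult_distrib)
  have "(\<Sum>j=1..4::nat. f j * zint p [1, 1, -1, -1] (3 + \<i> ^ j) u) =
      of_real u ^ p * S / (16 * sinh (2 * w) * sinh (2 * (\<i> * w)) * cosh w * cosh (\<i> * w))"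
    unfolding zint_eq w_def[symmetric] S[symmetric] sum_distrib_left sum_divide_distrib by (simp add: mult_ac)
  also have "\<dots> = (1 + \<i>) ^ p / (64 * \<i>) * (w ^ p * S / (sinh w * (cosh w)\<^sup>2 * sin w * (cos w)\<^sup>2))"
    unfolding up sinh_double sinh_sin_rot by (simp add: power2_eq_square mult_ac)
  finally show "(\<Sum>j=1..4::nat. f j * zint p [1, 1, -1, -1] (3 + \<i> ^ j) u) =
      (1 + \<i>) ^ p / (64 * \<i>) * (w ^ p * S / (sinh w * (cosh w)\<^sup>2 * sin w * (cos w)\<^sup>2))" .
  have "(\<Sum>j=1..4::nat. f j * zint p [1, 1, 1, 1] (3 + \<i> ^ j) u) =
      of_real u ^ p * S / (16 * sinh (2 * w) * sinh (2 * (\<i> * w)) * sinh w * sinh (\<i> * w))"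
    unfolding zint_eq w_def[symmetric] S[symmetric] sum_distrib_left sum_divide_distrib by (simp add: mult_ac)
  also have "16 * sinh (2 * w) * sinh (2 * (\<i> * w)) * sinh w * sinh (\<i> * w) = - (64 * ((sinh w)\<^sup>2 * cosh w * (sin w)\<^sup>2 * cos w))"
    unfolding sinh_double sinh_sin_rot by (simp add: power2_eq_square mult_ac)
  finally show "(\<Sum>j=1..4::nat. f j * zint p [1, 1, 1, 1] (3 + \<i> ^ j) u) =
      - ((1 + \<i>) ^ p) / 64 * (w ^ p * S / ((sinh w)\<^sup>2 * cosh w * (sin w)\<^sup>2 * cos w))"
    unfolding up by (simp add: mult_ac)
qed

text \<open>The coefficient is the constant of proportionality between the integrand and
  the rotated kernel, times \<^term>\<open>2 * \<i> * (1 + \<i>) / 2 ^ p\<close>.\<close>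

lemma zeta_value:
  assumes p: "even p"
  shows "\<lbrakk>p \<ge> 4; \<i> ^ p = 1\<rbrakk> \<Longrightarrow> \<exists>U\<in>lem_combination p.
      Gamma (of_nat (Suc p)) * (\<Sum>j=1..4::nat. \<i> powi (int j - 2) * gen_barnes_zeta (of_nat (Suc p)) (3 + \<i> ^ j) quartet [1, 1, -1, -1])
        = ((1 + \<i>) ^ p * (1 - \<i>) / (32 * \<i>)) * (2 * \<i> * (1 + \<i>)) / 2 ^ p * (U / of_real pi)" (is "_ \<Longrightarrow> _ \<Longrightarrow> ?A")
    "\<lbrakk>p = 2 \<or> p \<ge> 4; \<i> ^ p = -1\<rbrakk> \<Longrightarrow> \<exists>U\<in>lem_combination p.
      Gamma (of_nat (Suc p)) * (\<Sum>j=1..4::nat. (- \<i>) powi (int j - 2) * gen_barnes_zeta (of_nat (Suc p)) (3 + \<i> ^ j) quartet [1, 1, -1, -1])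
        = ((1 + \<i>) ^ p * (1 + \<i>) / (32 * \<i>)) * (2 * \<i> * (1 + \<i>)) / 2 ^ p * (U / of_real pi)" (is "_ \<Longrightarrow> _ \<Longrightarrow> ?B")
    "\<lbrakk>p \<ge> 4; \<i> ^ p = 1\<rbrakk> \<Longrightarrow> \<exists>U\<in>lem_combination p.
      Gamma (of_nat (Suc p)) * (\<Sum>j=1..4::nat. (- \<i>) powi (int j - 2) * gen_barnes_zeta (of_nat (Suc p)) (3 + \<i> ^ j) quartet [1, 1, 1, 1])
        = (- ((1 + \<i>) ^ p * (1 + \<i>)) / 32) * (2 * \<i> * (1 + \<i>)) / 2 ^ p * (U / of_real pi)" (is "_ \<Longrightarrow> _ \<Longrightarrow> ?C")
    "\<lbrakk>p \<ge> 4; \<i> ^ p = -1\<rbrakk> \<Longrightarrow> \<exists>U\<in>lem_combination p.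
      Gamma (of_nat (Suc p)) * (\<Sum>j=1..4::nat. \<i> powi (int j - 2) * gen_barnes_zeta (of_nat (Suc p)) (3 + \<i> ^ j) quartet [1, 1, 1, 1])
        = ((1 + \<i>) ^ p * (1 - \<i>) / 32) * (2 * \<i> * (1 + \<i>)) / 2 ^ p * (U / of_real pi)" (is "_ \<Longrightarrow> _ \<Longrightarrow> ?D")
proof -
  have "1 - \<i> \<noteq> 0" "1 + \<i> \<noteq> 0" by (simp_all add: complex_eq_iff)
  then have nz: "(1 + \<i>) ^ p \<noteq> 0" "1 - \<i> \<noteq> 0" "1 + \<i> \<noteq> 0" by simp_all
  have minus: "(\<Sum>j=1..4::nat. \<i> powi (int j - 2) * exp (- (\<i> ^ j * of_real u))) =
      2 * (1 - \<i>) * (sinh (rot (of_real u)) * cos (rot (of_real u)) - cosh (rot (of_real u)) * sin (rot (of_real u)))" for u :: real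
    unfolding sum_exp_roots sinh_sin_rot(1)[symmetric] of_real_eq_rot(2)[symmetric] ..
  have plus: "(\<Sum>j=1..4::nat. (- \<i>) powi (int j - 2) * exp (- (\<i> ^ j * of_real u))) =
      2 * (1 + \<i>) * (sinh (rot (of_real u)) * cos (rot (of_real u)) + cosh (rot (of_real u)) * sin (rot (of_real u)))" for u :: real
    unfolding sum_exp_roots sinh_sin_rot(2)[symmetric] of_real_eq_rot(2)[symmetric] ..
  note nzs = rot_of_real_nonzero
  have regroup: "x / (64 * \<i>) * (y * (2 * c * X) / D) = x * c / (32 * \<i>) * (y * X / D)"
    "- x / 64 * (y * (2 * c * X) / D) = - (x * c) / 32 * (y * X / D)"
    "- x / 64 * (y * (2 * c * X) / D) = x * c / 32 * - (y * X / D)" for x y c X D :: complex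
    by simp_all
  { assume p4: "p \<ge> 4" and ip: "\<i> ^ p = 1"
    have pc: "p \<ge> 4 \<and> [1, 1, -1, -1] \<in> {[1, 1, -1, -1], [1, 1, 1, 1 :: int]} \<or> p = 2 \<and> [1, 1, -1, -1] = [1, 1, -1, -1 :: int]" using p4 by simp
    have "p \<ge> 2" using p4 by simp
    from lemniscatic_sums(1)[OF p this] obtain U where U: "U \<in> lem_combination p"
      "(\<lambda>k. complex_of_real (pi ^ (p + 2) * (real (Suc k) ^ p * (-1) ^ Suc k / (cosh (pi * real (Suc k) / 2))\<^sup>2))) sums U" by blast
    show ?A
    proof (rule bexI[OF _ U(1)], unfold zeta_combination(2)[OF pc], rule integral_trig_kernel[OF square_kernel_cosh[OF \<open>p \<ge> 2\<close>] cosh_sinh_of_real(1) U(2) zeta_combination(1)[OF pc]])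
      show "(1 + \<i>) ^ p * (1 - \<i>) / (32 * \<i>) \<noteq> 0" using nz by simp
      fix u :: real assume u: "u > 0"
      show "(\<Sum>j=1..4::nat. \<i> powi (int j - 2) * zint p [1, 1, -1, -1] (3 + \<i> ^ j) u) =
         (1 + \<i>) ^ p * (1 - \<i>) / (32 * \<i>) * (trig_kernel cosh p (rot (of_real u)) - \<i> * trig_kernel cosh p (\<i> * rot (of_real u)))"
        unfolding zint_sum(1)[OF minus] kernel_combination_cosh(1)[OF nzs[OF u] ip, symmetric] by (rule regroup(1))
    qed }
  { assume p4: "p = 2 \<or> p \<ge> 4" and ip: "\<i> ^ p = -1"
    have pc: "p \<ge> 4 \<and> [1, 1, -1, -1] \<in> {[1, 1, -1, -1], [1, 1, 1, 1 :: int]} \<or> p = 2 \<and> [1, 1, -1, -1] = [1, 1, -1, -1 :: int]" using p4 by auto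
    have "p \<ge> 2" using p4 by auto
    from lemniscatic_sums(1)[OF p this] obtain U where U: "U \<in> lem_combination p"
      "(\<lambda>k. complex_of_real (pi ^ (p + 2) * (real (Suc k) ^ p * (-1) ^ Suc k / (cosh (pi * real (Suc k) / 2))\<^sup>2))) sums U" by blast
    show ?B
    proof (rule bexI[OF _ U(1)], unfold zeta_combination(2)[OF pc], rule integral_trig_kernel[OF square_kernel_cosh[OF \<open>p \<ge> 2\<close>] cosh_sinh_of_real(1) U(2) zeta_combination(1)[OF pc]])
      show "(1 + \<i>) ^ p * (1 + \<i>) / (32 * \<i>) \<noteq> 0" using nz by simp
      fix u :: real assume u: "u > 0"
      show "(\<Sum>j=1..4::nat. (- \<i>) powi (int j - 2) * zint p [1, 1, -1, -1] (3 + \<i> ^ j) u) =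
         (1 + \<i>) ^ p * (1 + \<i>) / (32 * \<i>) * (trig_kernel cosh p (rot (of_real u)) - \<i> * trig_kernel cosh p (\<i> * rot (of_real u)))"
        unfolding zint_sum(1)[OF plus] kernel_combination_cosh(2)[OF nzs[OF u] ip, symmetric] by (rule regroup(1))
    qed }
  { assume p4: "p \<ge> 4" and ip: "\<i> ^ p = 1"
    have pc: "p \<ge> 4 \<and> [1, 1, 1, 1] \<in> {[1, 1, -1, -1], [1, 1, 1, 1 :: int]} \<or> p = 2 \<and> [1, 1, 1, 1] = [1, 1, -1, -1 :: int]" using p4 by simp
    have "p \<ge> 2" "p \<noteq> 2" using p4 by simp_all
    from lemniscatic_sums(2)[OF p this] obtain U where U: "U \<in> lem_combination p"
      "(\<lambda>k. complex_of_real (pi ^ (p + 2) * (real (Suc k) ^ p * (-1) ^ Suc k / (sinh (pi * real (Suc k) / 2))\<^sup>2))) sums U" by blast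
    show ?C
    proof (rule bexI[OF _ U(1)], unfold zeta_combination(2)[OF pc], rule integral_trig_kernel[OF square_kernel_sinh[OF p4] cosh_sinh_of_real(2) U(2) zeta_combination(1)[OF pc]])
      show "- ((1 + \<i>) ^ p * (1 + \<i>)) / 32 \<noteq> 0" using nz by simp
      fix u :: real assume u: "u > 0"
      show "(\<Sum>j=1..4::nat. (- \<i>) powi (int j - 2) * zint p [1, 1, 1, 1] (3 + \<i> ^ j) u) =
         - ((1 + \<i>) ^ p * (1 + \<i>)) / 32 * (trig_kernel sinh p (rot (of_real u)) - \<i> * trig_kernel sinh p (\<i> * rot (of_real u)))"
        unfolding zint_sum(2)[OF plus] kernel_combination_sinh(1)[OF nzs[OF u] ip, symmetric] by (rule regroup(2))
    qed }
  { assume p4: "p \<ge> 4" and ip: "\<i> ^ p = -1"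
    have pc: "p \<ge> 4 \<and> [1, 1, 1, 1] \<in> {[1, 1, -1, -1], [1, 1, 1, 1 :: int]} \<or> p = 2 \<and> [1, 1, 1, 1] = [1, 1, -1, -1 :: int]" using p4 by simp
    have "p \<ge> 2" "p \<noteq> 2" using p4 by simp_all
    from lemniscatic_sums(2)[OF p this] obtain U where U: "U \<in> lem_combination p"
      "(\<lambda>k. complex_of_real (pi ^ (p + 2) * (real (Suc k) ^ p * (-1) ^ Suc k / (sinh (pi * real (Suc k) / 2))\<^sup>2))) sums U" by blast
    show ?D
    proof (rule bexI[OF _ U(1)], unfold zeta_combination(2)[OF pc], rule integral_trig_kernel[OF square_kernel_sinh[OF p4] cosh_sinh_of_real(2) U(2) zeta_combination(1)[OF pc]])
      show "(1 + \<i>) ^ p * (1 - \<i>) / 32 \<noteq> 0" using nz by simp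
      fix u :: real assume u: "u > 0"
      show "(\<Sum>j=1..4::nat. \<i> powi (int j - 2) * zint p [1, 1, 1, 1] (3 + \<i> ^ j) u) =
         (1 + \<i>) ^ p * (1 - \<i>) / 32 * (trig_kernel sinh p (rot (of_real u)) - \<i> * trig_kernel sinh p (\<i> * rot (of_real u)))"
        unfolding zint_sum(2)[OF minus] kernel_combination_sinh(2)[OF nzs[OF u] ip, symmetric] by (rule regroup(3))
    qed }
qed

lemma of_real_of_rat: "of_real (of_rat x) = (of_rat x :: 'a :: real_field)"
  by (cases x) (simp add: of_rat_rat)

text \<open>Substituting e = Gamma (1/4)^4 / (8 pi) and dividing by pi sends pi e^k to the first
  generator and e^(k + 1) to the second, up to powers of 8 absorbed in the rational
  coefficients.\<close>

lemma lem_combination_rat_span: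
  assumes U: "U \<in> lem_combination (2 * k)" and c: "c \<in> \<rat>"
  shows "c * (U / of_real pi) \<in> rat_span2 (Gamma (1/4) ^ (4 * k) / pi ^ k) (Gamma (1/4) ^ (4 * k + 4) / pi ^ (k + 2))"
proof -
  let ?G = "Gamma (1/4) :: real"
  obtain r s where rs: "r \<in> \<rat>" "s \<in> \<rat>" "U = r * (lem_half\<^sup>2) ^ (k + 1) + s * of_real pi * (lem_half\<^sup>2) ^ k"
    using U unfolding lem_combination_def by auto
  have "c * s / 8 ^ k \<in> \<rat>" "c * r / 8 ^ (k + 1) \<in> \<rat>" using c rs by auto
  then obtain x y where xy: "c * s / 8 ^ k = of_rat x" "c * r / 8 ^ (k + 1) = of_rat y"
    by (auto elim!: Rats_cases)
  have e: "(lem_half\<^sup>2) ^ k = of_real (?G ^ (4 * k) / pi ^ k) / 8 ^ k" for k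
    unfolding lem_half_Gamma by (simp add: power_divide power_mult_distrib power_mult)
  have "c * (U / of_real pi) = c * s / 8 ^ k * of_real (?G ^ (4 * k) / pi ^ k) + c * r / 8 ^ (k + 1) * of_real (?G ^ (4 * (k + 1)) / pi ^ (k + 2))"
    unfolding rs(3) e by (simp add: field_simps)
  also have "\<dots> = complex_of_real (of_rat x * (?G ^ (4 * k) / pi ^ k) + of_rat y * (?G ^ (4 * k + 4) / pi ^ (k + 2)))"
    unfolding xy by (simp add: of_real_of_rat add.commute)
  finally show ?thesis unfolding rat_span2_def by blast
qed

lemma one_plus_i_power: "(1 + \<i>) ^ (4 * m) = (- 4) ^ m" "\<i> ^ (4 * m) = 1" "(- 4) ^ m \<in> (\<rat> :: complex set)"
proof -
  have "(1 + \<i>) ^ 4 = - 4" "\<i> ^ 4 = 1" by (simp_all add: eval_nat_numeral algebra_simps)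
  then show "(1 + \<i>) ^ (4 * m) = (- 4) ^ m" "\<i> ^ (4 * m) = 1" by (simp_all add: power_mult)
  show "(- 4) ^ m \<in> (\<rat> :: complex set)" by simp
qed

theorem theorem5p10:
  fixes G :: real and a :: "complex list" and \<sigma> :: "int list"
  assumes G: "G = Gamma (1/4)"
    and a: "a = [2 - 2 * \<i>, 2 + 2 * \<i>, 1 - \<i>, 1 + \<i>]"
    and \<sigma>: "\<sigma> = [1, 1, -1, -1]"
  shows
    "(\<forall>m::nat. m \<ge> 1 \<longrightarrow>
        Gamma (4 * of_nat m + 1) *
          (\<Sum>j=1..4::nat. \<i> powi (int j - 2) * gen_barnes_zeta (4 * of_nat m + 1) (3 + \<i> ^ j) a \<sigma>)
        \<in> rat_span2 (G ^ (8*m) / pi ^ (2*m)) (G ^ (8*m + 4) / pi ^ (2*m + 2))) \<and>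
     (\<forall>m::nat. m \<ge> 1 \<longrightarrow>
        Gamma (4 * of_nat m - 1) *
          (\<Sum>j=1..4::nat. (- \<i>) powi (int j - 2) * gen_barnes_zeta (4 * of_nat m - 1) (3 + \<i> ^ j) a \<sigma>)
        \<in> rat_span2 (G ^ (8*m - 4) / pi ^ (2*m - 1)) (G ^ (8*m) / pi ^ (2*m + 1))) \<and>
     (\<forall>m::nat. m \<ge> 1 \<longrightarrow>
        Gamma (4 * of_nat m + 1) *
          (\<Sum>j=1..4::nat. (- \<i>) powi (int j - 2) * barnes_zeta (4 * of_nat m + 1) (3 + \<i> ^ j) a)
        \<in> rat_span2 (G ^ (8*m) / pi ^ (2*m)) (G ^ (8*m + 4) / pi ^ (2*m + 2))) \<and>
     (\<forall>m::nat. m \<ge> 2 \<longrightarrow>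
        Gamma (4 * of_nat m - 1) *
          (\<Sum>j=1..4::nat. \<i> powi (int j - 2) * barnes_zeta (4 * of_nat m - 1) (3 + \<i> ^ j) a)
        \<in> rat_span2 (G ^ (8*m - 4) / pi ^ (2*m - 1)) (G ^ (8*m) / pi ^ (2*m + 1)))"
proof -
  have q: "a = quartet" unfolding a quartet_def ..
  have rep: "replicate (length a) 1 = [1, 1, 1, 1 :: int]" by (simp add: a eval_nat_numeral)
  have s1: "4 * of_nat m + 1 = (of_nat (Suc (4 * m)) :: complex)" for m by simp
  have s3: "4 * of_nat m - 1 = (of_nat (Suc (4 * m - 2)) :: complex)" if "m \<ge> 1" for m
  proof -
    have "Suc (4 * m - 2) + 1 = 4 * m" using that by simp
    then have "of_nat (Suc (4 * m - 2)) + 1 = (4 * of_nat m :: complex)" by (metis of_nat_1 of_nat_add of_nat_mult of_nat_numeral)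
    then show ?thesis by (simp add: eq_diff_eq)
  qed
  \<comment> \<open>The exponents of the zeta function are p + 1 with p = 4 m or p = 4 m - 2, so i^p
    is 1 or -1. The second case is reduced to (1 + i)^4 = -4 by splitting off (1 + i)^2 = 2
    i.\<close>
  have i2: "\<i> ^ (4 * m - 2) = -1" and o2: "(1 + \<i>) ^ (4 * m - 2) = (-4) ^ m / (2 * \<i>)" if "m \<ge> 1" for m
  proof -
    have "4 * m - 2 + 2 = 4 * m" using that by simp
    then have "\<i> ^ (4 * m - 2) * \<i>\<^sup>2 = 1" "(1 + \<i>) ^ (4 * m - 2) * (1 + \<i>)\<^sup>2 = (-4) ^ m"
      unfolding power_add[symmetric] by (simp_all only: one_plus_i_power)
    moreover have "(1 + \<i>)\<^sup>2 = 2 * \<i>" by (simp add: power2_eq_square algebra_simps)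
    ultimately show "\<i> ^ (4 * m - 2) = -1" "(1 + \<i>) ^ (4 * m - 2) = (-4) ^ m / (2 * \<i>)"
      by (simp_all add: field_simps minus_equation_iff)
  qed
  have even: "even (4 * m - 2)" for m :: nat by presburger
  have ex1: "4 * (2 * m) = 8 * m" "2 * (2 * m) = 4 * m" for m :: nat by simp_all
  have ex3: "4 * (2 * m - 1) = 8 * m - 4" "2 * (2 * m - 1) = 4 * m - 2" "8 * m - 4 + 4 = 8 * m" "2 * m - 1 + 2 = 2 * m + 1" if "m \<ge> 1" for m :: nat
    using that by auto
  have span1: "c * (U / of_real pi) \<in> rat_span2 (G ^ (8*m) / pi ^ (2*m)) (G ^ (8*m + 4) / pi ^ (2*m + 2))"
    if "U \<in> lem_combination (4 * m)" "c \<in> \<rat>" for c U m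
    using lem_combination_rat_span[of U "2 * m" c] that unfolding ex1 G by simp
  have span3: "c * (U / of_real pi) \<in> rat_span2 (G ^ (8*m - 4) / pi ^ (2*m - 1)) (G ^ (8*m) / pi ^ (2*m + 1))"
    if "U \<in> lem_combination (4 * m - 2)" "c \<in> \<rat>" "m \<ge> 1" for c U m
    using lem_combination_rat_span[of U "2 * m - 1" c] that(1,2) unfolding ex3[OF that(3)] G by simp
  \<comment> \<open>In each of the four cases the factors 1 + i, 1 - i and i cancel to a rational
    number, as membership in the rational span requires.\<close>
  have c1: "((1 + \<i>) ^ (4 * m) * (1 - \<i>) / (32 * \<i>)) * (2 * \<i> * (1 + \<i>)) / 2 ^ (4 * m) = (-4) ^ m / (8 * 2 ^ (4 * m))" for m
    unfolding one_plus_i_power by (simp add: field_simps)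
  have c3: "(- ((1 + \<i>) ^ (4 * m) * (1 + \<i>)) / 32) * (2 * \<i> * (1 + \<i>)) / 2 ^ (4 * m) = (-4) ^ m / (8 * 2 ^ (4 * m))" for m
    unfolding one_plus_i_power by (simp add: field_simps)
  have c2: "((1 + \<i>) ^ (4 * m - 2) * (1 + \<i>) / (32 * \<i>)) * (2 * \<i> * (1 + \<i>)) / 2 ^ (4 * m - 2) = (-4) ^ m / (16 * 2 ^ (4 * m - 2))"
    and c4: "((1 + \<i>) ^ (4 * m - 2) * (1 - \<i>) / 32) * (2 * \<i> * (1 + \<i>)) / 2 ^ (4 * m - 2) = (-4) ^ m / (16 * 2 ^ (4 * m - 2))"
    if "m \<ge> 1" for m
    unfolding o2[OF that] by (simp_all add: field_simps)
  show ?thesis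
  proof (intro conjI allI impI)
    fix m :: nat assume m: "m \<ge> 1"
    have "\<exists>U\<in>lem_combination (4 * m). Gamma (4 * of_nat m + 1) *
          (\<Sum>j=1..4::nat. \<i> powi (int j - 2) * gen_barnes_zeta (4 * of_nat m + 1) (3 + \<i> ^ j) a \<sigma>) = (-4) ^ m / (8 * 2 ^ (4 * m)) * (U / of_real pi)"
      unfolding s1 q \<sigma> c1[symmetric] by (rule zeta_value(1)) (use m one_plus_i_power in auto)
    then show "Gamma (4 * of_nat m + 1) *
          (\<Sum>j=1..4::nat. \<i> powi (int j - 2) * gen_barnes_zeta (4 * of_nat m + 1) (3 + \<i> ^ j) a \<sigma>)
        \<in> rat_span2 (G ^ (8*m) / pi ^ (2*m)) (G ^ (8*m + 4) / pi ^ (2*m + 2))"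
      by (elim bexE) (simp only:, rule span1, auto)
  next
    fix m :: nat assume m: "m \<ge> 1"
    then have p: "4 * m - 2 = 2 \<or> 4 \<le> 4 * m - 2" by presburger
    have "\<exists>U\<in>lem_combination (4 * m - 2). Gamma (4 * of_nat m - 1) *
          (\<Sum>j=1..4::nat. (- \<i>) powi (int j - 2) * gen_barnes_zeta (4 * of_nat m - 1) (3 + \<i> ^ j) a \<sigma>) = (-4) ^ m / (16 * 2 ^ (4 * m - 2)) * (U / of_real pi)"
      unfolding s3[OF m] q \<sigma> c2[OF m, symmetric] by (rule zeta_value(2)[OF even p i2[OF m]])
    then show "Gamma (4 * of_nat m - 1) *
          (\<Sum>j=1..4::nat. (- \<i>) powi (int j - 2) * gen_barnes_zeta (4 * of_nat m - 1) (3 + \<i> ^ j) a \<sigma>)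
        \<in> rat_span2 (G ^ (8*m - 4) / pi ^ (2*m - 1)) (G ^ (8*m) / pi ^ (2*m + 1))"
      by (elim bexE) (simp only:, rule span3, use m in auto)
  next
    fix m :: nat assume m: "m \<ge> 1"
    have "\<exists>U\<in>lem_combination (4 * m). Gamma (4 * of_nat m + 1) *
          (\<Sum>j=1..4::nat. (- \<i>) powi (int j - 2) * barnes_zeta (4 * of_nat m + 1) (3 + \<i> ^ j) a) = (-4) ^ m / (8 * 2 ^ (4 * m)) * (U / of_real pi)"
      unfolding barnes_zeta_def rep unfolding s1 q c3[symmetric] by (rule zeta_value(3)) (use m one_plus_i_power in auto)
    then show "Gamma (4 * of_nat m + 1) *
          (\<Sum>j=1..4::nat. (- \<i>) powi (int j - 2) * barnes_zeta (4 * of_nat m + 1) (3 + \<i> ^ j) a)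
        \<in> rat_span2 (G ^ (8*m) / pi ^ (2*m)) (G ^ (8*m + 4) / pi ^ (2*m + 2))"
      by (elim bexE) (simp only:, rule span1, auto)
  next
    fix m :: nat assume "m \<ge> 2"
    then have m: "m \<ge> 1" and p: "4 \<le> 4 * m - 2" by simp_all
    have "\<exists>U\<in>lem_combination (4 * m - 2). Gamma (4 * of_nat m - 1) *
          (\<Sum>j=1..4::nat. \<i> powi (int j - 2) * barnes_zeta (4 * of_nat m - 1) (3 + \<i> ^ j) a) = (-4) ^ m / (16 * 2 ^ (4 * m - 2)) * (U / of_real pi)"
      unfolding barnes_zeta_def rep unfolding s3[OF m] q c4[OF m, symmetric] by (rule zeta_value(4)[OF even p i2[OF m]])
    then show "Gamma (4 * of_nat m - 1) *
          (\<Sum>j=1..4::nat. \<i> powi (int j - 2) * barnes_zeta (4 * of_nat m - 1) (3 + \<i> ^ j) a)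
        \<in> rat_span2 (G ^ (8*m - 4) / pi ^ (2*m - 1)) (G ^ (8*m) / pi ^ (2*m + 1))"
      by (elim bexE) (simp only:, rule span3, use m in auto)
  qed
qed

end
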